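(* Suppose that $R$ is an $F$-finite reduced ring of characteristic $p > 0$ and $R \subseteq S$ is a finite extension with $S$ reduced. Further suppose that $L$ is a finitely generated $R$-module whose support is $\operatorname{Spec} R$ and $M$ is a finitely generated $S$-module whose support is $\operatorname{Spec} S$. Then $$L_{*R} = \sum_{e \geq 0}\ \sum_{\phi\in \operatorname{Hom}_{R}( {}^e M, L)} \phi\big( {}^e(M_{*S}) \big).$$ In particular, if $L = R$ and $M = S$, then $$\tau_b(R) = \sum_{e \geq 0}\ \sum_{\phi\in\operatorname{Hom}_{R}( {}^e S, R)} \phi\big( {}^e\tau_b(S) \big).$$
   Context: Rings are commutative Noetherian of prime characteristic $p>0$. A ring is $F$-finite if its Frobenius endomorphism is a finite map. $R^\circ$ is the set of elements of $R$ not contained in any minimal prime. For a module $M$ over $R$ and $e\ge 0$, ${}^eM=\{{}^ex : x\in M\}$ is $M$ as an abelian group, with module structure $r\cdot{}^ex={}^e(r^{p^e}x)$; for a subset $N\subseteq M$, ${}^eN=\{{}^ex: x\in N\}$. An $S$-module $M$ is regarded as an $R$-module by restriction, and so is ${}^eM$. Tight interior over $R$: for $c\in R^\circ$ and $e_0\ge 0$ put $M_*[c,p^{e_0}]=\sum_{e\ge e_0}\operatorname{im}(\operatorname{Hom}_R({}^eR,M)\to M,\ g\mapsto g({}^ec))$, and $M_{*R}=\bigcap_{c\in R^\circ}\bigcap_{e_0\ge0}M_*[c,p^{e_0}]$. $M_{*S}$ denotes the tight interior of an $S$-module computed over $S$. Big test ideal: for an $R$-module $N$, the tight closure $0^*_N$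 of $0$ in $N$ is the set of $z\in N$ for which there is $c\in R^\circ$ with ${}^ec\otimes z=0$ in ${}^eR\otimes_R N$ for all $e\gg0$ (tensor product formed via the right structure ${}^ex\cdot s={}^e(s^{p^e}x)$, i.e. the usual $R$-module structure on ${}^eR$ above). $\tau_b(R)=\bigcap_N\operatorname{Ann}_R(0^*_N)$ over all $R$-modules $N$. *)

theory Defs
  imports "HOL-Algebra.Algebra" "HOL-Computational_Algebra.Primes"
begin

section \<open>Rings\<close>

text \<open>Since 1 has additive order \<open>p\<close>, the zero ring is excluded.\<close>

definition char_p_ring :: "nat \<Rightarrow> 'a ring \<Rightarrow> bool" where
  "char_p_ring p R \<longleftrightarrow> cring R \<and> noetherian_ring R \<and> Factorial_Ring.prime p \<and>
     (\<forall>n::nat. [n] \<cdot>\<^bsub>R\<^esub> \<one>\<^bsub>R\<^esub> = \<zero>\<^bsub>R\<^esub> \<longleftrightarrow> p dvd n)"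

definition reduced_ring :: "'a ring \<Rightarrow> bool" where
  "reduced_ring R \<longleftrightarrow>
     (\<forall>x\<in>carrier R. \<forall>n::nat. x [^]\<^bsub>R\<^esub> n = \<zero>\<^bsub>R\<^esub> \<longrightarrow> x = \<zero>\<^bsub>R\<^esub>)"

definition prime_spec :: "'a ring \<Rightarrow> 'a set set" where
  "prime_spec R = {P. primeideal P R}"

definition minimal_primes :: "'a ring \<Rightarrow> 'a set set" where
  "minimal_primes R = {P \<in> prime_spec R. \<forall>Q\<in>prime_spec R. Q \<subseteq> P \<longrightarrow> Q = P}"

definition off_minimal_primes :: "'a ring \<Rightarrow> 'a set" where
  "off_minimal_primes R = carrier R - \<Union>(minimal_primes R)"


section \<open>Modules\<close>

text \<open>The fields \<open>mult\<close> and \<open>one\<close> that a module record inherits from rings play no role below.\<close>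

definition ring_module :: "'a ring \<Rightarrow> ('a, 'a) module" where
  "ring_module R = \<lparr>carrier = carrier R, monoid.mult = (\<otimes>\<^bsub>R\<^esub>), one = \<one>\<^bsub>R\<^esub>,
     ring.zero = \<zero>\<^bsub>R\<^esub>, add = (\<oplus>\<^bsub>R\<^esub>), smult = (\<otimes>\<^bsub>R\<^esub>)\<rparr>"

text \<open>The module \<open>\<^sup>eM\<close>. Its elements are those of \<open>M\<close> itself, so \<open>\<^sup>ex\<close> is just \<open>x\<close>
  and \<open>\<^sup>eN\<close> is just \<open>N\<close>.\<close>

definition frob_module :: "nat \<Rightarrow> nat \<Rightarrow> 'a ring \<Rightarrow> ('a, 'm) module \<Rightarrow> ('a, 'm) module" where
  "frob_module p e R M = M\<lparr>smult := \<lambda>r x. (r [^]\<^bsub>R\<^esub> (p ^ e)) \<odot>\<^bsub>M\<^esub> x\<rparr>"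

text \<open>Homomorphisms are unconstrained outside the carrier, so one mathematical homomorphism
  may be represented by several functions. Only their images of subsets of the carrier are used.\<close>

definition Hom_module :: "'a ring \<Rightarrow> ('a, 'm) module \<Rightarrow> ('a, 'n) module \<Rightarrow> ('m \<Rightarrow> 'n) set" where
  "Hom_module R M N = {f \<in> carrier M \<rightarrow> carrier N.
     (\<forall>x\<in>carrier M. \<forall>y\<in>carrier M. f (x \<oplus>\<^bsub>M\<^esub> y) = f x \<oplus>\<^bsub>N\<^esub> f y) \<and>
     (\<forall>r\<in>carrier R. \<forall>x\<in>carrier M. f (r \<odot>\<^bsub>M\<^esub> x) = r \<odot>\<^bsub>N\<^esub> f x)}"

definition fg_module :: "'a ring \<Rightarrow> ('a, 'm) module \<Rightarrow> bool" where
  "fg_module R M \<longleftrightarrow> module R M \<and>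
     (\<exists>A. finite A \<and> A \<subseteq> carrier M \<and>
        carrier M = {(\<Oplus>\<^bsub>M\<^esub>a\<in>A. r a \<odot>\<^bsub>M\<^esub> a) | r. r \<in> A \<rightarrow> carrier R})"

text \<open>The sum of a (possibly infinite) family of submodules of \<open>M\<close>.\<close>

definition submodule_sum :: "('a, 'm) module \<Rightarrow> 'i set \<Rightarrow> ('i \<Rightarrow> 'm set) \<Rightarrow> 'm set" where
  "submodule_sum M I F =
     {(\<Oplus>\<^bsub>M\<^esub>i\<in>J. x i) | J x. finite J \<and> J \<subseteq> I \<and> (\<forall>i\<in>J. x i \<in> F i)}"

definition annihilator :: "'a ring \<Rightarrow> ('a, 'm) module \<Rightarrow> 'm set \<Rightarrow> 'a set" where
  "annihilator R M B = {r \<in> carrier R. \<forall>x\<in>B. r \<odot>\<^bsub>M\<^esub> x = \<zero>\<^bsub>M\<^esub>}"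

text \<open>\<open>localization M U\<close> is the set of fractions \<open>U\<^sup>-\<^sup>1M\<close>.\<close>

definition frac_rel :: "('a, 'm) module \<Rightarrow> 'a set \<Rightarrow> (('m \<times> 'a) \<times> ('m \<times> 'a)) set" where
  "frac_rel M U = {((x, s), (y, t)). x \<in> carrier M \<and> y \<in> carrier M \<and> s \<in> U \<and> t \<in> U \<and>
     (\<exists>u\<in>U. u \<odot>\<^bsub>M\<^esub> (t \<odot>\<^bsub>M\<^esub> x) = u \<odot>\<^bsub>M\<^esub> (s \<odot>\<^bsub>M\<^esub> y))}"

definition localization :: "('a, 'm) module \<Rightarrow> 'a set \<Rightarrow> ('m \<times> 'a) set set" where
  "localization M U = (carrier M \<times> U) // frac_rel M U"

definition module_support :: "'a ring \<Rightarrow> ('a, 'm) module \<Rightarrow> 'a set set" where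
  "module_support R M = {P \<in> prime_spec R.
     localization M (carrier R - P) \<noteq> {frac_rel M (carrier R - P) `` {(\<zero>\<^bsub>M\<^esub>, \<one>\<^bsub>R\<^esub>)}}}"

definition F_finite :: "nat \<Rightarrow> 'a ring \<Rightarrow> bool" where
  "F_finite p R \<longleftrightarrow> fg_module R (frob_module p 1 R (ring_module R))"

text \<open>An extension is a literal inclusion, so restriction of scalars from \<open>S\<close> to \<open>R\<close>
  leaves a module record unchanged.\<close>

definition finite_extension :: "'a ring \<Rightarrow> 'a ring \<Rightarrow> bool" where
  "finite_extension R S \<longleftrightarrow> subring (carrier R) S \<and> R = S\<lparr>carrier := carrier R\<rparr> \<and>
     fg_module R (ring_module S)"


section \<open>Tensor products\<close>

definition tensor_relations ::
    "'a ring \<Rightarrow> ('a, 'm) module \<Rightarrow> ('a, 'n) module \<Rightarrow> (('m \<times> 'n) \<Rightarrow>\<^sub>0 int) set" where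
  "tensor_relations R M N =
     {frag_of (x \<oplus>\<^bsub>M\<^esub> x', y) - frag_of (x, y) - frag_of (x', y) | x x' y.
        x \<in> carrier M \<and> x' \<in> carrier M \<and> y \<in> carrier N} \<union>
     {frag_of (x, y \<oplus>\<^bsub>N\<^esub> y') - frag_of (x, y) - frag_of (x, y') | x y y'.
        x \<in> carrier M \<and> y \<in> carrier N \<and> y' \<in> carrier N} \<union>
     {frag_of (r \<odot>\<^bsub>M\<^esub> x, y) - frag_of (x, r \<odot>\<^bsub>N\<^esub> y) | r x y.
        r \<in> carrier R \<and> x \<in> carrier M \<and> y \<in> carrier N}"

definition tensor_kernel ::
    "'a ring \<Rightarrow> ('a, 'm) module \<Rightarrow> ('a, 'n) module \<Rightarrow> (('m \<times> 'n) \<Rightarrow>\<^sub>0 int) set" where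
  "tensor_kernel R M N =
     generate (free_Abelian_group (carrier M \<times> carrier N)) (tensor_relations R M N)"

definition tensor_product ::
    "'a ring \<Rightarrow> ('a, 'm) module \<Rightarrow> ('a, 'n) module \<Rightarrow> (('m \<times> 'n) \<Rightarrow>\<^sub>0 int) set monoid" where
  "tensor_product R M N =
     free_Abelian_group (carrier M \<times> carrier N) Mod tensor_kernel R M N"

definition pure_tensor ::
    "'a ring \<Rightarrow> ('a, 'm) module \<Rightarrow> ('a, 'n) module \<Rightarrow> 'm \<Rightarrow> 'n \<Rightarrow> (('m \<times> 'n) \<Rightarrow>\<^sub>0 int) set" where
  "pure_tensor R M N x y =
     tensor_kernel R M N #>\<^bsub>free_Abelian_group (carrier M \<times> carrier N)\<^esub> frag_of (x, y)"


section \<open>Tight interior and the big test ideal\<close>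

definition tight_interior_at ::
    "nat \<Rightarrow> 'a ring \<Rightarrow> ('a, 'm) module \<Rightarrow> 'a \<Rightarrow> nat \<Rightarrow> 'm set" where
  "tight_interior_at p R M c e\<^sub>0 =
     submodule_sum M {e\<^sub>0..}
       (\<lambda>e. (\<lambda>g. g c) ` Hom_module R (frob_module p e R (ring_module R)) M)"

definition tight_interior :: "nat \<Rightarrow> 'a ring \<Rightarrow> ('a, 'm) module \<Rightarrow> 'm set" where
  "tight_interior p R M =
     (\<Inter>c\<in>off_minimal_primes R. \<Inter>e\<^sub>0. tight_interior_at p R M c e\<^sub>0)"

text \<open>The tensor product is written additively in the mathematics; its zero is the \<open>\<one>\<close> of
  the quotient group.\<close>

definition tight_closure_zero :: "nat \<Rightarrow> 'a ring \<Rightarrow> ('a, 'n) module \<Rightarrow> 'n set" where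
  "tight_closure_zero p R N = {z \<in> carrier N. \<exists>c\<in>off_minimal_primes R. \<exists>e\<^sub>0. \<forall>e\<ge>e\<^sub>0.
     pure_tensor R (frob_module p e R (ring_module R)) N c z =
       \<one>\<^bsub>tensor_product R (frob_module p e R (ring_module R)) N\<^esub>}"

text \<open>HOL cannot quantify over the carrier type inside a definition. The modules \<open>N\<close> below range
  over all module structures on subsets of \<^typ>\<open>'a list\<close>; up to isomorphism these include all
  countably generated modules. Lemma \<open>big_test_ideal_universal\<close> shows that
  the result annihilates \<open>0\<^sup>*\<^sub>N\<close> for modules \<open>N\<close> over every carrier type.\<close>

definition big_test_ideal :: "nat \<Rightarrow> 'a ring \<Rightarrow> 'a set" where
  "big_test_ideal p R =
     {r \<in> carrier R. \<forall>N :: ('a, 'a list) module. module R N \<longrightarrow>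
        r \<in> annihilator R N (tight_closure_zero p R N)}"


section \<open>Independence of the big test ideal from the carrier type\<close>

lemma tensor_relations_carrier:
  assumes "\<And>x y. x \<in> carrier M \<Longrightarrow> y \<in> carrier M \<Longrightarrow> x \<oplus>\<^bsub>M\<^esub> y \<in> carrier M"
    and "\<And>r x. r \<in> carrier R \<Longrightarrow> x \<in> carrier M \<Longrightarrow> r \<odot>\<^bsub>M\<^esub> x \<in> carrier M"
    and "module R N"
  shows "tensor_relations R M N \<subseteq> carrier (free_Abelian_group (carrier M \<times> carrier N))"
proof -
  interpret N: module R N by fact
  show ?thesis
    unfolding tensor_relations_def
    by (auto simp: assms dest!: keys_diff[THEN subsetD])
qed

lemma pure_tensor_eq_one_iff:
  assumes "\<And>x y. x \<in> carrier M \<Longrightarrow> y \<in> carrier M \<Longrightarrow> x \<oplus>\<^bsub>M\<^esub> y \<in> carrier M"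
    and "\<And>r x. r \<in> carrier R \<Longrightarrow> x \<in> carrier M \<Longrightarrow> r \<odot>\<^bsub>M\<^esub> x \<in> carrier M"
    and "module R N" "x \<in> carrier M" "y \<in> carrier N"
  shows "pure_tensor R M N x y = \<one>\<^bsub>tensor_product R M N\<^esub> \<longleftrightarrow>
    frag_of (x, y) \<in> tensor_kernel R M N"
proof -
  interpret F: group "free_Abelian_group (carrier M \<times> carrier N)" by simp
  have sg: "subgroup (tensor_kernel R M N) (free_Abelian_group (carrier M \<times> carrier N))"
    unfolding tensor_kernel_def
    by (rule F.generate_is_subgroup) (rule tensor_relations_carrier[OF assms(1-3)])
  have c: "frag_of (x, y) \<in> carrier (free_Abelian_group (carrier M \<times> carrier N))"
    using assms(4,5) by simp
  show ?thesis
    unfolding pure_tensor_def tensor_product_def one_FactGroup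
    using F.coset_join1[OF _ c sg] F.coset_join2[OF c sg] by blast
qed

lemma tensor_kernel_map:
  assumes M: "\<And>x y. x \<in> carrier M \<Longrightarrow> y \<in> carrier M \<Longrightarrow> x \<oplus>\<^bsub>M\<^esub> y \<in> carrier M"
      "\<And>r x. r \<in> carrier R \<Longrightarrow> x \<in> carrier M \<Longrightarrow> r \<odot>\<^bsub>M\<^esub> x \<in> carrier M"
    and N: "module R N" "module R N'" and f: "f \<in> Hom_module R N N'"
    and x: "x \<in> tensor_kernel R M N"
  shows "frag_extend (\<lambda>(a, n). frag_of (a, f n)) x \<in> tensor_kernel R M N'"
proof -
  let ?F = "frag_extend (\<lambda>(a, n). frag_of (a, f n))"
  have rel: "?F h \<in> tensor_relations R M N'" if "h \<in> tensor_relations R M N" for h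
  proof -
    have cl: "f y \<in> carrier N'" if "y \<in> carrier N" for y
      using f that by (auto simp: Hom_module_def)
    have ad: "f (y \<oplus>\<^bsub>N\<^esub> z) = f y \<oplus>\<^bsub>N'\<^esub> f z" if "y \<in> carrier N" "z \<in> carrier N" for y z
      using f that by (auto simp: Hom_module_def)
    have sm: "f (r \<odot>\<^bsub>N\<^esub> y) = r \<odot>\<^bsub>N'\<^esub> f y" if "r \<in> carrier R" "y \<in> carrier N" for r y
      using f that by (auto simp: Hom_module_def)
    from that consider
      (1) a a' y where "h = frag_of (a \<oplus>\<^bsub>M\<^esub> a', y) - frag_of (a, y) - frag_of (a', y)"
        "a \<in> carrier M" "a' \<in> carrier M" "y \<in> carrier N"
    | (2) a y y' where "h = frag_of (a, y \<oplus>\<^bsub>N\<^esub> y') - frag_of (a, y) - frag_of (a, y')"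
        "a \<in> carrier M" "y \<in> carrier N" "y' \<in> carrier N"
    | (3) r a y where "h = frag_of (r \<odot>\<^bsub>M\<^esub> a, y) - frag_of (a, r \<odot>\<^bsub>N\<^esub> y)"
        "r \<in> carrier R" "a \<in> carrier M" "y \<in> carrier N"
      unfolding tensor_relations_def by blast
    then show ?thesis
    proof cases
      case 1
      then have "?F h = frag_of (a \<oplus>\<^bsub>M\<^esub> a', f y) - frag_of (a, f y) - frag_of (a', f y)"
        by (simp add: frag_extend_diff)
      then show ?thesis using 1 cl unfolding tensor_relations_def by blast
    next
      case 2
      then have "?F h = frag_of (a, f y \<oplus>\<^bsub>N'\<^esub> f y') - frag_of (a, f y) - frag_of (a, f y')"
        by (simp add: frag_extend_diff ad)
      then show ?thesis using 2 cl unfolding tensor_relations_def by blast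
    next
      case 3
      then have "?F h = frag_of (r \<odot>\<^bsub>M\<^esub> a, f y) - frag_of (a, r \<odot>\<^bsub>N'\<^esub> f y)"
        by (simp add: frag_extend_diff sm)
      then show ?thesis using 3 cl unfolding tensor_relations_def by blast
    qed
  qed
  note rc = tensor_relations_carrier[OF M N(1)] tensor_relations_carrier[OF M N(2)]
  from x show ?thesis
    unfolding tensor_kernel_def
  proof (induction rule: generate.induct)
    case one
    then show ?case using generate.one[of "free_Abelian_group (carrier M \<times> carrier N')"] by simp
  next
    case (incl h)
    then show ?case by (intro generate.incl rel)
  next
    case (inv h)
    have "Poly_Mapping.keys h \<subseteq> carrier M \<times> carrier N"
      using subsetD[OF rc(1) inv] by simp
    moreover have "Poly_Mapping.keys (?F h) \<subseteq> carrier M \<times> carrier N'"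
      using subsetD[OF rc(2) rel[OF inv]] by simp
    ultimately show ?case
      using generate.inv[OF rel[OF inv], of "free_Abelian_group (carrier M \<times> carrier N')"]
      by (simp add: frag_extend_minus)
  next
    case (eng h1 h2)
    then show ?case
      using generate.eng[OF eng.IH] by (simp add: frag_extend_add)
  qed
qed

lemma tensor_kernel_finite:
  assumes M: "\<And>x y. x \<in> carrier M \<Longrightarrow> y \<in> carrier M \<Longrightarrow> x \<oplus>\<^bsub>M\<^esub> y \<in> carrier M"
      "\<And>r x. r \<in> carrier R \<Longrightarrow> x \<in> carrier M \<Longrightarrow> r \<odot>\<^bsub>M\<^esub> x \<in> carrier M"
    and N: "module R N" and x: "x \<in> tensor_kernel R M N"
  shows "\<exists>B. finite B \<and> B \<subseteq> carrier N \<and>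
    (\<forall>H. submodule H R N \<longrightarrow> B \<subseteq> H \<longrightarrow> x \<in> tensor_kernel R M (N\<lparr>carrier := H\<rparr>))"
proof -
  have rel: "\<exists>B. finite B \<and> B \<subseteq> carrier N \<and>
      (\<forall>H. submodule H R N \<longrightarrow> B \<subseteq> H \<longrightarrow> h \<in> tensor_relations R M (N\<lparr>carrier := H\<rparr>))"
    if "h \<in> tensor_relations R M N" for h
  proof -
    from that consider
      (1) a a' y where "h = frag_of (a \<oplus>\<^bsub>M\<^esub> a', y) - frag_of (a, y) - frag_of (a', y)"
        "a \<in> carrier M" "a' \<in> carrier M" "y \<in> carrier N"
    | (2) a y y' where "h = frag_of (a, y \<oplus>\<^bsub>N\<^esub> y') - frag_of (a, y) - frag_of (a, y')"
        "a \<in> carrier M" "y \<in> carrier N" "y' \<in> carrier N"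
    | (3) r a y where "h = frag_of (r \<odot>\<^bsub>M\<^esub> a, y) - frag_of (a, r \<odot>\<^bsub>N\<^esub> y)"
        "r \<in> carrier R" "a \<in> carrier M" "y \<in> carrier N"
      unfolding tensor_relations_def by blast
    then show ?thesis
    proof cases
      case 1
      then show ?thesis
        by (intro exI[of _ "{y}"]) (simp add: tensor_relations_def, blast)
    next
      case 2
      then show ?thesis
        by (intro exI[of _ "{y, y'}"]) (simp add: tensor_relations_def, blast)
    next
      case 3
      then show ?thesis
        by (intro exI[of _ "{y}"]) (simp add: tensor_relations_def, blast)
    qed
  qed
  have mH: "module R (N\<lparr>carrier := H\<rparr>)" if "submodule H R N" for H
    using submodule.submodule_is_module[OF that N] .
  note rc = tensor_relations_carrier[OF M N]
  from x show ?thesis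
    unfolding tensor_kernel_def
  proof (induction rule: generate.induct)
    case one
    have "\<one>\<^bsub>free_Abelian_group (carrier M \<times> carrier N)\<^esub> \<in>
        generate (free_Abelian_group (carrier M \<times> carrier (N\<lparr>carrier := H\<rparr>)))
          (tensor_relations R M (N\<lparr>carrier := H\<rparr>))" for H
      using generate.one[of "free_Abelian_group (carrier M \<times> carrier (N\<lparr>carrier := H\<rparr>))"] by simp
    then show ?case by (intro exI[of _ "{}"]) blast
  next
    case (incl h)
    from rel[OF incl] show ?case by (meson generate.incl)
  next
    case (inv h)
    from rel[OF inv] obtain B where B: "finite B" "B \<subseteq> carrier N"
      "\<And>H. submodule H R N \<Longrightarrow> B \<subseteq> H \<Longrightarrow> h \<in> tensor_relations R M (N\<lparr>carrier := H\<rparr>)"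
      by blast
    have kh: "Poly_Mapping.keys h \<subseteq> carrier M \<times> carrier N"
      using subsetD[OF rc inv] by simp
    have "inv\<^bsub>free_Abelian_group (carrier M \<times> carrier N)\<^esub> h \<in>
        generate (free_Abelian_group (carrier M \<times> carrier (N\<lparr>carrier := H\<rparr>)))
          (tensor_relations R M (N\<lparr>carrier := H\<rparr>))" if H: "submodule H R N" "B \<subseteq> H" for H
    proof -
      have "Poly_Mapping.keys h \<subseteq> carrier M \<times> carrier (N\<lparr>carrier := H\<rparr>)"
        using subsetD[OF tensor_relations_carrier[OF M mH[OF H(1)]] B(3)[OF H]] by simp
      then show ?thesis
        using generate.inv[OF B(3)[OF H],
            of "free_Abelian_group (carrier M \<times> carrier (N\<lparr>carrier := H\<rparr>))"] kh
        by simp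
    qed
    then show ?case using B(1,2) by blast
  next
    case (eng h1 h2)
    then obtain B Y where B: "finite B" "B \<subseteq> carrier N"
        "\<forall>H. submodule H R N \<longrightarrow> B \<subseteq> H \<longrightarrow>
          h1 \<in> generate (free_Abelian_group (carrier M \<times> carrier (N\<lparr>carrier := H\<rparr>)))
            (tensor_relations R M (N\<lparr>carrier := H\<rparr>))"
      and Y: "finite Y" "Y \<subseteq> carrier N"
        "\<forall>H. submodule H R N \<longrightarrow> Y \<subseteq> H \<longrightarrow>
          h2 \<in> generate (free_Abelian_group (carrier M \<times> carrier (N\<lparr>carrier := H\<rparr>)))
            (tensor_relations R M (N\<lparr>carrier := H\<rparr>))"
      by blast
    have "h1 \<otimes>\<^bsub>free_Abelian_group (carrier M \<times> carrier N)\<^esub> h2 \<in>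
        generate (free_Abelian_group (carrier M \<times> carrier (N\<lparr>carrier := H\<rparr>)))
          (tensor_relations R M (N\<lparr>carrier := H\<rparr>))" if H: "submodule H R N" "B \<union> Y \<subseteq> H" for H
      using generate.eng[of h1 "free_Abelian_group (carrier M \<times> carrier (N\<lparr>carrier := H\<rparr>))" _ h2]
        B(3) Y(3) H by simp
    then show ?case using B(1,2) Y(1,2) by (intro exI[of _ "B \<union> Y"]) auto
  qed
qed

fun list_comb :: "('a, 'n, 'z) module_scheme \<Rightarrow> (nat \<Rightarrow> 'n) \<Rightarrow> nat \<Rightarrow> 'a list \<Rightarrow> 'n" where
  "list_comb N x k [] = \<zero>\<^bsub>N\<^esub>"
| "list_comb N x k (r # rs) = r \<odot>\<^bsub>N\<^esub> x k \<oplus>\<^bsub>N\<^esub> list_comb N x (Suc k) rs"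

context module
begin

lemma list_comb_closed:
  assumes "range x \<subseteq> carrier M" "set rs \<subseteq> carrier R"
  shows "list_comb M x k rs \<in> carrier M"
  using assms(2)
proof (induction rs arbitrary: k)
  case (Cons r rs)
  have "x k \<in> carrier M" using assms(1) by blast
  then show ?case using Cons by simp
qed simp

lemma list_comb_add:
  assumes x: "range x \<subseteq> carrier M"
  shows "set rs \<subseteq> carrier R \<Longrightarrow> set ss \<subseteq> carrier R \<Longrightarrow>
    \<exists>ts. set ts \<subseteq> carrier R \<and> list_comb M x k ts = list_comb M x k rs \<oplus>\<^bsub>M\<^esub> list_comb M x k ss"
proof (induction rs arbitrary: k ss)
  case Nil
  then show ?case using list_comb_closed[OF x] by (intro exI[of _ ss]) simp
next
  case (Cons r rs)
  have xk: "x k \<in> carrier M" using x by blast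
  show ?case
  proof (cases ss)
    case Nil
    then show ?thesis
      using Cons.prems list_comb_closed[OF x, of "r # rs" k] by (intro exI[of _ "r # rs"]) simp
  next
    case (Cons s ss')
    obtain ts where ts: "set ts \<subseteq> carrier R"
      "list_comb M x (Suc k) ts = list_comb M x (Suc k) rs \<oplus>\<^bsub>M\<^esub> list_comb M x (Suc k) ss'"
      using Cons.IH[of ss' "Suc k"] Cons.prems Cons by auto
    have c: "list_comb M x (Suc k) rs \<in> carrier M" "list_comb M x (Suc k) ss' \<in> carrier M"
      "r \<in> carrier R" "s \<in> carrier R"
      using Cons.prems Cons list_comb_closed[OF x] by auto
    show ?thesis
      using ts c xk Cons
      by (intro exI[of _ "(r \<oplus> s) # ts"]) (simp add: smult_l_distr M.add.m_ac)
  qed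
qed

lemma list_comb_smult:
  assumes x: "range x \<subseteq> carrier M" and a: "a \<in> carrier R"
  shows "set rs \<subseteq> carrier R \<Longrightarrow>
    list_comb M x k (map ((\<otimes>) a) rs) = a \<odot>\<^bsub>M\<^esub> list_comb M x k rs"
proof (induction rs arbitrary: k)
  case (Cons r rs)
  have "x k \<in> carrier M" using x by blast
  then show ?case
    using Cons a list_comb_closed[OF x, of rs] by (simp add: smult_assoc1 smult_r_distr)
qed (use a in simp)

lemma list_comb_mem:
  assumes x: "range x \<subseteq> carrier M"
  shows "\<exists>rs. set rs \<subseteq> carrier R \<and> list_comb M x k rs = x (k + n)"
proof (induction n arbitrary: k)
  case 0
  have "x k \<in> carrier M" using x by blast
  then show ?case by (intro exI[of _ "[\<one>]"]) simp
next
  case (Suc n)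
  obtain rs where rs: "set rs \<subseteq> carrier R" "list_comb M x (Suc k) rs = x (Suc k + n)"
    using Suc by blast
  have "x k \<in> carrier M" "x (Suc (k + n)) \<in> carrier M" using x by blast+
  then show ?case using rs by (intro exI[of _ "\<zero> # rs"]) simp
qed

lemma countable_submodule:
  fixes B
  assumes B: "countable B" "B \<subseteq> carrier M"
  shows "\<exists>H (h :: _ \<Rightarrow> 'a list). submodule H R M \<and> B \<subseteq> H \<and> inj_on h H"
proof -
  define Y where "Y = insert \<zero>\<^bsub>M\<^esub> B"
  define x where "x = from_nat_into Y"
  have rx: "range x = Y"
    unfolding x_def Y_def using B by (intro range_from_nat_into) auto
  then have x: "range x \<subseteq> carrier M" using B(2) by (auto simp: Y_def)
  let ?L = "{rs. set rs \<subseteq> carrier R}"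
  define H where "H = list_comb M x 0 ` ?L"
  have "submodule H R M"
  proof (rule submoduleI)
    show "H \<subseteq> carrier M" unfolding H_def using list_comb_closed[OF x] by auto
    show "\<zero>\<^bsub>M\<^esub> \<in> H" unfolding H_def by (rule image_eqI[of _ _ "[]"]) auto
    show sm: "a \<odot>\<^bsub>M\<^esub> y \<in> H" if a: "a \<in> carrier R" and y: "y \<in> H" for a y
    proof -
      obtain rs where rs: "set rs \<subseteq> carrier R" "y = list_comb M x 0 rs"
        using y unfolding H_def by blast
      have "set (map ((\<otimes>) a) rs) \<subseteq> carrier R" using rs a by auto
      moreover have "a \<odot>\<^bsub>M\<^esub> y = list_comb M x 0 (map ((\<otimes>) a) rs)"
        using list_comb_smult[OF x a rs(1), of 0] rs(2) by simp
      ultimately show ?thesis unfolding H_def by blast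
    qed
    show "y \<oplus>\<^bsub>M\<^esub> z \<in> H" if yz: "y \<in> H" "z \<in> H" for y z
    proof -
      obtain rs ss where *: "set rs \<subseteq> carrier R" "y = list_comb M x 0 rs"
        "set ss \<subseteq> carrier R" "z = list_comb M x 0 ss"
        using yz unfolding H_def by blast
      obtain ts where "set ts \<subseteq> carrier R" "list_comb M x 0 ts = y \<oplus>\<^bsub>M\<^esub> z"
        using list_comb_add[OF x *(1) *(3), of 0] *(2,4) by auto
      then show ?thesis unfolding H_def by (metis (mono_tags) image_eqI mem_Collect_eq)
    qed
    show "\<ominus>\<^bsub>M\<^esub> y \<in> H" if "y \<in> H" for y
    proof -
      have yc: "y \<in> carrier M"
        using that list_comb_closed[OF x] unfolding H_def by auto
      have "\<ominus>\<^bsub>M\<^esub> y = (\<ominus> \<one>) \<odot>\<^bsub>M\<^esub> y"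
        using smult_l_minus[OF R.one_closed yc] yc by simp
      then show ?thesis using sm[OF _ that, of "\<ominus> \<one>"] by simp
    qed
  qed
  moreover have "B \<subseteq> H"
  proof
    fix y assume "y \<in> B"
    then obtain n where n: "y = x n" using rx unfolding Y_def by blast
    obtain rs where "set rs \<subseteq> carrier R" "list_comb M x 0 rs = x n"
      using list_comb_mem[OF x, of 0 n] by auto
    then show "y \<in> H" unfolding H_def n by (metis (mono_tags) image_eqI mem_Collect_eq)
  qed
  moreover have "inj_on (inv_into ?L (list_comb M x 0)) H"
    unfolding H_def by (rule inj_on_inv_into) simp
  ultimately show ?thesis by blast
qed

end

lemma transport_module:
  fixes N :: "('a, 'n) module" and h :: "'n \<Rightarrow> 'm"
  assumes N: "module R N" and h: "inj_on h (carrier N)"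
  shows "\<exists>N' :: ('a, 'm) module. module R N' \<and> h \<in> Hom_module R N N' \<and>
    \<zero>\<^bsub>N'\<^esub> = h \<zero>\<^bsub>N\<^esub>"
proof -
  interpret N: module R N by fact
  define g where "g = inv_into (carrier N) h"
  have gh: "g (h y) = y" if "y \<in> carrier N" for y
    unfolding g_def using h that by (rule inv_into_f_f)
  define N' :: "('a, 'm) module" where
    "N' = \<lparr>carrier = h ` carrier N, monoid.mult = (\<lambda>_ _. undefined), one = undefined,
       ring.zero = h \<zero>\<^bsub>N\<^esub>, add = (\<lambda>a b. h (g a \<oplus>\<^bsub>N\<^esub> g b)), smult = (\<lambda>r a. h (r \<odot>\<^bsub>N\<^esub> g a))\<rparr>"
  have "abelian_group N'"
  proof (rule abelian_groupI)
    fix a assume "a \<in> carrier N'"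
    then obtain y where y: "y \<in> carrier N" "a = h y" by (auto simp: N'_def)
    show "\<exists>b\<in>carrier N'. b \<oplus>\<^bsub>N'\<^esub> a = \<zero>\<^bsub>N'\<^esub>"
      using y by (intro bexI[of _ "h (\<ominus>\<^bsub>N\<^esub> y)"]) (auto simp: N'_def gh N.M.l_neg)
  qed (auto simp: N'_def gh N.M.add.m_ac)
  then have "module R N'"
    by (intro moduleI)
      (auto simp: N'_def gh N.smult_l_distr N.smult_r_distr N.smult_assoc1 intro: N.R.is_cring)
  moreover have "h \<in> Hom_module R N N'"
    by (auto simp: Hom_module_def N'_def gh)
  moreover have "\<zero>\<^bsub>N'\<^esub> = h \<zero>\<^bsub>N\<^esub>" by (simp add: N'_def)
  ultimately show ?thesis by blast
qed

lemma big_test_ideal_universal: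
  fixes N :: "('a, 'n) module"
  assumes N: "module R N" and r: "r \<in> big_test_ideal p R"
  shows "r \<in> annihilator R N (tight_closure_zero p R N)"
proof -
  interpret N: module R N by fact
  have rR: "r \<in> carrier R" using r by (simp add: big_test_ideal_def)
  let ?F = "\<lambda>e. frob_module p e R (ring_module R)"
  have M: "\<And>e x y. x \<in> carrier (?F e) \<Longrightarrow> y \<in> carrier (?F e) \<Longrightarrow> x \<oplus>\<^bsub>?F e\<^esub> y \<in> carrier (?F e)"
    "\<And>e s x. s \<in> carrier R \<Longrightarrow> x \<in> carrier (?F e) \<Longrightarrow> s \<odot>\<^bsub>?F e\<^esub> x \<in> carrier (?F e)"
    by (auto simp: frob_module_def ring_module_def)
  have "r \<odot>\<^bsub>N\<^esub> z = \<zero>\<^bsub>N\<^esub>" if "z \<in> tight_closure_zero p R N" for z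
  proof -
    from that obtain c e\<^sub>0 where z: "z \<in> carrier N" and c: "c \<in> off_minimal_primes R"
      and *: "\<And>e. e \<ge> e\<^sub>0 \<Longrightarrow> pure_tensor R (?F e) N c z = \<one>\<^bsub>tensor_product R (?F e) N\<^esub>"
      unfolding tight_closure_zero_def by blast
    have cR: "c \<in> carrier (?F e)" for e
      using c by (auto simp: off_minimal_primes_def frob_module_def ring_module_def)
    have "frag_of (c, z) \<in> tensor_kernel R (?F e) N" if "e \<ge> e\<^sub>0" for e
      using *[OF that] pure_tensor_eq_one_iff[OF M N cR z] by simp
    then have "\<exists>B. finite B \<and> B \<subseteq> carrier N \<and> (\<forall>H. submodule H R N \<longrightarrow> B \<subseteq> H \<longrightarrow>
        frag_of (c, z) \<in> tensor_kernel R (?F e) (N\<lparr>carrier := H\<rparr>))" if "e \<ge> e\<^sub>0" for e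
      using tensor_kernel_finite[OF M N] that by blast
    then obtain B where B: "\<And>e. e \<ge> e\<^sub>0 \<Longrightarrow> finite (B e) \<and> B e \<subseteq> carrier N \<and>
        (\<forall>H. submodule H R N \<longrightarrow> B e \<subseteq> H \<longrightarrow>
        frag_of (c, z) \<in> tensor_kernel R (?F e) (N\<lparr>carrier := H\<rparr>))"
      by metis
    define Y where "Y = insert z (\<Union>e\<in>{e\<^sub>0..}. B e)"
    have "countable Y" "Y \<subseteq> carrier N"
      unfolding Y_def using B z by (auto intro: countable_finite)
    then obtain H and h :: "'n \<Rightarrow> 'a list"
      where H: "submodule H R N" "Y \<subseteq> H" "inj_on h H"
      using N.countable_submodule by blast
    let ?N = "N\<lparr>carrier := H\<rparr>"
    have mH: "module R ?N" using submodule.submodule_is_module[OF H(1) N] .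
    interpret H: module R ?N by fact
    obtain N' :: "('a, 'a list) module" where N': "module R N'" "h \<in> Hom_module R ?N N'"
      "\<zero>\<^bsub>N'\<^esub> = h \<zero>\<^bsub>N\<^esub>"
      using transport_module[OF mH, of h] H(3) by auto
    have zH: "z \<in> H" using H(2) by (simp add: Y_def)
    then have hz: "h z \<in> carrier N'" using N'(2) by (auto simp: Hom_module_def)
    have "pure_tensor R (?F e) N' c (h z) = \<one>\<^bsub>tensor_product R (?F e) N'\<^esub>" if e: "e \<ge> e\<^sub>0" for e
    proof -
      have "B e \<subseteq> H" using H(2) e by (auto simp: Y_def)
      then have "frag_of (c, z) \<in> tensor_kernel R (?F e) ?N" using B[OF e] H(1) by blast
      from tensor_kernel_map[OF M mH N'(1,2) this]
      show ?thesis using pure_tensor_eq_one_iff[OF M N'(1) cR hz] by simp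
    qed
    then have "h z \<in> tight_closure_zero p R N'"
      unfolding tight_closure_zero_def using hz c by blast
    then have "r \<odot>\<^bsub>N'\<^esub> h z = h \<zero>\<^bsub>N\<^esub>"
      using r N'(1,3) by (auto simp: big_test_ideal_def annihilator_def)
    moreover have "h (r \<odot>\<^bsub>N\<^esub> z) = r \<odot>\<^bsub>N'\<^esub> h z"
      using N'(2) rR zH by (auto simp: Hom_module_def)
    ultimately have eq: "h (r \<odot>\<^bsub>N\<^esub> z) = h \<zero>\<^bsub>N\<^esub>" by simp
    have "r \<odot>\<^bsub>N\<^esub> z \<in> H" "\<zero>\<^bsub>N\<^esub> \<in> H"
      using H.smult_closed[OF rR, of z] zH H.M.zero_closed by auto
    then show ?thesis using eq H(3) by (meson inj_onD)
  qed
  then show ?thesis using rR by (simp add: annihilator_def)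
qed

end

theory Submission
  imports Defs
begin

text \<open>
  Write \<open>R\<degree>\<close> for the complement of the minimal primes and \<open>M\<^sub>*[c, e\<^sub>0]\<close> for the sum of the values
  \<open>g(\<^sup>ec)\<close> over \<open>e \<ge> e\<^sub>0\<close> and \<open>R\<close>-linear \<open>g : \<^sup>eR \<rightarrow> M\<close>. If \<open>y = g(\<^sup>ec)\<close> and \<open>\<phi> : \<^sup>aM \<rightarrow> L\<close> is linear,
  then \<open>\<phi>(\<^sup>ay)\<close> is the value of the composite \<open>\<phi> \<circ> g\<close> at \<open>c\<close>. So tight interiors are carried into
  tight interiors (\<open>tight_interior_Hom\<close>), and both inclusions of the first formula come down to
  finding linear maps to compose with.

  For \<open>\<supseteq>\<close> it is enough that \<open>M\<^sub>*\<^sub>S \<subseteq> M\<^sub>*\<^sub>R\<close>. An element of \<open>M\<^sub>*\<^sub>S\<close> is a sum of values \<open>g(\<^sup>ed)\<close> for any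
  chosen \<open>d \<in> S\<degree>\<close>; given \<open>c \<in> R\<degree>\<close>, one needs an \<open>R\<close>-linear \<open>\<psi> : \<^sup>aR \<rightarrow> S\<close> with \<open>\<psi>(\<^sup>ac) \<in> S\<degree>\<close>. A minimal
  prime \<open>Q\<close> of \<open>S\<close> may lie over a prime \<open>P\<close> of \<open>R\<close> that is not minimal, so \<open>c\<close> itself need not be in
  \<open>S\<degree>\<close>. But \<open>c\<close> is a nonzerodivisor, and by Krull's intersection theorem
  (\<open>Krull_intersection_frobenius_powers\<close>) it is not in \<open>P\<^bsup>[q]\<^esup>R\<^sub>P\<close> for \<open>q = p\<^sup>a\<close> large. Hence it is nonzero
  in \<open>\<^sup>aR \<otimes> \<kappa>(P)\<close> and is detected by a linear map from \<open>\<^sup>aR\<close> to \<open>R/P\<close> (\<open>functional_extension\<close>), which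
  maps to \<open>S\<close> by an element \<open>t \<notin> Q\<close> with \<open>tQ = 0\<close>. Such a \<open>t\<close> exists because \<open>S\<close> is reduced.

  For \<open>\<subseteq>\<close> it is enough that sums of elements \<open>\<phi>(m)\<close>, with \<open>\<phi> : M \<rightarrow> R\<close> linear over \<open>R\<close> and
  \<open>m \<in> M\<^sub>*\<^sub>S\<close>, reach some \<open>c \<in> R\<degree>\<close>: an element of \<open>L\<^sub>*\<^sub>R\<close> is a sum of values \<open>g(\<^sup>ec)\<close>, and so a sum of
  values \<open>(g \<circ> \<phi>)(\<^sup>em)\<close>. Since \<open>M\<close> is supported everywhere, they do once \<open>M\<^sub>*\<^sub>S\<close> contains \<open>sM\<close> for some
  \<open>s \<in> S\<degree>\<close>, a test element (\<open>test_element\<close>).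

  Test elements come from generic freeness of \<open>\<^sup>1R\<close>: some \<open>b \<in> R\<degree>\<close> is such that \<open>b \<cdot> \<^sup>1y\<close> is a combination of
  elements \<open>\<phi>(\<^sup>1y) \<cdot> \<^sup>1x\<close> with linear \<open>\<phi> : \<^sup>1R \<rightarrow> R\<close> (\<open>generic_trace\<close>). The ideal \<open>J = R\<^sub>*[d, e\<^sub>0]\<close> is stable
  under all such \<open>\<phi>\<close>, hence \<open>b\<^sup>pJ \<subseteq> J\<^sup>2\<close>, and Nakayama's lemma puts a power of \<open>b\<close> into \<open>J\<close>.
  Stability again lowers the exponent to \<open>3p\<close>, uniformly in \<open>d\<close> and \<open>e\<^sub>0\<close>.

  The second formula is the case \<open>L = R\<close>, \<open>M = S\<close> of the first, because \<open>\<tau>\<^sub>b(R) = R\<^sub>*\<^sub>R\<close>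
  (\<open>big_test_ideal_eq_tight_interior\<close>). There \<open>\<supseteq>\<close> follows by tensoring \<open>g : \<^sup>eR \<rightarrow> R\<close> with \<open>N\<close>. For \<open>\<subseteq>\<close> there
  is, for given \<open>d\<close> and \<open>e\<^sub>0\<close>, a universal module with an element \<open>z\<close> such that \<open>\<^sup>ed \<otimes> z = 0\<close> for all
  \<open>e \<ge> e\<^sub>0\<close>; the annihilator of this \<open>z\<close> lies in \<open>R\<^sub>*[d, e\<^sub>0]\<close>.
\<close>

section \<open>Ideals and submodules\<close>


lemma (in cring) ideal_criterion:
  assumes "I \<subseteq> carrier R" "\<zero> \<in> I" "\<And>a b. a \<in> I \<Longrightarrow> b \<in> I \<Longrightarrow> a \<oplus> b \<in> I"
    "\<And>a x. a \<in> I \<Longrightarrow> x \<in> carrier R \<Longrightarrow> x \<otimes> a \<in> I"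
  shows "ideal I R"
proof (rule idealI)
  have inv: "\<ominus> a \<in> I" if "a \<in> I" for a
  proof -
    have "\<ominus> a = (\<ominus> \<one>) \<otimes> a" using that assms(1) by (simp add: l_minus subset_iff)
    then show ?thesis using assms(4)[OF that, of "\<ominus> \<one>"] by simp
  qed
  show "subgroup I (add_monoid R)"
    by (rule add.subgroupI) (use assms inv in \<open>auto simp: a_inv_def\<close>)
  show "a \<otimes> x \<in> I" if "a \<in> I" "x \<in> carrier R" for a x
    using assms(1,4) that m_comm[of a x] by auto
qed (use assms ring_axioms in auto)

lemma (in module) submodule_criterion:
  assumes "H \<subseteq> carrier M" "\<zero>\<^bsub>M\<^esub> \<in> H"
    "\<And>a b. a \<in> H \<Longrightarrow> b \<in> H \<Longrightarrow> a \<oplus>\<^bsub>M\<^esub> b \<in> H"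
    "\<And>a x. a \<in> carrier R \<Longrightarrow> x \<in> H \<Longrightarrow> a \<odot>\<^bsub>M\<^esub> x \<in> H"
  shows "submodule H R M"
proof (rule submoduleI)
  fix a assume "a \<in> H"
  then have "\<ominus>\<^bsub>M\<^esub> a = (\<ominus> \<one>) \<odot>\<^bsub>M\<^esub> a"
    using assms(1) smult_l_minus[of \<one> a] by auto
  then show "\<ominus>\<^bsub>M\<^esub> a \<in> H" using assms(4)[OF _ \<open>a \<in> H\<close>, of "\<ominus> \<one>"] by simp
qed (use assms in auto)

lemma (in module) submodule_props:
  assumes "submodule H R M"
  shows "H \<subseteq> carrier M" "\<zero>\<^bsub>M\<^esub> \<in> H"
    "\<And>a b. a \<in> H \<Longrightarrow> b \<in> H \<Longrightarrow> a \<oplus>\<^bsub>M\<^esub> b \<in> H"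
    "\<And>a b. a \<in> H \<Longrightarrow> b \<in> H \<Longrightarrow> a \<ominus>\<^bsub>M\<^esub> b \<in> H"
    "\<And>a x. a \<in> carrier R \<Longrightarrow> x \<in> H \<Longrightarrow> a \<odot>\<^bsub>M\<^esub> x \<in> H"
proof -
  note H = submoduleE[OF assms]
  obtain h where h: "h \<in> H" using H(2) by blast
  then have "\<zero>\<^bsub>M\<^esub> = \<zero> \<odot>\<^bsub>M\<^esub> h" using H(1) by (simp add: subset_iff)
  then show "\<zero>\<^bsub>M\<^esub> \<in> H" using H(4)[OF _ h, of \<zero>] by simp
qed (use submoduleE[OF assms] in \<open>auto simp: a_minus_def\<close>)

section \<open>Minimal primes of a noetherian ring\<close>

locale noetherian_cring = cring R + noetherian_ring R for R :: "'a ring" (structure)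

context noetherian_cring
begin

lemma ex_maximal_ideal:
  assumes "D \<noteq> {}" "\<And>I. I \<in> D \<Longrightarrow> ideal I R"
  shows "\<exists>I\<in>D. \<forall>J\<in>D. I \<subseteq> J \<longrightarrow> J = I"
proof (rule subset_Zorn)
  fix C assume C: "subset.chain D C"
  show "\<exists>U\<in>D. \<forall>I\<in>C. I \<subseteq> U"
  proof (cases "C = {}")
    case False
    have "subset.chain {I. ideal I R} C"
      using C assms(2) unfolding pred_on.chain_def by blast
    then have "\<Union>C \<in> C" by (rule ideal_chain_is_trivial[OF False])
    then have "\<Union>C \<in> D" using C unfolding pred_on.chain_def by blast
    then show ?thesis by (intro bexI[of _ "\<Union>C"]) auto
  qed (use assms(1) in blast)
qed

lemma colon_ideal:
  assumes "ideal I R" "B \<subseteq> carrier R"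
  shows "ideal {x \<in> carrier R. \<forall>b\<in>B. x \<otimes> b \<in> I} R"
proof -
  interpret I: ideal I R by fact
  show ?thesis
  proof (rule ideal_criterion)
    fix a x assume a: "a \<in> {x \<in> carrier R. \<forall>b\<in>B. x \<otimes> b \<in> I}" and x: "x \<in> carrier R"
    have "x \<otimes> a \<otimes> b \<in> I" if b: "b \<in> B" for b
      using a x b assms(2) I.I_l_closed[of "a \<otimes> b" x] by (simp add: m_assoc subset_iff)
    then show "x \<otimes> a \<in> {x \<in> carrier R. \<forall>b\<in>B. x \<otimes> b \<in> I}" using a x by auto
  qed (use assms(2) in \<open>auto simp: l_distr subset_iff\<close>)
qed

text \<open>Noetherian induction: if \<open>I\<close> is maximal among the ideals without such a set \<open>F\<close>, then \<open>I\<close> is not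
  prime, say \<open>ab \<in> I\<close> with \<open>a, b \<notin> I\<close>. The ideals \<open>A = (I : b)\<close> and \<open>B = (I : A)\<close> are strictly larger
  than \<open>I\<close>, and \<open>BA \<subseteq> I\<close>, so the primes found for \<open>A\<close> and for \<open>B\<close> together serve for \<open>I\<close>. For \<open>I = 0\<close> this
  yields that there are finitely many minimal primes, that every prime contains one, and that their
  intersection is nil.\<close>

lemma finite_primes_over_ideal:
  assumes "ideal I R"
  shows "\<exists>F. finite F \<and> (\<forall>P\<in>F. primeideal P R) \<and> (\<forall>Q. primeideal Q R \<longrightarrow> I \<subseteq> Q \<longrightarrow> (\<exists>P\<in>F. P \<subseteq> Q)) \<and>
    (\<forall>x\<in>carrier R. (\<forall>P\<in>F. x \<in> P) \<longrightarrow> (\<exists>n::nat. x [^] n \<in> I))"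
proof (rule ccontr)
  define good where "good I F \<longleftrightarrow> finite F \<and> (\<forall>P\<in>F. primeideal P R) \<and>
    (\<forall>Q. primeideal Q R \<longrightarrow> I \<subseteq> Q \<longrightarrow> (\<exists>P\<in>F. P \<subseteq> Q)) \<and>
    (\<forall>x\<in>carrier R. (\<forall>P\<in>F. x \<in> P) \<longrightarrow> (\<exists>n::nat. x [^] n \<in> I))" for I F
  assume "\<not> ?thesis"
  then have ne: "{I. ideal I R \<and> (\<nexists>F. good I F)} \<noteq> {}"
    using assms unfolding good_def by blast
  have "\<exists>I\<in>{I. ideal I R \<and> (\<nexists>F. good I F)}. \<forall>J\<in>{I. ideal I R \<and> (\<nexists>F. good I F)}. I \<subseteq> J \<longrightarrow> J = I"
    by (rule ex_maximal_ideal[OF ne]) blast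
  then obtain I where I: "ideal I R" and bad: "\<nexists>F. good I F"
    and max: "\<And>J. ideal J R \<Longrightarrow> I \<subset> J \<Longrightarrow> \<exists>F. good J F" by blast
  interpret I: ideal I R by fact
  have ne: "I \<noteq> carrier R"
  proof
    assume eq: "I = carrier R"
    have "\<not> I \<subseteq> Q" if "primeideal Q R" for Q
    proof -
      interpret Q: primeideal Q R by fact
      show ?thesis using eq Q.I_notcarr Q.a_subset by blast
    qed
    then have "good I {}" unfolding good_def eq by auto
    then show False using bad by blast
  qed
  have "\<not> primeideal I R"
  proof
    assume "primeideal I R"
    then have "good I {I}" unfolding good_def using I.Icarr
      by (auto intro: exI[of _ "1::nat"])
    then show False using bad by blast
  qed
  then obtain a b where ab: "a \<in> carrier R" "b \<in> carrier R" "a \<otimes> b \<in> I" "a \<notin> I" "b \<notin> I"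
    using ne primeidealI[OF I is_cring] by metis
  define A where "A = {x \<in> carrier R. \<forall>y\<in>{b}. x \<otimes> y \<in> I}"
  define B where "B = {x \<in> carrier R. \<forall>y\<in>A. x \<otimes> y \<in> I}"
  have iA: "ideal A R" unfolding A_def by (rule colon_ideal[OF I]) (use ab in auto)
  have iB: "ideal B R" unfolding B_def by (rule colon_ideal[OF I]) (auto simp: A_def)
  have IA: "I \<subset> A" using ab I.I_r_closed I.Icarr unfolding A_def by auto
  have "b \<in> B" unfolding B_def A_def using ab m_comm[of b] by auto
  then have IB: "I \<subset> B" using ab I.I_r_closed I.Icarr unfolding B_def A_def by auto
  obtain FA FB where F: "good A FA" "good B FB" using max[OF iA IA] max[OF iB IB] by blast
  have prod: "x \<otimes> y \<in> I" if "x \<in> B" "y \<in> A" for x y using that unfolding B_def by auto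
  have "\<exists>P\<in>FA \<union> FB. P \<subseteq> Q" if Q: "primeideal Q R" "I \<subseteq> Q" for Q
  proof -
    interpret Q: primeideal Q R by fact
    have "A \<subseteq> Q \<or> B \<subseteq> Q"
    proof (rule ccontr)
      assume "\<not> ?thesis"
      then obtain x y where xy: "x \<in> B" "x \<notin> Q" "y \<in> A" "y \<notin> Q" by blast
      then have "x \<in> carrier R" "y \<in> carrier R" by (auto simp: A_def B_def)
      then show False using Q.I_prime[of x y] prod[OF xy(1,3)] Q(2) xy by blast
    qed
    moreover have "\<exists>P\<in>FA. P \<subseteq> Q" if "A \<subseteq> Q"
      using F(1) Q(1) that unfolding good_def by simp
    moreover have "\<exists>P\<in>FB. P \<subseteq> Q" if "B \<subseteq> Q"
      using F(2) Q(1) that unfolding good_def by simp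
    ultimately show ?thesis by blast
  qed
  moreover have "\<exists>n::nat. x [^] n \<in> I" if x: "x \<in> carrier R" "\<forall>P\<in>FA \<union> FB. x \<in> P" for x
  proof -
    obtain m n :: nat where "x [^] m \<in> A" "x [^] n \<in> B" using F x unfolding good_def by fastforce
    then have "x [^] n \<otimes> x [^] m \<in> I" using prod by blast
    then show ?thesis using x(1) nat_pow_mult[of x n m] by auto
  qed
  moreover have "finite (FA \<union> FB)" "\<forall>P\<in>FA \<union> FB. primeideal P R"
    using F by (simp_all add: good_def ball_Un)
  ultimately have "good I (FA \<union> FB)" unfolding good_def by simp
  then show False using bad by blast
qed

lemma minimal_primes_prime: "P \<in> minimal_primes R \<Longrightarrow> primeideal P R"
  by (simp add: minimal_primes_def prime_spec_def)

lemma
  shows finite_minimal_primes: "finite (minimal_primes R)"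
    and nilpotent_if_in_minimal_primes:
      "x \<in> carrier R \<Longrightarrow> (\<And>P. P \<in> minimal_primes R \<Longrightarrow> x \<in> P) \<Longrightarrow> \<exists>n::nat. x [^] n = \<zero>"
proof -
  from finite_primes_over_ideal[OF zeroideal] obtain F where F: "finite F" "\<forall>P\<in>F. primeideal P R"
    "\<forall>Q. primeideal Q R \<longrightarrow> {\<zero>} \<subseteq> Q \<longrightarrow> (\<exists>P\<in>F. P \<subseteq> Q)"
    "\<forall>x\<in>carrier R. (\<forall>P\<in>F. x \<in> P) \<longrightarrow> (\<exists>n::nat. x [^] n \<in> {\<zero>})"
    by (elim exE conjE)
  have F3: "\<exists>P\<in>F. P \<subseteq> Q" if "primeideal Q R" for Q
  proof -
    interpret Q: primeideal Q R by fact
    show ?thesis using F(3) that by auto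
  qed
  have "minimal_primes R \<subseteq> F"
  proof
    fix P assume "P \<in> minimal_primes R"
    then have P: "primeideal P R" "\<And>Q. primeideal Q R \<Longrightarrow> Q \<subseteq> P \<Longrightarrow> Q = P"
      unfolding minimal_primes_def prime_spec_def by auto
    obtain Q where "Q \<in> F" "Q \<subseteq> P" using F3[OF P(1)] by blast
    then show "P \<in> F" using P(2)[of Q] F(2) by simp
  qed
  then show "finite (minimal_primes R)" using F(1) finite_subset by blast
  have ex: "\<exists>P\<in>minimal_primes R. P \<subseteq> Q" if Q: "primeideal Q R" for Q
  proof -
    let ?G = "{P \<in> F. P \<subseteq> Q}"
    have "finite ?G" "?G \<noteq> {}" using F(1) F3[OF Q] by auto
    from finite_has_minimal[OF this] obtain P where P: "P \<in> ?G" "\<forall>P'\<in>?G. P' \<subseteq> P \<longrightarrow> P = P'" by blast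
    have "Q' = P" if Q': "primeideal Q' R" "Q' \<subseteq> P" for Q'
    proof -
      obtain P' where P': "P' \<in> F" "P' \<subseteq> Q'" using F3[OF Q'(1)] by blast
      then have "P = P'" using P Q'(2) by (metis (no_types, lifting) mem_Collect_eq subset_trans)
      then show ?thesis using P'(2) Q'(2) by simp
    qed
    then have "P \<in> minimal_primes R"
      using P F(2) unfolding minimal_primes_def prime_spec_def by simp
    then show ?thesis using P by blast
  qed
  show "\<exists>n::nat. x [^] n = \<zero>" if x: "x \<in> carrier R" "\<And>P. P \<in> minimal_primes R \<Longrightarrow> x \<in> P"
  proof -
    have "\<forall>P\<in>F. x \<in> P" using F(2) ex x(2) by blast
    then show ?thesis using F(4) x(1) by simp
  qed
qed

lemma separate_minimal_prime:
  assumes P: "P \<in> minimal_primes R"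
  shows "\<exists>t\<in>carrier R. t \<notin> P \<and> (\<forall>Q\<in>minimal_primes R. Q \<noteq> P \<longrightarrow> t \<in> Q)"
proof -
  interpret P: primeideal P R by (rule minimal_primes_prime[OF P])
  have "\<exists>t\<in>carrier R. t \<notin> P \<and> (\<forall>Q\<in>F. t \<in> Q)" if "finite F" "F \<subseteq> minimal_primes R - {P}" for F
    using that
  proof (induction F)
    case empty
    then show ?case using P.I_notcarr P.a_subset by auto
  next
    case (insert Q F)
    then obtain t where t: "t \<in> carrier R" "t \<notin> P" "\<forall>Q\<in>F. t \<in> Q" by auto
    have Q: "Q \<in> minimal_primes R" "Q \<noteq> P" using insert by auto
    interpret Q: primeideal Q R by (rule minimal_primes_prime[OF Q(1)])
    have "\<not> Q \<subseteq> P" using P Q unfolding minimal_primes_def by auto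
    then obtain q where q: "q \<in> Q" "q \<notin> P" by blast
    have qc: "q \<in> carrier R" using q Q.Icarr by blast
    have "t \<otimes> q \<in> Q'" if "Q' \<in> insert Q F" for Q'
    proof (cases "Q' = Q")
      case True
      then show ?thesis using Q.I_l_closed[OF q(1) t(1)] by simp
    next
      case False
      then have Q': "Q' \<in> F" using that by blast
      then interpret Q': primeideal Q' R using minimal_primes_prime insert.prems by blast
      show ?thesis using Q'.I_r_closed[of t q] t qc Q' by blast
    qed
    moreover have "t \<otimes> q \<notin> P" using P.I_prime[OF t(1) qc] t q by blast
    moreover have "t \<otimes> q \<in> carrier R" using t qc by simp
    ultimately show ?case by blast
  qed
  from this[of "minimal_primes R - {P}"] show ?thesis using finite_minimal_primes by auto
qed

text \<open>Prime avoidance. An element \<open>x\<close> that misses some of the minimal primes but lies in \<open>Q\<close> is corrected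
  by a multiple \<open>tb\<close> with \<open>t \<notin> Q\<close> in all the other minimal primes and \<open>b \<in> I - Q\<close>.\<close>

lemma ideal_meets_off_minimal_primes:
  assumes I: "ideal I R" and ne: "\<And>P. P \<in> minimal_primes R \<Longrightarrow> \<not> I \<subseteq> P"
  shows "\<exists>x\<in>I. x \<in> off_minimal_primes R"
proof -
  interpret I: ideal I R by fact
  have "\<exists>x\<in>I. \<forall>P\<in>F. x \<notin> P" if "finite F" "F \<subseteq> minimal_primes R" for F
    using that
  proof (induction F)
    case empty
    then show ?case using I.zero_closed by blast
  next
    case (insert Q F)
    then obtain x where x: "x \<in> I" "\<forall>P\<in>F. x \<notin> P" by auto
    have Q: "Q \<in> minimal_primes R" using insert by blast
    interpret Q: primeideal Q R by (rule minimal_primes_prime[OF Q])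
    show ?case
    proof (cases "x \<in> Q")
      case True
      obtain b where b: "b \<in> I" "b \<notin> Q" using ne[OF Q] by blast
      obtain t where t: "t \<in> carrier R" "t \<notin> Q" "\<forall>P\<in>minimal_primes R. P \<noteq> Q \<longrightarrow> t \<in> P"
        using separate_minimal_prime[OF Q] by blast
      have c: "x \<in> carrier R" "b \<in> carrier R" using x b I.Icarr by auto
      have tb: "t \<otimes> b \<in> I" using I.I_l_closed b t by blast
      have tbQ: "t \<otimes> b \<notin> Q" using Q.I_prime[of t b] t b c by blast
      have 1: "x \<oplus> t \<otimes> b \<notin> Q"
      proof
        assume "x \<oplus> t \<otimes> b \<in> Q"
        then have "\<ominus> x \<oplus> (x \<oplus> t \<otimes> b) \<in> Q" using Q.a_closed Q.a_inv_closed True by blast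
        then show False using tbQ t c by (simp add: r_neg1 r_neg2)
      qed
      have 2: "x \<oplus> t \<otimes> b \<notin> P" if P: "P \<in> F" for P
      proof -
        have Pm: "P \<in> minimal_primes R" "P \<noteq> Q" using P insert by auto
        interpret P: primeideal P R by (rule minimal_primes_prime[OF Pm(1)])
        have tbP: "t \<otimes> b \<in> P" using P.I_r_closed[of t b] t Pm c by blast
        show ?thesis
        proof
          assume "x \<oplus> t \<otimes> b \<in> P"
          then have "(x \<oplus> t \<otimes> b) \<oplus> \<ominus> (t \<otimes> b) \<in> P" using P.a_closed P.a_inv_closed tbP by blast
          then show False using c t x P by (auto simp: a_assoc r_neg)
        qed
      qed
      show ?thesis using 1 2 I.a_closed[OF x(1) tb] by blast
    qed (use x in auto)
  qed
  from this[of "minimal_primes R"] show ?thesis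
    using finite_minimal_primes I.Icarr unfolding off_minimal_primes_def by auto
qed

lemma off_minimal_primes_mult:
  assumes "x \<in> off_minimal_primes R" "y \<in> off_minimal_primes R"
  shows "x \<otimes> y \<in> off_minimal_primes R"
  using assms minimal_primes_prime primeideal.I_prime[of _ R x y]
  unfolding off_minimal_primes_def by auto

lemma off_minimal_primes_carrier: "x \<in> off_minimal_primes R \<Longrightarrow> x \<in> carrier R"
  by (auto simp: off_minimal_primes_def)

lemma one_off_minimal_primes: "\<one> \<in> off_minimal_primes R"
proof -
  have "\<one> \<notin> P" if "P \<in> minimal_primes R" for P
  proof -
    interpret P: primeideal P R by (rule minimal_primes_prime[OF that])
    show ?thesis using P.I_notcarr P.one_imp_carrier by blast
  qed
  then show ?thesis by (auto simp: off_minimal_primes_def)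
qed

lemma off_minimal_primes_pow: "x \<in> off_minimal_primes R \<Longrightarrow> x [^] (n::nat) \<in> off_minimal_primes R"
  by (induction n) (simp_all add: one_off_minimal_primes off_minimal_primes_mult)

end

locale reduced_noetherian_cring = noetherian_cring +
  assumes reduced: "reduced_ring R"
begin

lemma zero_if_in_minimal_primes:
  assumes "x \<in> carrier R" "\<And>P. P \<in> minimal_primes R \<Longrightarrow> x \<in> P"
  shows "x = \<zero>"
  using nilpotent_if_in_minimal_primes[OF assms] reduced assms(1) unfolding reduced_ring_def by blast

text \<open>An element that separates \<open>P\<close> from the other minimal primes will do: its multiples by \<open>P\<close> lie in all
  minimal primes. So \<open>R/P\<close> embeds in \<open>R\<close> as the ideal \<open>tR\<close>, which is how functionals with values in
  residue fields are turned into functionals with values in \<open>R\<close>.\<close>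

lemma minimal_prime_annihilated:
  assumes P: "P \<in> minimal_primes R"
  shows "\<exists>t\<in>carrier R. t \<notin> P \<and> (\<forall>a\<in>P. t \<otimes> a = \<zero>)"
proof -
  obtain t where t: "t \<in> carrier R" "t \<notin> P" "\<forall>Q\<in>minimal_primes R. Q \<noteq> P \<longrightarrow> t \<in> Q"
    using separate_minimal_prime[OF P] by blast
  have "t \<otimes> a = \<zero>" if a: "a \<in> P" for a
  proof (rule zero_if_in_minimal_primes)
    interpret P: primeideal P R by (rule minimal_primes_prime[OF P])
    have ac: "a \<in> carrier R" using a P.Icarr by blast
    show "t \<otimes> a \<in> carrier R" using ac t by simp
    fix Q assume Q: "Q \<in> minimal_primes R"
    interpret Q: primeideal Q R by (rule minimal_primes_prime[OF Q])
    show "t \<otimes> a \<in> Q"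
      using t Q Q.I_r_closed[OF _ ac, of t] P.I_l_closed[OF a t(1)] by (cases "Q = P") auto
  qed
  then show ?thesis using t by blast
qed

lemma off_minimal_primes_nonzerodivisor:
  assumes x: "x \<in> off_minimal_primes R" and y: "y \<in> carrier R" and 0: "x \<otimes> y = \<zero>"
  shows "y = \<zero>"
proof (rule zero_if_in_minimal_primes[OF y])
  fix P assume P: "P \<in> minimal_primes R"
  interpret P: primeideal P R by (rule minimal_primes_prime[OF P])
  show "y \<in> P" using P.I_prime[of x y] x y 0 P P.zero_closed by (auto simp: off_minimal_primes_def)
qed

end

section \<open>The Frobenius endomorphism\<close>

lemma (in cring) binomial_expansion:
  assumes x: "x \<in> carrier R" and y: "y \<in> carrier R"
  shows "(x \<oplus> y) [^] (n::nat) = (\<Oplus>k\<in>{..n}. [(n choose k)] \<cdot> (x [^] k \<otimes> y [^] (n - k)))"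
proof (induction n)
  case 0
  then show ?case using x y by simp
next
  case (Suc n)
  let ?t = "\<lambda>n k. [(n choose k)] \<cdot> (x [^] k \<otimes> y [^] (n - k))"
  have c: "?t n k \<in> carrier R" for n k using x y by simp
  define f where "f k = (if k \<le> n then [(n choose k)] \<cdot> (x [^] k \<otimes> y [^] (Suc n - k)) else \<zero>)" for k
  define g where "g k = (if k = 0 then \<zero> else [(n choose (k-1))] \<cdot> (x [^] k \<otimes> y [^] (Suc n - k)))" for k
  have fc: "f k \<in> carrier R" "g k \<in> carrier R" for k using x y by (auto simp: f_def g_def)
  have A: "(\<Oplus>k\<in>{..n}. ?t n k) \<otimes> y = (\<Oplus>k\<in>{..Suc n}. f k)"
  proof -
    have "(\<Oplus>k\<in>{..n}. ?t n k) \<otimes> y = (\<Oplus>k\<in>{..n}. ?t n k \<otimes> y)"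
      by (rule finsum_ldistr) (use y c in auto)
    also have "\<dots> = (\<Oplus>k\<in>{..n}. f k)"
    proof (rule finsum_cong')
      fix k assume k: "k \<in> {..n}"
      then have e: "Suc n - k = Suc (n - k)" by auto
      show "?t n k \<otimes> y = f k"
        using k x y unfolding f_def e by (simp add: add_pow_ldistr m_assoc)
    qed (use fc in auto)
    also have "\<dots> = (\<Oplus>k\<in>{..Suc n}. f k)"
    proof -
      have "f (Suc n) = \<zero>" by (simp add: f_def)
      moreover have "(\<Oplus>k\<in>{..n}. f k) \<in> carrier R" by (rule finsum_closed) (use fc in auto)
      ultimately show ?thesis using fc by (simp add: finsum_Suc Pi_def)
    qed
    finally show ?thesis .
  qed
  have B: "(\<Oplus>k\<in>{..n}. ?t n k) \<otimes> x = (\<Oplus>k\<in>{..Suc n}. g k)"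
  proof -
    have "(\<Oplus>k\<in>{..n}. ?t n k) \<otimes> x = (\<Oplus>k\<in>{..n}. ?t n k \<otimes> x)"
      by (rule finsum_ldistr) (use x c in auto)
    also have "\<dots> = (\<Oplus>k\<in>{..n}. g (Suc k))"
      by (rule finsum_cong')
        (use fc x y in \<open>auto simp: g_def add_pow_ldistr add_pow_rdistr m_ac\<close>)
    also have "\<dots> = (\<Oplus>k\<in>{..Suc n}. g k)"
    proof -
      have "(\<Oplus>k\<in>{..Suc n}. g k) = (\<Oplus>k\<in>{..n}. g (Suc k)) \<oplus> g 0"
        by (rule finsum_Suc2) (use fc in auto)
      moreover have "(\<Oplus>k\<in>{..n}. g (Suc k)) \<in> carrier R" by (rule finsum_closed) (use fc in auto)
      ultimately show ?thesis by (simp add: g_def)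
    qed
    finally show ?thesis .
  qed
  have fin: "(\<Oplus>k\<in>{..n}. ?t n k) \<in> carrier R" using c by (intro finsum_closed) auto
  have "(x \<oplus> y) [^] Suc n = (\<Oplus>k\<in>{..n}. ?t n k) \<otimes> (x \<oplus> y)" by (simp add: Suc)
  also have "\<dots> = (\<Oplus>k\<in>{..n}. ?t n k) \<otimes> x \<oplus> (\<Oplus>k\<in>{..n}. ?t n k) \<otimes> y"
    using x y fin by (simp add: r_distr)
  also have "\<dots> = (\<Oplus>k\<in>{..Suc n}. g k) \<oplus> (\<Oplus>k\<in>{..Suc n}. f k)" unfolding A B ..
  also have "\<dots> = (\<Oplus>k\<in>{..Suc n}. g k \<oplus> f k)" using fc by (subst finsum_addf) auto
  also have "\<dots> = (\<Oplus>k\<in>{..Suc n}. ?t (Suc n) k)"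
  proof (rule finsum_cong')
    fix k assume k: "k \<in> {..Suc n}"
    show "g k \<oplus> f k = ?t (Suc n) k"
    proof (cases k)
      case 0
      then show ?thesis using x y by (simp add: f_def g_def)
    next
      case (Suc j)
      have xy: "x [^] Suc j \<otimes> y [^] (n - j) \<in> carrier R" using x y by simp
      have gj: "g k = [(n choose j)] \<cdot> (x [^] Suc j \<otimes> y [^] (n - j))" using Suc by (simp add: g_def)
      have fj: "f k = [(n choose Suc j)] \<cdot> (x [^] Suc j \<otimes> y [^] (n - j))"
        using Suc k by (cases "Suc j \<le> n") (auto simp: f_def not_le binomial_eq_0)
      have "?t (Suc n) k = [((n choose j) + (n choose Suc j))] \<cdot> (x [^] Suc j \<otimes> y [^] (n - j))"
        using Suc by simp
      then show ?thesis unfolding gj fj add.nat_pow_mult[OF xy, symmetric] by simp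
    qed
  qed (use c in auto)
  finally show ?case .
qed

locale char_p_cring = noetherian_cring +
  fixes p :: nat
  assumes p: "char_p_ring p R"
begin

lemma prime_p: "Factorial_Ring.prime p" using p by (simp add: char_p_ring_def)

lemma p_gt_1: "p > 1" using prime_p prime_gt_1_nat by blast

lemma p_multiple_zero:
  assumes "p dvd n" "x \<in> carrier R" shows "[n] \<cdot> x = \<zero>"
proof -
  have "[n] \<cdot> x = [n] \<cdot> (\<one> \<otimes> x)" using assms by simp
  also have "\<dots> = ([n] \<cdot> \<one>) \<otimes> x" using assms by (subst add_pow_ldistr) auto
  also have "[n] \<cdot> \<one> = \<zero>" using p assms by (simp add: char_p_ring_def)
  finally show ?thesis using assms by simp
qed

lemma frobenius_add_p:
  assumes x: "x \<in> carrier R" and y: "y \<in> carrier R"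
  shows "(x \<oplus> y) [^] p = x [^] p \<oplus> y [^] p"
proof -
  let ?t = "\<lambda>k. [(p choose k)] \<cdot> (x [^] k \<otimes> y [^] (p - k))"
  have c: "?t k \<in> carrier R" for k using x y by simp
  have z: "?t k = \<zero>" if "k \<in> {..p} - {0, p}" for k
    using that x y dvd_choose_prime[OF _ _ _ prime_p, of k] by (intro p_multiple_zero) auto
  have "(\<Oplus>k\<in>{..p}. ?t k) = (\<Oplus>k\<in>{0, p}. ?t k)"
    by (rule add.finprod_mono_neutral_cong_right) (use c z in auto)
  also have "\<dots> = y [^] p \<oplus> x [^] p" using x y p_gt_1 by simp
  finally show ?thesis using binomial_expansion[OF x y, of p] x y by (simp add: a_comm)
qed

lemma frobenius_add:
  assumes x: "x \<in> carrier R" and y: "y \<in> carrier R"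
  shows "(x \<oplus> y) [^] (p ^ e) = x [^] (p ^ e) \<oplus> y [^] (p ^ e)"
proof (induction e)
  case (Suc e)
  have "z [^] (p ^ Suc e) = (z [^] (p ^ e)) [^] p" if "z \<in> carrier R" for z
    using that by (simp add: nat_pow_pow mult.commute)
  then show ?case using Suc x y frobenius_add_p by simp
qed (use x y in simp)

lemma zero_frobenius: "\<zero> [^] (p ^ e) = \<zero>"
  using p_gt_1 by (intro nat_pow_zero) auto

end


section \<open>Homomorphisms of modules\<close>

lemma ring_module_simps [simp]:
  "carrier (ring_module R) = carrier R" "add (ring_module R) = add R"
  "ring.zero (ring_module R) = ring.zero R" "smult (ring_module R) = monoid.mult R"
  by (simp_all add: ring_module_def)

lemma frob_module_simps [simp]:
  "carrier (frob_module p e R M) = carrier M" "add (frob_module p e R M) = add M"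
  "ring.zero (frob_module p e R M) = ring.zero M"
  "smult (frob_module p e R M) r x = smult M (r [^]\<^bsub>R\<^esub> (p ^ e)) x"
  by (simp_all add: frob_module_def)

lemma module_ring_module:
  assumes "cring R" shows "module R (ring_module R)"
proof -
  interpret cring R by fact
  show ?thesis
  proof (rule moduleI)
    show "abelian_group (ring_module R)"
      by (rule abelian_groupI) (auto simp: a_ac intro: l_neg bexI[of _ "\<ominus>\<^bsub>R\<^esub> _"])
  qed (auto simp: l_distr r_distr m_assoc is_cring)
qed

lemma minus_ring_module:
  fixes R :: "'a ring" (structure)
  assumes R: "cring R" and x: "x \<in> carrier R" "y \<in> carrier R"
  shows "x \<ominus>\<^bsub>ring_module R\<^esub> y = x \<ominus> y"
proof -
  interpret RM: module R "ring_module R" by (rule module_ring_module[OF R])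
  show ?thesis using RM.smult_l_minus[of \<one> y] x by (simp add: a_minus_def RM.l_minus)
qed

lemma (in char_p_cring) module_frob_module:
  assumes "module R M" shows "module R (frob_module p e R M)"
proof -
  interpret M: module R M by fact
  show ?thesis
  proof (rule moduleI)
    show "abelian_group (frob_module p e R M)"
      by (rule abelian_groupI) (auto simp: M.a_ac intro: M.l_neg bexI[of _ "\<ominus>\<^bsub>M\<^esub> _"])
  qed (auto simp: frobenius_add M.smult_l_distr M.smult_r_distr M.smult_assoc1 nat_pow_distrib is_cring)
qed

lemma Hom_moduleI:
  assumes "\<And>x. x \<in> carrier M \<Longrightarrow> f x \<in> carrier N"
    "\<And>x y. x \<in> carrier M \<Longrightarrow> y \<in> carrier M \<Longrightarrow> f (x \<oplus>\<^bsub>M\<^esub> y) = f x \<oplus>\<^bsub>N\<^esub> f y"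
    "\<And>r x. r \<in> carrier R \<Longrightarrow> x \<in> carrier M \<Longrightarrow> f (r \<odot>\<^bsub>M\<^esub> x) = r \<odot>\<^bsub>N\<^esub> f x"
  shows "f \<in> Hom_module R M N"
  using assms by (auto simp: Hom_module_def)

lemma Hom_moduleD:
  assumes "f \<in> Hom_module R M N"
  shows "x \<in> carrier M \<Longrightarrow> f x \<in> carrier N"
    "x \<in> carrier M \<Longrightarrow> y \<in> carrier M \<Longrightarrow> f (x \<oplus>\<^bsub>M\<^esub> y) = f x \<oplus>\<^bsub>N\<^esub> f y"
    "r \<in> carrier R \<Longrightarrow> x \<in> carrier M \<Longrightarrow> f (r \<odot>\<^bsub>M\<^esub> x) = r \<odot>\<^bsub>N\<^esub> f x"
  using assms by (auto simp: Hom_module_def)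

lemma Hom_module_zero:
  assumes "module R M" "module R N" "f \<in> Hom_module R M N"
  shows "f \<zero>\<^bsub>M\<^esub> = \<zero>\<^bsub>N\<^esub>"
proof -
  interpret M: module R M by fact
  interpret N: module R N by fact
  have "f (\<zero>\<^bsub>R\<^esub> \<odot>\<^bsub>M\<^esub> \<zero>\<^bsub>M\<^esub>) = \<zero>\<^bsub>R\<^esub> \<odot>\<^bsub>N\<^esub> f \<zero>\<^bsub>M\<^esub>"
    by (rule Hom_moduleD[OF assms(3)]) auto
  then show ?thesis using Hom_moduleD(1)[OF assms(3)] by simp
qed

text \<open>The exponents add up because \<open>\<^sup>b(\<^sup>aM) = \<^sup>a\<^sup>+\<^sup>bM\<close>.\<close>

lemma Hom_frob_comp:
  assumes R: "cring R"
    and f: "f \<in> Hom_module R (frob_module p a R M) N" and g: "g \<in> Hom_module R (frob_module p b R N) T"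
  shows "(\<lambda>x. g (f x)) \<in> Hom_module R (frob_module p (a + b) R M) T"
proof -
  interpret cring R by fact
  have r: "r [^]\<^bsub>R\<^esub> (p ^ (a + b)) = (r [^]\<^bsub>R\<^esub> (p ^ b)) [^]\<^bsub>R\<^esub> (p ^ a)" if "r \<in> carrier R" for r
    using that by (simp add: nat_pow_pow power_add mult.commute)
  note f = Hom_moduleD[OF f, simplified] and g = Hom_moduleD[OF g, simplified]
  show ?thesis
    by (rule Hom_moduleI) (simp_all add: f g r)
qed

lemma Hom_frob_zero:
  assumes R: "cring R" and M: "module R M"
  shows "Hom_module R (frob_module p 0 R M) N = Hom_module R M N"
proof -
  interpret cring R by fact
  interpret M: module R M by fact
  show ?thesis by (auto simp: Hom_module_def)
qed

lemma Hom_module_add: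
  assumes N: "module R N" and f: "f \<in> Hom_module R M N" and g: "g \<in> Hom_module R M N"
  shows "(\<lambda>x. f x \<oplus>\<^bsub>N\<^esub> g x) \<in> Hom_module R M N"
proof -
  interpret N: module R N by fact
  note f = Hom_moduleD[OF f] and g = Hom_moduleD[OF g]
  show ?thesis
    by (rule Hom_moduleI) (simp_all add: f g N.smult_r_distr N.a_ac)
qed

lemma Hom_module_smult:
  assumes N: "module R N" and f: "f \<in> Hom_module R M N" and r: "r \<in> carrier R"
  shows "(\<lambda>x. r \<odot>\<^bsub>N\<^esub> f x) \<in> Hom_module R M N"
proof -
  interpret N: module R N by fact
  note f = Hom_moduleD[OF f]
  have *: "r \<odot>\<^bsub>N\<^esub> (s \<odot>\<^bsub>N\<^esub> y) = s \<odot>\<^bsub>N\<^esub> (r \<odot>\<^bsub>N\<^esub> y)" if "s \<in> carrier R" "y \<in> carrier N" for s y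
    using that r by (simp add: N.smult_assoc1[symmetric] N.m_comm)
  show ?thesis
    by (rule Hom_moduleI) (simp_all add: f r N.smult_r_distr *)
qed

lemma Hom_module_const_zero:
  assumes N: "module R N"
  shows "(\<lambda>x. \<zero>\<^bsub>N\<^esub>) \<in> Hom_module R M N"
proof -
  interpret N: module R N by fact
  show ?thesis by (rule Hom_moduleI) simp_all
qed

lemma submodule_Hom_values:
  assumes M: "module R M" and c: "c \<in> carrier N"
  shows "submodule ((\<lambda>g. g c) ` Hom_module R N M) R M"
proof -
  interpret M: module R M by fact
  show ?thesis
  proof (rule M.submodule_criterion)
    show "(\<lambda>g. g c) ` Hom_module R N M \<subseteq> carrier M" using c by (auto simp: Hom_module_def)
    show "\<zero>\<^bsub>M\<^esub> \<in> (\<lambda>g. g c) ` Hom_module R N M"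
      by (rule image_eqI[OF _ Hom_module_const_zero[OF M]]) simp
  next
    fix a b assume "a \<in> (\<lambda>g. g c) ` Hom_module R N M" "b \<in> (\<lambda>g. g c) ` Hom_module R N M"
    then obtain f g where fg: "f \<in> Hom_module R N M" "a = f c" "g \<in> Hom_module R N M" "b = g c" by blast
    show "a \<oplus>\<^bsub>M\<^esub> b \<in> (\<lambda>g. g c) ` Hom_module R N M"
      by (rule image_eqI[OF _ Hom_module_add[OF M fg(1,3)]]) (simp add: fg)
  next
    fix r a assume r: "r \<in> carrier R" and "a \<in> (\<lambda>g. g c) ` Hom_module R N M"
    then obtain f where f: "f \<in> Hom_module R N M" "a = f c" by blast
    show "r \<odot>\<^bsub>M\<^esub> a \<in> (\<lambda>g. g c) ` Hom_module R N M"
      by (rule image_eqI[OF _ Hom_module_smult[OF M f(1) r]]) (simp add: f)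
  qed
qed

lemma Hom_module_minus:
  assumes M: "module R M" and N: "module R N" and f: "f \<in> Hom_module R M N"
    and x: "x \<in> carrier M" "y \<in> carrier M"
  shows "f (x \<ominus>\<^bsub>M\<^esub> y) = f x \<ominus>\<^bsub>N\<^esub> f y"
proof -
  interpret M: module R M by fact
  interpret N: module R N by fact
  note fh = Hom_moduleD[OF f]
  have neg: "\<ominus>\<^bsub>M\<^esub> y = (\<ominus>\<^bsub>R\<^esub> \<one>\<^bsub>R\<^esub>) \<odot>\<^bsub>M\<^esub> y" using x by (simp add: M.smult_l_minus)
  have "f (\<ominus>\<^bsub>M\<^esub> y) = \<ominus>\<^bsub>N\<^esub> f y"
    unfolding neg using fh(3)[of "\<ominus>\<^bsub>R\<^esub> \<one>\<^bsub>R\<^esub>" y] x fh(1) by (simp add: N.smult_l_minus)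
  then show ?thesis using x fh(2) by (simp add: a_minus_def)
qed

lemma Hom_module_finsum:
  assumes M: "module R M" and N: "module R N" and f: "f \<in> Hom_module R M N"
    and g: "\<And>i. i \<in> A \<Longrightarrow> g i \<in> carrier M"
  shows "f (\<Oplus>\<^bsub>M\<^esub>i\<in>A. g i) = (\<Oplus>\<^bsub>N\<^esub>i\<in>A. f (g i))"
proof -
  interpret M: module R M by fact
  interpret N: module R N by fact
  note fh = Hom_moduleD[OF f] and f0 = Hom_module_zero[OF M N f]
  show ?thesis
  proof (cases "finite A")
    case True
    then show ?thesis using g
    proof (induction A)
      case (insert i A)
      then show ?case
        using fh M.finsum_closed[of g A] by (simp add: M.finsum_insert N.finsum_insert Pi_def)
    qed (simp add: f0)
  qed (simp add: f0 M.finsum_infinite N.finsum_infinite)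
qed

lemma submodule_Hom_image:
  assumes N: "module R N" and L: "module R L" and T: "submodule T R N" and \<phi>: "\<phi> \<in> Hom_module R N L"
  shows "submodule (\<phi> ` T) R L"
proof -
  interpret N: module R N by fact
  interpret L: module R L by fact
  note Tp = N.submodule_props[OF T] and \<phi>h = Hom_moduleD[OF \<phi>]
  show ?thesis
  proof (rule L.submodule_criterion)
    show "\<phi> ` T \<subseteq> carrier L" using \<phi>h(1) Tp(1) by blast
    show "\<zero>\<^bsub>L\<^esub> \<in> \<phi> ` T" using Hom_module_zero[OF N L \<phi>] Tp(2) by (metis image_eqI)
  next
    fix a b assume "a \<in> \<phi> ` T" "b \<in> \<phi> ` T"
    then obtain x y where "x \<in> T" "y \<in> T" "a = \<phi> x" "b = \<phi> y" by blast
    then show "a \<oplus>\<^bsub>L\<^esub> b \<in> \<phi> ` T"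
      using \<phi>h(2)[of x y] Tp(3) subsetD[OF Tp(1)] by (intro image_eqI[of _ _ "x \<oplus>\<^bsub>N\<^esub> y"]) auto
  next
    fix r a assume r: "r \<in> carrier R" and "a \<in> \<phi> ` T"
    then obtain x where "x \<in> T" "a = \<phi> x" by blast
    then show "r \<odot>\<^bsub>L\<^esub> a \<in> \<phi> ` T"
      using \<phi>h(3)[OF r, of x] Tp(5) subsetD[OF Tp(1)] r by (intro image_eqI[of _ _ "r \<odot>\<^bsub>N\<^esub> x"]) auto
  qed
qed

lemma submodule_Hom_kernel:
  assumes M: "module R M" and N: "module R N" and f: "f \<in> Hom_module R M N"
  shows "submodule {x \<in> carrier M. f x = \<zero>\<^bsub>N\<^esub>} R M"
proof -
  interpret M: module R M by fact
  interpret N: module R N by fact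
  show ?thesis
    by (rule M.submodule_criterion) (simp_all add: Hom_module_zero[OF M N f] Hom_moduleD[OF f])
qed

text \<open>The usual way to define a homomorphism on a module given by generators: send \<open>n\<close> to a value
  read off from any of its presentations, all of which give the same value.\<close>

lemma Hom_module_of_relation:
  assumes total: "\<And>n. n \<in> carrier N \<Longrightarrow> \<exists>t. rel n t"
    and single_valued: "\<And>n t t'. n \<in> carrier N \<Longrightarrow> rel n t \<Longrightarrow> rel n t' \<Longrightarrow> t = t'"
    and N: "module R N" and cl: "\<And>n t. rel n t \<Longrightarrow> t \<in> carrier T"
    and add: "\<And>n n' t t'. n \<in> carrier N \<Longrightarrow> n' \<in> carrier N \<Longrightarrow> rel n t \<Longrightarrow> rel n' t' \<Longrightarrow>
      rel (n \<oplus>\<^bsub>N\<^esub> n') (t \<oplus>\<^bsub>T\<^esub> t')"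
    and smult: "\<And>r n t. r \<in> carrier R \<Longrightarrow> n \<in> carrier N \<Longrightarrow> rel n t \<Longrightarrow> rel (r \<odot>\<^bsub>N\<^esub> n) (r \<odot>\<^bsub>T\<^esub> t)"
  shows "\<exists>\<phi>\<in>Hom_module R N T. \<forall>n\<in>carrier N. rel n (\<phi> n)"
proof -
  interpret N: module R N by fact
  define \<phi> where "\<phi> n = (SOME t. rel n t)" for n
  have \<phi>: "rel n (\<phi> n)" if "n \<in> carrier N" for n
    unfolding \<phi>_def using total[OF that] by (rule someI_ex)
  have "\<phi> \<in> Hom_module R N T"
  proof (rule Hom_moduleI)
    fix n n' assume n: "n \<in> carrier N" "n' \<in> carrier N"
    then show "\<phi> (n \<oplus>\<^bsub>N\<^esub> n') = \<phi> n \<oplus>\<^bsub>T\<^esub> \<phi> n'"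
      by (intro single_valued[of "n \<oplus>\<^bsub>N\<^esub> n'"] \<phi> add) simp_all
  next
    fix r n assume n: "r \<in> carrier R" "n \<in> carrier N"
    then show "\<phi> (r \<odot>\<^bsub>N\<^esub> n) = r \<odot>\<^bsub>T\<^esub> \<phi> n"
      by (intro single_valued[of "r \<odot>\<^bsub>N\<^esub> n"] \<phi> smult) simp_all
  qed (use \<phi> cl in auto)
  then show ?thesis using \<phi> by blast
qed

section \<open>Linear combinations and generators\<close>

text \<open>The product of copies of \<open>R\<close> indexed by a type. It does duty for free modules: a vector of
  coefficients on a finite set is the restriction of an element.\<close>

definition fun_module :: "'a ring \<Rightarrow> ('a, 'i \<Rightarrow> 'a) module" where
  "fun_module R = \<lparr>carrier = {f. \<forall>i. f i \<in> carrier R}, monoid.mult = (\<lambda>f g i. f i \<otimes>\<^bsub>R\<^esub> g i),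
     one = (\<lambda>i. \<one>\<^bsub>R\<^esub>), ring.zero = (\<lambda>i. \<zero>\<^bsub>R\<^esub>), add = (\<lambda>f g i. f i \<oplus>\<^bsub>R\<^esub> g i),
     smult = (\<lambda>r f i. r \<otimes>\<^bsub>R\<^esub> f i)\<rparr>"

lemma fun_module_simps [simp]:
  "f \<in> carrier (fun_module R) \<longleftrightarrow> (\<forall>i. f i \<in> carrier R)"
  "f \<oplus>\<^bsub>fun_module R\<^esub> g = (\<lambda>i. f i \<oplus>\<^bsub>R\<^esub> g i)" "\<zero>\<^bsub>fun_module R\<^esub> = (\<lambda>i. \<zero>\<^bsub>R\<^esub>)"
  "r \<odot>\<^bsub>fun_module R\<^esub> f = (\<lambda>i. r \<otimes>\<^bsub>R\<^esub> f i)"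
  by (simp_all add: fun_module_def)

lemma module_fun_module:
  assumes "cring R" shows "module R (fun_module R)"
proof -
  interpret cring R by fact
  show ?thesis
  proof (rule moduleI[OF is_cring])
    show "abelian_group (fun_module R)"
    proof (rule abelian_groupI)
      fix f assume "f \<in> carrier (fun_module R)"
      then show "\<exists>g\<in>carrier (fun_module R). g \<oplus>\<^bsub>fun_module R\<^esub> f = \<zero>\<^bsub>fun_module R\<^esub>"
        by (intro bexI[of _ "\<lambda>i. \<ominus>\<^bsub>R\<^esub> f i"]) (auto simp: l_neg)
    qed (auto simp: a_ac)
  qed (auto simp: l_distr r_distr m_assoc)
qed

lemma Hom_evaluation: "(\<lambda>f. f i) \<in> Hom_module R (fun_module R) (ring_module R)"
  by (rule Hom_moduleI) auto

definition lincomb :: "('a, 't) module \<Rightarrow> 'i set \<Rightarrow> ('i \<Rightarrow> 't) \<Rightarrow> ('i \<Rightarrow> 'a) \<Rightarrow> 't" where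
  "lincomb T A t s = (\<Oplus>\<^bsub>T\<^esub>x\<in>A. s x \<odot>\<^bsub>T\<^esub> t x)"

context
  fixes R :: "'a ring" and T :: "('a, 't) module" and A :: "'i set" and t :: "'i \<Rightarrow> 't"
  assumes T: "module R T" and t: "\<And>x. x \<in> A \<Longrightarrow> t x \<in> carrier T"
begin

interpretation T: module R T by (rule T)

lemma lincomb_cong:
  assumes "\<And>x. x \<in> A \<Longrightarrow> s x = s' x" "\<And>x. x \<in> A \<Longrightarrow> s' x \<in> carrier R"
  shows "lincomb T A t s = lincomb T A t s'"
  unfolding lincomb_def by (rule T.finsum_cong') (use assms t in auto)

lemma Hom_lincomb:
  assumes A: "finite A" shows "lincomb T A t \<in> Hom_module R (fun_module R) T"
proof (rule Hom_moduleI)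
  fix s s' :: "'i \<Rightarrow> 'a" assume s: "s \<in> carrier (fun_module R)"
  then show "lincomb T A t s \<in> carrier T" unfolding lincomb_def using t by (intro T.finsum_closed) auto
  assume s': "s' \<in> carrier (fun_module R)"
  have "lincomb T A t (s \<oplus>\<^bsub>fun_module R\<^esub> s') = (\<Oplus>\<^bsub>T\<^esub>x\<in>A. s x \<odot>\<^bsub>T\<^esub> t x \<oplus>\<^bsub>T\<^esub> s' x \<odot>\<^bsub>T\<^esub> t x)"
    unfolding lincomb_def using s s' t by (intro T.finsum_cong') (auto simp: T.smult_l_distr)
  also have "\<dots> = lincomb T A t s \<oplus>\<^bsub>T\<^esub> lincomb T A t s'"
    unfolding lincomb_def using s s' t by (intro T.finsum_addf) auto
  finally show "lincomb T A t (s \<oplus>\<^bsub>fun_module R\<^esub> s') = lincomb T A t s \<oplus>\<^bsub>T\<^esub> lincomb T A t s'" .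
next
  fix r and s :: "'i \<Rightarrow> 'a" assume r: "r \<in> carrier R" and s: "s \<in> carrier (fun_module R)"
  have "r \<odot>\<^bsub>T\<^esub> lincomb T A t s = (\<Oplus>\<^bsub>T\<^esub>x\<in>A. r \<odot>\<^bsub>T\<^esub> (s x \<odot>\<^bsub>T\<^esub> t x))"
    unfolding lincomb_def using A r s t by (intro T.finsum_smult_ldistr) auto
  also have "\<dots> = lincomb T A t (r \<odot>\<^bsub>fun_module R\<^esub> s)"
    unfolding lincomb_def using r s t by (intro T.finsum_cong') (auto simp: T.smult_assoc1)
  finally show "lincomb T A t (r \<odot>\<^bsub>fun_module R\<^esub> s) = r \<odot>\<^bsub>T\<^esub> lincomb T A t s" by simp
qed

lemma lincomb_zero: "finite A \<Longrightarrow> lincomb T A t (\<lambda>_. \<zero>\<^bsub>R\<^esub>) = \<zero>\<^bsub>T\<^esub>"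
  using Hom_module_zero[OF module_fun_module[OF T.is_cring] T Hom_lincomb] by simp

lemma lincomb_unit:
  assumes "finite A" "d \<in> A"
  shows "lincomb T A t (\<lambda>x. if x = d then \<one>\<^bsub>R\<^esub> else \<zero>\<^bsub>R\<^esub>) = t d"
proof -
  have "lincomb T A t (\<lambda>x. if x = d then \<one>\<^bsub>R\<^esub> else \<zero>\<^bsub>R\<^esub>) = (\<Oplus>\<^bsub>T\<^esub>x\<in>A. if d = x then t x else \<zero>\<^bsub>T\<^esub>)"
    unfolding lincomb_def using t by (intro T.finsum_cong') auto
  then show ?thesis using assms t by (simp add: T.M.add.finprod_singleton)
qed

end

lemma lincomb_ring_commute:
  assumes R: "cring R" and v: "\<And>x. x \<in> A \<Longrightarrow> v x \<in> carrier R" "\<And>x. x \<in> A \<Longrightarrow> g x \<in> carrier R"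
  shows "lincomb (ring_module R) A g v = lincomb (ring_module R) A v g"
proof -
  interpret module R "ring_module R" by (rule module_ring_module[OF R])
  show ?thesis unfolding lincomb_def by (rule M.finsum_cong') (use v in \<open>auto simp: m_comm\<close>)
qed

text \<open>Generation is phrased through submodules rather than through sums, so that showing that a set
  generates, or that a linear condition holds everywhere once it holds on generators, needs no
  coefficients.\<close>

definition generating_set :: "'a ring \<Rightarrow> ('a, 'm) module \<Rightarrow> 'm set \<Rightarrow> bool" where
  "generating_set R M A \<longleftrightarrow> A \<subseteq> carrier M \<and>
     (\<forall>H. submodule H R M \<longrightarrow> A \<subseteq> H \<longrightarrow> carrier M \<subseteq> H)"

lemma generating_setD:
  assumes "generating_set R M A" "submodule H R M" "A \<subseteq> H" "x \<in> carrier M"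
  shows "x \<in> H"
  using assms unfolding generating_set_def by (metis subsetD)

lemma (in module) submodule_finsum:
  assumes "submodule H R M" "\<And>i. i \<in> J \<Longrightarrow> f i \<in> H"
  shows "finsum M f J \<in> H"
proof (cases "finite J")
  case True
  then show ?thesis using assms(2)
  proof (induction J)
    case (insert i J)
    then show ?case
      using submodule_props(1,3)[OF assms(1)] by (subst M.finsum_insert) (auto simp: Pi_def subset_iff)
  qed (simp add: submodule_props[OF assms(1)])
qed (simp add: submodule_props[OF assms(1)] M.finsum_infinite)

lemma generating_set_iff_lincomb:
  assumes M: "module R M" and A: "finite A" "A \<subseteq> carrier M"
  shows "generating_set R M A \<longleftrightarrow> carrier M = lincomb M A (\<lambda>x. x) ` carrier (fun_module R)"
    (is "_ \<longleftrightarrow> _ = ?C")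
proof
  interpret M: module R M by (rule M)
  have t: "\<And>x. x \<in> A \<Longrightarrow> x \<in> carrier M" using A(2) by blast
  have F: "module R (fun_module R)" by (rule module_fun_module[OF M.is_cring])
  interpret F: module R "fun_module R" by (rule F)
  have hom: "lincomb M A (\<lambda>x. x) \<in> Hom_module R (fun_module R) M" by (rule Hom_lincomb[OF M t A(1)])
  show "generating_set R M A" if eq: "carrier M = ?C"
    unfolding generating_set_def
  proof (intro conjI allI impI subsetI)
    fix H x assume H: "submodule H R M" "A \<subseteq> H" and "x \<in> carrier M"
    then obtain s where "\<forall>i. s i \<in> carrier R" "x = lincomb M A (\<lambda>x. x) s" using eq by auto
    then show "x \<in> H" unfolding lincomb_def
      using H M.submodule_props(5)[OF H(1)] by (auto intro!: M.submodule_finsum)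
  qed (use t in auto)
  assume gen: "generating_set R M A"
  have "A \<subseteq> ?C"
  proof
    fix d assume d: "d \<in> A"
    have "lincomb M A (\<lambda>x. x) (\<lambda>x. if x = d then \<one>\<^bsub>R\<^esub> else \<zero>\<^bsub>R\<^esub>) = d"
      by (rule lincomb_unit[OF M t A(1) d])
    then show "d \<in> ?C" by (intro image_eqI[of d _ "\<lambda>x. if x = d then \<one>\<^bsub>R\<^esub> else \<zero>\<^bsub>R\<^esub>"]) auto
  qed
  then have "carrier M \<subseteq> ?C"
    using generating_setD[OF gen submodule_Hom_image[OF F M F.carrier_is_submodule hom]] by blast
  then show "carrier M = ?C" using Hom_moduleD(1)[OF hom] by blast
qed

lemma fg_module_iff: "fg_module R M \<longleftrightarrow> module R M \<and> (\<exists>A. finite A \<and> generating_set R M A)"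
proof -
  have *: "(finite A \<and> A \<subseteq> carrier M \<and> carrier M = {(\<Oplus>\<^bsub>M\<^esub>a\<in>A. r a \<odot>\<^bsub>M\<^esub> a) | r. r \<in> A \<rightarrow> carrier R}) \<longleftrightarrow>
      finite A \<and> generating_set R M A" if M: "module R M" for A
  proof (cases "finite A \<and> A \<subseteq> carrier M")
    case True
    interpret M: module R M by (rule M)
    have t: "\<And>x. x \<in> A \<Longrightarrow> x \<in> carrier M" using True by blast
    have "{(\<Oplus>\<^bsub>M\<^esub>a\<in>A. r a \<odot>\<^bsub>M\<^esub> a) | r. r \<in> A \<rightarrow> carrier R} = lincomb M A (\<lambda>x. x) ` carrier (fun_module R)"
    proof (intro subset_antisym subsetI)
      fix y assume "y \<in> {(\<Oplus>\<^bsub>M\<^esub>a\<in>A. r a \<odot>\<^bsub>M\<^esub> a) | r. r \<in> A \<rightarrow> carrier R}"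
      then obtain r where r: "r \<in> A \<rightarrow> carrier R" "y = lincomb M A (\<lambda>x. x) r" by (auto simp: lincomb_def)
      have "y = lincomb M A (\<lambda>x. x) (\<lambda>x. if x \<in> A then r x else \<zero>\<^bsub>R\<^esub>)"
        unfolding r(2) by (rule lincomb_cong[OF M t]) (use r(1) in auto)
      then show "y \<in> lincomb M A (\<lambda>x. x) ` carrier (fun_module R)"
        using r(1) by (intro image_eqI[of _ _ "\<lambda>x. if x \<in> A then r x else \<zero>\<^bsub>R\<^esub>"]) auto
    qed (auto simp: lincomb_def)
    then show ?thesis using True generating_set_iff_lincomb[OF M, of A] by simp
  qed (auto simp: generating_set_def)
  show ?thesis
    unfolding fg_module_def by (rule conj_cong[OF refl], rule ex_cong1, rule *)
qed

lemma (in module) submodule_add_multiples: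
  assumes D: "submodule D R M" and I: "ideal I R" and a: "a \<in> carrier M"
  shows "submodule {d \<oplus>\<^bsub>M\<^esub> r \<odot>\<^bsub>M\<^esub> a | d r. d \<in> D \<and> r \<in> I} R M" (is "submodule ?S R M")
    and "D \<subseteq> {d \<oplus>\<^bsub>M\<^esub> r \<odot>\<^bsub>M\<^esub> a | d r. d \<in> D \<and> r \<in> I}"
proof -
  interpret I: ideal I R by fact
  note Dp = submodule_props[OF D]
  show DS: "D \<subseteq> ?S"
  proof
    fix d assume d: "d \<in> D"
    then have "d = d \<oplus>\<^bsub>M\<^esub> \<zero> \<odot>\<^bsub>M\<^esub> a" using a Dp(1) by auto
    then show "d \<in> ?S" using d I.zero_closed by blast
  qed
  show "submodule ?S R M"
  proof (rule submodule_criterion)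
    show "?S \<subseteq> carrier M" using a Dp(1) I.Icarr by auto
    show "\<zero>\<^bsub>M\<^esub> \<in> ?S" using DS Dp(2) by blast
  next
    fix y z assume "y \<in> ?S" "z \<in> ?S"
    then obtain d r e s where *: "y = d \<oplus>\<^bsub>M\<^esub> r \<odot>\<^bsub>M\<^esub> a" "z = e \<oplus>\<^bsub>M\<^esub> s \<odot>\<^bsub>M\<^esub> a" "d \<in> D" "e \<in> D" "r \<in> I" "s \<in> I"
      by blast
    have "d \<in> carrier M" "e \<in> carrier M" "r \<in> carrier R" "s \<in> carrier R" using * Dp(1) I.Icarr by auto
    then have "y \<oplus>\<^bsub>M\<^esub> z = (d \<oplus>\<^bsub>M\<^esub> e) \<oplus>\<^bsub>M\<^esub> (r \<oplus> s) \<odot>\<^bsub>M\<^esub> a"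
      using * a by (simp add: smult_l_distr M.a_ac)
    then show "y \<oplus>\<^bsub>M\<^esub> z \<in> ?S" using * Dp(3) I.a_closed by blast
  next
    fix s y assume s: "s \<in> carrier R" and "y \<in> ?S"
    then obtain d r where *: "y = d \<oplus>\<^bsub>M\<^esub> r \<odot>\<^bsub>M\<^esub> a" "d \<in> D" "r \<in> I" by blast
    have "d \<in> carrier M" "r \<in> carrier R" using * Dp(1) I.Icarr by auto
    then have "s \<odot>\<^bsub>M\<^esub> y = s \<odot>\<^bsub>M\<^esub> d \<oplus>\<^bsub>M\<^esub> (s \<otimes> r) \<odot>\<^bsub>M\<^esub> a"
      using * a s by (simp add: smult_r_distr smult_assoc1)
    then show "s \<odot>\<^bsub>M\<^esub> y \<in> ?S" using * s Dp(5) I.I_l_closed by blast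
  qed
qed

lemma submodule_ring_module_iff:
  fixes R :: "'a ring" (structure)
  assumes "cring R"
  shows "submodule H R (ring_module R) \<longleftrightarrow> ideal H R"
proof -
  interpret cring R by fact
  interpret RM: module R "ring_module R" using module_ring_module[OF is_cring] .
  show ?thesis
  proof
    assume "submodule H R (ring_module R)"
    from RM.submodule_props[OF this] show "ideal H R" by (intro ideal_criterion) auto
  next
    assume "ideal H R"
    then interpret H: ideal H R .
    show "submodule H R (ring_module R)"
      by (rule RM.submodule_criterion) (auto simp: H.I_l_closed intro: H.Icarr H.zero_closed H.a_closed)
  qed
qed

section \<open>Sums of submodules\<close>

lemma submodule_sum_upper:
  assumes M: "module R M" and i: "i \<in> I" and y: "y \<in> F i" "y \<in> carrier M"
  shows "y \<in> submodule_sum M I F"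
proof -
  interpret module R M by fact
  show ?thesis
    unfolding submodule_sum_def using i y
    by (intro CollectI exI[of _ "{i}"] exI[of _ "\<lambda>_. y"]) (auto simp: M.finsum_insert)
qed

lemma submodule_sum_least:
  assumes M: "module R M" and H: "H \<subseteq> carrier M" "\<zero>\<^bsub>M\<^esub> \<in> H"
      "\<And>a b. a \<in> H \<Longrightarrow> b \<in> H \<Longrightarrow> a \<oplus>\<^bsub>M\<^esub> b \<in> H"
    and F: "\<And>i. i \<in> I \<Longrightarrow> F i \<subseteq> H"
  shows "submodule_sum M I F \<subseteq> H"
proof
  interpret module R M by fact
  fix y assume "y \<in> submodule_sum M I F"
  then obtain J x where J: "finite J" "J \<subseteq> I" "\<forall>i\<in>J. x i \<in> F i" "y = (\<Oplus>\<^bsub>M\<^esub>i\<in>J. x i)"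
    unfolding submodule_sum_def by blast
  have "(\<Oplus>\<^bsub>M\<^esub>i\<in>J. x i) \<in> H" using J(1-3)
  proof (induction J)
    case (insert i J)
    have "x j \<in> H" if "j \<in> insert i J" for j using insert.prems F that by blast
    then show ?case using insert H by (subst M.finsum_insert) (auto simp: Pi_def subset_iff)
  qed (simp add: H)
  then show "y \<in> H" using J by simp
qed

lemma submodule_submodule_sum:
  assumes M: "module R M" and F: "\<And>i. i \<in> I \<Longrightarrow> submodule (F i) R M"
  shows "submodule (submodule_sum M I F) R M"
proof -
  interpret module R M by fact
  note Fp = submodule_props[OF F]
  show ?thesis
  proof (rule submodule_criterion)
    show "submodule_sum M I F \<subseteq> carrier M"
      by (rule submodule_sum_least[OF M]) (use Fp(1) in auto)
    show "\<zero>\<^bsub>M\<^esub> \<in> submodule_sum M I F"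
      unfolding submodule_sum_def by (intro CollectI exI[of _ "{}"]) simp
  next
    fix a b assume "a \<in> submodule_sum M I F" "b \<in> submodule_sum M I F"
    then obtain J x J' y where J: "finite J" "J \<subseteq> I" "\<forall>i\<in>J. x i \<in> F i" "a = (\<Oplus>\<^bsub>M\<^esub>i\<in>J. x i)"
      and J': "finite J'" "J' \<subseteq> I" "\<forall>i\<in>J'. y i \<in> F i" "b = (\<Oplus>\<^bsub>M\<^esub>i\<in>J'. y i)"
      unfolding submodule_sum_def by blast
    define x' where "x' i = (if i \<in> J then x i else \<zero>\<^bsub>M\<^esub>)" for i
    define y' where "y' i = (if i \<in> J' then y i else \<zero>\<^bsub>M\<^esub>)" for i
    have x': "x' i \<in> F i" if "i \<in> J \<union> J'" for i using that J J' Fp(2) by (auto simp: x'_def)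
    have y': "y' i \<in> F i" if "i \<in> J \<union> J'" for i using that J J' Fp(2) by (auto simp: y'_def)
    have FM: "F i \<subseteq> carrier M" if "i \<in> J \<union> J'" for i using that J J' Fp(1) by blast
    have xy: "x i \<in> carrier M" if "i \<in> J" for i using that J FM[of i] by blast
    have xy': "y i \<in> carrier M" if "i \<in> J'" for i using that J' FM[of i] by blast
    have "a = (\<Oplus>\<^bsub>M\<^esub>i\<in>J \<union> J'. x' i)"
      unfolding J(4) by (rule M.add.finprod_mono_neutral_cong_left)
        (use J(1) J'(1) xy in \<open>auto simp: x'_def\<close>)
    moreover have "b = (\<Oplus>\<^bsub>M\<^esub>i\<in>J \<union> J'. y' i)"
      unfolding J'(4) by (rule M.add.finprod_mono_neutral_cong_left)
        (use J(1) J'(1) xy' in \<open>auto simp: y'_def\<close>)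
    ultimately have "a \<oplus>\<^bsub>M\<^esub> b = (\<Oplus>\<^bsub>M\<^esub>i\<in>J \<union> J'. x' i \<oplus>\<^bsub>M\<^esub> y' i)"
      using x' y' FM by (subst M.finsum_addf) (auto simp: Pi_def subset_iff)
    moreover have "x' i \<oplus>\<^bsub>M\<^esub> y' i \<in> F i" if "i \<in> J \<union> J'" for i
      using Fp(3)[OF _ x'[OF that] y'[OF that]] that J J' by blast
    ultimately show "a \<oplus>\<^bsub>M\<^esub> b \<in> submodule_sum M I F"
      unfolding submodule_sum_def using J J'
      by (intro CollectI exI[of _ "J \<union> J'"] exI[of _ "\<lambda>i. x' i \<oplus>\<^bsub>M\<^esub> y' i"]) auto
  next
    fix r a assume r: "r \<in> carrier R" and "a \<in> submodule_sum M I F"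
    then obtain J x where J: "finite J" "J \<subseteq> I" "\<forall>i\<in>J. x i \<in> F i" "a = (\<Oplus>\<^bsub>M\<^esub>i\<in>J. x i)"
      unfolding submodule_sum_def by blast
    have "r \<odot>\<^bsub>M\<^esub> a = (\<Oplus>\<^bsub>M\<^esub>i\<in>J. r \<odot>\<^bsub>M\<^esub> x i)"
      unfolding J(4) using J r Fp(1) by (intro finsum_smult_ldistr) auto
    then show "r \<odot>\<^bsub>M\<^esub> a \<in> submodule_sum M I F"
      unfolding submodule_sum_def using J Fp(5)[OF _ r]
      by (intro CollectI exI[of _ J] exI[of _ "\<lambda>i. r \<odot>\<^bsub>M\<^esub> x i"]) auto
  qed
qed


section \<open>Nakayama's lemma\<close>

lemma ideal_add_multiples:
  fixes R :: "'a ring" (structure)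
  assumes R: "cring R" and D: "ideal D R" and I: "ideal I R" and a: "a \<in> carrier R"
  shows "ideal {d \<oplus> r \<otimes> a | d r. d \<in> D \<and> r \<in> I} R" "D \<subseteq> {d \<oplus> r \<otimes> a | d r. d \<in> D \<and> r \<in> I}"
proof -
  interpret RM: module R "ring_module R" by (rule module_ring_module[OF R])
  have "submodule D R (ring_module R)" using D submodule_ring_module_iff[OF R] by simp
  from RM.submodule_add_multiples[OF this I, of a]
  show "ideal {d \<oplus> r \<otimes> a | d r. d \<in> D \<and> r \<in> I} R" "D \<subseteq> {d \<oplus> r \<otimes> a | d r. d \<in> D \<and> r \<in> I}"
    using a submodule_ring_module_iff[OF R] by simp_all
qed

text \<open>The set \<open>W\<close> will be either the complement of a prime \<open>I\<close>, or the set of elements congruent modulo \<open>I\<close>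
  to a power of a fixed element. Generators of \<open>N\<close> are eliminated one at a time: if \<open>wN \<subseteq> I\<langle>C, n\<rangle>\<close>, then
  \<open>wn = m + an\<close> with \<open>m \<in> I\<langle>C\<rangle>\<close> and \<open>a \<in> I\<close>, that is, \<open>(w - a)n = m\<close>, and so \<open>(w - a)wN \<subseteq> I\<langle>C\<rangle>\<close>.\<close>

lemma (in noetherian_cring) nakayama:
  assumes I: "ideal I R" and N: "ideal N R"
    and W: "W \<subseteq> carrier R" "\<And>v w. v \<in> W \<Longrightarrow> w \<in> W \<Longrightarrow> v \<otimes> w \<in> W"
      "\<And>w a. w \<in> W \<Longrightarrow> a \<in> I \<Longrightarrow> w \<ominus> a \<in> W"
    and w: "w \<in> W" "\<And>y. y \<in> N \<Longrightarrow> w \<otimes> y \<in> Idl {i \<otimes> n | i n. i \<in> I \<and> n \<in> N}"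
  shows "\<exists>w\<in>W. \<forall>y\<in>N. w \<otimes> y = \<zero>"
proof -
  interpret I: ideal I R by fact
  interpret N: ideal N R by fact
  obtain B where B: "B \<subseteq> carrier R" "finite B" "N = Idl B" using finetely_gen[OF N] by blast
  define IB where "IB C = Idl {i \<otimes> n | i n. i \<in> I \<and> n \<in> C}" for C
  have sub: "{i \<otimes> n | i n. i \<in> I \<and> n \<in> C} \<subseteq> carrier R" if "C \<subseteq> carrier R" for C
    using that I.Icarr by auto
  have iIB: "ideal (IB C) R" if "C \<subseteq> carrier R" for C
    unfolding IB_def by (rule genideal_ideal[OF sub[OF that]])
  have mem: "i \<otimes> n \<in> IB C" if "C \<subseteq> carrier R" "i \<in> I" "n \<in> C" for C i n
    using genideal_self[OF sub[OF that(1)]] that(2,3) unfolding IB_def by blast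
  have NB: "IB N \<subseteq> IB B"
  proof -
    interpret K: ideal "IB B" R by (rule iIB[OF B(1)])
    have "ideal {n \<in> carrier R. \<forall>i\<in>I. n \<otimes> i \<in> IB B} R"
      by (rule colon_ideal[OF iIB[OF B(1)]]) (use I.Icarr in auto)
    moreover have "B \<subseteq> {n \<in> carrier R. \<forall>i\<in>I. n \<otimes> i \<in> IB B}"
    proof
      fix n assume n: "n \<in> B"
      have "n \<otimes> i \<in> IB B" if "i \<in> I" for i
        using mem[OF B(1) that n] m_comm[of n i] n B(1) I.Icarr[OF that] by auto
      then show "n \<in> {n \<in> carrier R. \<forall>i\<in>I. n \<otimes> i \<in> IB B}" using n B(1) by auto
    qed
    ultimately have "N \<subseteq> {n \<in> carrier R. \<forall>i\<in>I. n \<otimes> i \<in> IB B}"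
      unfolding B(3) by (rule genideal_minimal)
    then have "{i \<otimes> n | i n. i \<in> I \<and> n \<in> N} \<subseteq> IB B"
      using I.Icarr m_comm by (fastforce simp: subset_iff)
    then show ?thesis unfolding IB_def[of N] by (rule genideal_minimal[OF iIB[OF B(1)]])
  qed
  have step: "\<exists>w\<in>W. \<forall>y\<in>N. w \<otimes> y = \<zero>"
    if "finite C" "C \<subseteq> N" "w \<in> W" "\<forall>y\<in>N. w \<otimes> y \<in> IB C" for C w
    using that
  proof (induction C arbitrary: w)
    case empty
    have "{i \<otimes> n | i n. i \<in> I \<and> n \<in> {}} \<subseteq> {\<zero>}" by auto
    then have "IB {} \<subseteq> {\<zero>}" unfolding IB_def by (rule genideal_minimal[OF zeroideal])
    then show ?case using empty by blast
  next
    case (insert n C)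
    have c: "n \<in> carrier R" "C \<subseteq> carrier R" "w \<in> carrier R" "insert n C \<subseteq> carrier R"
      using insert N.a_subset W(1) by auto
    interpret K: ideal "IB C" R by (rule iIB[OF c(2)])
    let ?S = "{m \<oplus> a \<otimes> n | m a. m \<in> IB C \<and> a \<in> I}"
    have "ideal ?S R" using ideal_add_multiples(1)[OF is_cring K.ideal_axioms I c(1)] .
    moreover have "{i \<otimes> m | i m. i \<in> I \<and> m \<in> insert n C} \<subseteq> ?S"
    proof
      fix z assume "z \<in> {i \<otimes> m | i m. i \<in> I \<and> m \<in> insert n C}"
      then obtain i m where z: "z = i \<otimes> m" "i \<in> I" "m \<in> insert n C" by blast
      show "z \<in> ?S"
      proof (cases "m = n")
        case True
        then have "z = \<zero> \<oplus> i \<otimes> n" using z c I.Icarr by simp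
        then show ?thesis using z(2) K.zero_closed by blast
      next
        case False
        then have m: "m \<in> C" "m \<in> carrier R" using z c by auto
        then have "z = i \<otimes> m \<oplus> \<zero> \<otimes> n" using z c I.Icarr by simp
        then show ?thesis using I.zero_closed mem[OF c(2) z(2) m(1)] by blast
      qed
    qed
    ultimately have IS: "IB (insert n C) \<subseteq> ?S" unfolding IB_def by (rule genideal_minimal)
    have "n \<in> N" using insert by blast
    then obtain a m where am: "w \<otimes> n = m \<oplus> a \<otimes> n" "a \<in> I" "m \<in> IB C"
      using insert.prems(3) IS by blast
    have ac: "a \<in> carrier R" "m \<in> carrier R" using am I.Icarr K.Icarr by auto
    have wn: "(w \<ominus> a) \<otimes> n = m"
    proof -
      have "(w \<ominus> a) \<otimes> n = w \<otimes> n \<ominus> a \<otimes> n"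
        using c ac by (simp add: a_minus_def l_distr l_minus)
      then show ?thesis unfolding am(1) using c ac by algebra
    qed
    have v: "w \<ominus> a \<in> W" using W(3) insert.prems am by blast
    have "((w \<ominus> a) \<otimes> w) \<otimes> y \<in> IB C" if y: "y \<in> N" for y
    proof -
      obtain b m' where b: "w \<otimes> y = m' \<oplus> b \<otimes> n" "b \<in> I" "m' \<in> IB C"
        using insert.prems(3) IS y by blast
      have bc: "b \<in> carrier R" "m' \<in> carrier R" "y \<in> carrier R" using b I.Icarr K.Icarr N.Icarr y by auto
      have va: "w \<ominus> a \<in> carrier R" using c ac by simp
      have "((w \<ominus> a) \<otimes> w) \<otimes> y = (w \<ominus> a) \<otimes> (m' \<oplus> b \<otimes> n)"
        using b va c bc by (simp add: m_assoc)
      also have "\<dots> = (w \<ominus> a) \<otimes> m' \<oplus> b \<otimes> ((w \<ominus> a) \<otimes> n)"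
        using va c bc by (simp add: r_distr m_lcomm)
      finally show ?thesis unfolding wn using K.I_l_closed am b bc va K.a_closed by simp
    qed
    then show ?case
      by (intro insert.IH[of "(w \<ominus> a) \<otimes> w"]) (use insert.prems v W(2) in auto)
  qed
  have "B \<subseteq> N" using genideal_self[OF B(1)] B(3) by simp
  then show ?thesis using step[OF B(2) _ w(1)] w(2) NB unfolding IB_def by blast
qed

section \<open>Linear maps into a module killed by a prime\<close>

lemma (in abelian_group) minus_eq_zero_imp_eq:
  assumes "a \<ominus> b = \<zero>" "a \<in> carrier G" "b \<in> carrier G"
  shows "a = b"
proof -
  have "a = (a \<ominus> b) \<oplus> b" using assms(2,3) by (simp add: a_minus_def a_assoc l_neg)
  then show ?thesis using assms by simp
qed

lemma (in abelian_group) minus_minus_cancel: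
  assumes "a \<in> carrier G" "b \<in> carrier G" "c \<in> carrier G"
  shows "(a \<ominus> b) \<ominus> (a \<ominus> c) = c \<ominus> b"
proof -
  have "(a \<ominus> b) \<ominus> (a \<ominus> c) = (a \<oplus> \<ominus> a) \<oplus> (c \<ominus> b)"
    unfolding a_minus_def using assms by (simp add: minus_add a_ac del: r_neg)
  then show ?thesis using assms by (simp add: r_neg)
qed

text \<open>This is linear algebra over the residue field of \<open>P\<close> with cleared denominators. There \<open>N/D0\<close> becomes a
  finite-dimensional vector space in which \<open>x\<close> is nonzero. Going through the generators, each one is
  made a multiple of \<open>x\<close> modulo \<open>D\<close>, by enlarging \<open>D\<close> if necessary, until \<open>D\<close> is a hyperplane that does not
  contain \<open>x\<close>. The factor \<open>u\<close> is a common denominator, and the map reads off the coefficient of \<open>x\<close> and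
  multiplies it by \<open>t\<close>.\<close>

lemma functional_extension:
  fixes R (structure) and N :: "('a, 'n) module" and T :: "('a, 't) module"
  assumes N: "module R N" and T: "module R T" and P: "primeideal P R"
    and A: "finite A" "generating_set R N A"
    and D0: "submodule D0 R N" "\<And>a n. a \<in> P \<Longrightarrow> n \<in> carrier N \<Longrightarrow> a \<odot>\<^bsub>N\<^esub> n \<in> D0"
    and x: "x \<in> carrier N" "\<And>u. u \<in> carrier R - P \<Longrightarrow> u \<odot>\<^bsub>N\<^esub> x \<notin> D0"
    and t: "t \<in> carrier T" "\<And>a. a \<in> P \<Longrightarrow> a \<odot>\<^bsub>T\<^esub> t = \<zero>\<^bsub>T\<^esub>"
  shows "\<exists>\<phi>\<in>Hom_module R N T. \<exists>r\<in>carrier R - P. \<phi> x = r \<odot>\<^bsub>T\<^esub> t"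
proof -
  interpret N: module R N by fact
  interpret T: module R T by fact
  interpret P: primeideal P R by fact
  note PI = P.I_prime
  have Pmult: "u \<otimes> v \<in> carrier R - P" if "u \<in> carrier R - P" "v \<in> carrier R - P" for u v
    using that PI by auto
  have one: "\<one> \<in> carrier R - P" using P.one_imp_carrier P.I_notcarr by auto
  have "\<exists>D u. submodule D R N \<and> D0 \<subseteq> D \<and> u \<in> carrier R - P \<and> (\<forall>v\<in>carrier R - P. v \<odot>\<^bsub>N\<^esub> x \<notin> D) \<and>
    (\<forall>a\<in>C. \<exists>r\<in>carrier R. u \<odot>\<^bsub>N\<^esub> a \<ominus>\<^bsub>N\<^esub> r \<odot>\<^bsub>N\<^esub> x \<in> D)"
    if "finite C" "C \<subseteq> carrier N" for C
    using that
  proof (induction C)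
    case empty
    then show ?case using D0 x one by blast
  next
    case (insert a C)
    then obtain D u where D: "submodule D R N" "D0 \<subseteq> D" "u \<in> carrier R - P"
      "\<And>v. v\<in>carrier R - P \<Longrightarrow> v \<odot>\<^bsub>N\<^esub> x \<notin> D" "\<And>b. b\<in>C \<Longrightarrow> \<exists>r\<in>carrier R. u \<odot>\<^bsub>N\<^esub> b \<ominus>\<^bsub>N\<^esub> r \<odot>\<^bsub>N\<^esub> x \<in> D"
      by auto
    note Dp = N.submodule_props[OF D(1)]
    have a: "a \<in> carrier N" "C \<subseteq> carrier N" using insert by auto
    have u: "u \<in> carrier R" using D(3) by blast
    show ?case
    proof (cases "\<exists>v\<in>carrier R - P. \<exists>d\<in>D. \<exists>r\<in>carrier R. v \<odot>\<^bsub>N\<^esub> x = d \<oplus>\<^bsub>N\<^esub> r \<odot>\<^bsub>N\<^esub> a")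
      \<comment> \<open>Here \<open>a\<close> is already a multiple of \<open>x\<close> modulo \<open>D\<close>, with \<open>r\<close> as a new denominator.\<close>
      case True
      then obtain v d r where v: "v \<in> carrier R - P" "d \<in> D" "r \<in> carrier R" "v \<odot>\<^bsub>N\<^esub> x = d \<oplus>\<^bsub>N\<^esub> r \<odot>\<^bsub>N\<^esub> a" by blast
      have vc: "v \<in> carrier R" "d \<in> carrier N" using v Dp(1) by auto
      have rP: "r \<notin> P"
      proof
        assume "r \<in> P"
        then have "r \<odot>\<^bsub>N\<^esub> a \<in> D" using D0(2)[of r a] D(2) a by blast
        then have "v \<odot>\<^bsub>N\<^esub> x \<in> D" using Dp(3) v by simp
        then show False using D(4) v by blast
      qed
      have "\<exists>s\<in>carrier R. (r \<otimes> u) \<odot>\<^bsub>N\<^esub> b \<ominus>\<^bsub>N\<^esub> s \<odot>\<^bsub>N\<^esub> x \<in> D" if b: "b \<in> insert a C" for b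
      proof (cases "b = a")
        case True
        have "(r \<otimes> u) \<odot>\<^bsub>N\<^esub> a \<ominus>\<^bsub>N\<^esub> (u \<otimes> v) \<odot>\<^bsub>N\<^esub> x = u \<odot>\<^bsub>N\<^esub> (r \<odot>\<^bsub>N\<^esub> a \<ominus>\<^bsub>N\<^esub> v \<odot>\<^bsub>N\<^esub> x)"
          using u v(3) vc a x(1)
          by (simp add: a_minus_def N.smult_r_distr N.smult_r_minus N.smult_assoc1[symmetric] N.m_comm)
        also have "r \<odot>\<^bsub>N\<^esub> a \<ominus>\<^bsub>N\<^esub> v \<odot>\<^bsub>N\<^esub> x = \<ominus>\<^bsub>N\<^esub> d"
          unfolding v(4) using v(3) vc a by (simp add: a_minus_def N.minus_add N.a_ac N.r_neg1 N.r_neg2 N.M.r_neg)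
        also have "u \<odot>\<^bsub>N\<^esub> (\<ominus>\<^bsub>N\<^esub> d) \<in> D"
          using Dp(5)[OF u] N.submoduleE(3)[OF D(1)] v by blast
        finally show ?thesis using True u vc by (intro bexI[of _ "u \<otimes> v"]) auto
      next
        case False
        then obtain s where s: "s \<in> carrier R" "u \<odot>\<^bsub>N\<^esub> b \<ominus>\<^bsub>N\<^esub> s \<odot>\<^bsub>N\<^esub> x \<in> D" using D(5) b by blast
        have bc: "b \<in> carrier N" using b a by auto
        have "(r \<otimes> u) \<odot>\<^bsub>N\<^esub> b \<ominus>\<^bsub>N\<^esub> (r \<otimes> s) \<odot>\<^bsub>N\<^esub> x = r \<odot>\<^bsub>N\<^esub> (u \<odot>\<^bsub>N\<^esub> b \<ominus>\<^bsub>N\<^esub> s \<odot>\<^bsub>N\<^esub> x)"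
          using u v(3) s bc x(1)
          by (simp add: a_minus_def N.smult_r_distr N.smult_r_minus N.smult_assoc1)
        then have "(r \<otimes> u) \<odot>\<^bsub>N\<^esub> b \<ominus>\<^bsub>N\<^esub> (r \<otimes> s) \<odot>\<^bsub>N\<^esub> x \<in> D" using Dp(5)[OF v(3) s(2)] by simp
        then show ?thesis using s v(3) by blast
      qed
      moreover have "r \<otimes> u \<in> carrier R - P" using Pmult rP v(3) D(3) by blast
      ultimately show ?thesis using D(1,2,4) by blast
    next
      \<comment> \<open>Here \<open>x\<close> stays outside when \<open>a\<close> is added to \<open>D\<close>.\<close>
      case False
      let ?D = "{d \<oplus>\<^bsub>N\<^esub> r \<odot>\<^bsub>N\<^esub> a | d r. d \<in> D \<and> r \<in> carrier R}"
      have 1: "submodule ?D R N" and "D \<subseteq> ?D"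
        by (rule N.submodule_add_multiples[OF D(1) N.oneideal a(1)])+
      then have DD: "d \<in> ?D" if "d \<in> D" for d using that by blast
      have 2: "\<exists>r\<in>carrier R. u \<odot>\<^bsub>N\<^esub> b \<ominus>\<^bsub>N\<^esub> r \<odot>\<^bsub>N\<^esub> x \<in> ?D" if b: "b \<in> insert a C" for b
      proof (cases "b = a")
        case True
        have "u \<odot>\<^bsub>N\<^esub> a \<ominus>\<^bsub>N\<^esub> \<zero> \<odot>\<^bsub>N\<^esub> x = \<zero>\<^bsub>N\<^esub> \<oplus>\<^bsub>N\<^esub> u \<odot>\<^bsub>N\<^esub> a"
          using u a x(1) by (simp add: a_minus_def)
        then show ?thesis using True u Dp(2) by (intro bexI[of _ \<zero>]) auto
      next
        case False
        then show ?thesis using D(5)[of b] b DD by blast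
      qed
      have 3: "v \<odot>\<^bsub>N\<^esub> x \<notin> ?D" if "v \<in> carrier R - P" for v using False that by blast
      show ?thesis using 1 2 3 D(2,3) DD by blast
    qed
  qed
  from this[of A] A obtain D u where D: "submodule D R N" "u \<in> carrier R - P"
    "\<And>v. v \<in> carrier R - P \<Longrightarrow> v \<odot>\<^bsub>N\<^esub> x \<notin> D" "\<And>a. a \<in> A \<Longrightarrow> \<exists>r\<in>carrier R. u \<odot>\<^bsub>N\<^esub> a \<ominus>\<^bsub>N\<^esub> r \<odot>\<^bsub>N\<^esub> x \<in> D"
    unfolding generating_set_def by auto
  note Dp = N.submodule_props[OF D(1)]
  have u: "u \<in> carrier R" using D(2) by blast
  define rel where "rel n r \<longleftrightarrow> r \<in> carrier R \<and> u \<odot>\<^bsub>N\<^esub> n \<ominus>\<^bsub>N\<^esub> r \<odot>\<^bsub>N\<^esub> x \<in> D" for n r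
  have rel_add: "rel (n \<oplus>\<^bsub>N\<^esub> n') (r \<oplus> r')"
    if "rel n r" "rel n' r'" "n \<in> carrier N" "n' \<in> carrier N" for n n' r r'
  proof -
    have rc: "r \<in> carrier R" "r' \<in> carrier R" using that by (auto simp: rel_def)
    have "u \<odot>\<^bsub>N\<^esub> (n \<oplus>\<^bsub>N\<^esub> n') \<ominus>\<^bsub>N\<^esub> (r \<oplus> r') \<odot>\<^bsub>N\<^esub> x =
      (u \<odot>\<^bsub>N\<^esub> n \<ominus>\<^bsub>N\<^esub> r \<odot>\<^bsub>N\<^esub> x) \<oplus>\<^bsub>N\<^esub> (u \<odot>\<^bsub>N\<^esub> n' \<ominus>\<^bsub>N\<^esub> r' \<odot>\<^bsub>N\<^esub> x)"
      using that rc u x(1)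
      by (simp add: a_minus_def N.smult_r_distr N.smult_l_distr N.M.minus_add N.M.a_ac)
    then show ?thesis using that Dp(3) by (simp add: rel_def)
  qed
  have rel_smult: "rel (s \<odot>\<^bsub>N\<^esub> n) (s \<otimes> r)"
    if "rel n r" "n \<in> carrier N" "s \<in> carrier R" for n r s
  proof -
    have rc: "r \<in> carrier R" using that by (auto simp: rel_def)
    have "u \<odot>\<^bsub>N\<^esub> (s \<odot>\<^bsub>N\<^esub> n) \<ominus>\<^bsub>N\<^esub> (s \<otimes> r) \<odot>\<^bsub>N\<^esub> x = s \<odot>\<^bsub>N\<^esub> (u \<odot>\<^bsub>N\<^esub> n \<ominus>\<^bsub>N\<^esub> r \<odot>\<^bsub>N\<^esub> x)"
      using that rc u x(1)
      by (simp add: a_minus_def N.smult_r_distr N.smult_r_minus N.smult_assoc1[symmetric] N.m_comm)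
    then show ?thesis using that Dp(5) by (simp add: rel_def)
  qed
  have ex: "\<exists>r. rel n r" if "n \<in> carrier N" for n
  proof -
    have "submodule {n \<in> carrier N. \<exists>r. rel n r} R N"
    proof (rule N.submodule_criterion)
      have "rel \<zero>\<^bsub>N\<^esub> \<zero>" using u x(1) N.submoduleE(3)[OF D(1) Dp(2)] by (simp add: rel_def a_minus_def)
      then show "\<zero>\<^bsub>N\<^esub> \<in> {n \<in> carrier N. \<exists>r. rel n r}" by auto
    next
      fix n m assume "n \<in> {n \<in> carrier N. \<exists>r. rel n r}" "m \<in> {n \<in> carrier N. \<exists>r. rel n r}"
      then show "n \<oplus>\<^bsub>N\<^esub> m \<in> {n \<in> carrier N. \<exists>r. rel n r}" using rel_add by blast
    next
      fix s n assume "s \<in> carrier R" "n \<in> {n \<in> carrier N. \<exists>r. rel n r}"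
      then show "s \<odot>\<^bsub>N\<^esub> n \<in> {n \<in> carrier N. \<exists>r. rel n r}" using rel_smult by blast
    qed auto
    moreover have "A \<subseteq> {n \<in> carrier N. \<exists>r. rel n r}"
    proof
      fix a assume a: "a \<in> A"
      then have "a \<in> carrier N" using A(2) by (auto simp: generating_set_def)
      moreover obtain r where "rel a r" using D(4)[OF a] by (auto simp: rel_def)
      ultimately show "a \<in> {n \<in> carrier N. \<exists>r. rel n r}" by blast
    qed
    ultimately have "n \<in> {n \<in> carrier N. \<exists>r. rel n r}"
      by (rule generating_setD[OF A(2) _ _ that])
    then show ?thesis by blast
  qed
  have uniq: "r \<odot>\<^bsub>T\<^esub> t = r' \<odot>\<^bsub>T\<^esub> t" if "rel n r" "rel n r'" "n \<in> carrier N" for n r r'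
  proof -
    have rc: "r \<in> carrier R" "r' \<in> carrier R" using that by (auto simp: rel_def)
    have "(r' \<ominus> r) \<odot>\<^bsub>N\<^esub> x = (u \<odot>\<^bsub>N\<^esub> n \<ominus>\<^bsub>N\<^esub> r \<odot>\<^bsub>N\<^esub> x) \<ominus>\<^bsub>N\<^esub> (u \<odot>\<^bsub>N\<^esub> n \<ominus>\<^bsub>N\<^esub> r' \<odot>\<^bsub>N\<^esub> x)"
      using that rc u x(1) by (subst N.M.minus_minus_cancel) (auto simp: a_minus_def N.smult_l_distr N.smult_l_minus)
    then have "(r' \<ominus> r) \<odot>\<^bsub>N\<^esub> x \<in> D" using that Dp(4) by (simp add: rel_def)
    then have "r' \<ominus> r \<in> P" using D(3)[of "r' \<ominus> r"] rc by auto
    then have "(r' \<ominus> r) \<odot>\<^bsub>T\<^esub> t = \<zero>\<^bsub>T\<^esub>" using t by blast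
    then have "r' \<odot>\<^bsub>T\<^esub> t \<ominus>\<^bsub>T\<^esub> r \<odot>\<^bsub>T\<^esub> t = \<zero>\<^bsub>T\<^esub>"
      using rc t by (simp add: a_minus_def T.smult_l_distr T.smult_l_minus)
    then show ?thesis using rc t(1) by (metis T.M.minus_eq_zero_imp_eq T.smult_closed)
  qed
  have "\<exists>\<phi>\<in>Hom_module R N T. \<forall>n\<in>carrier N. \<exists>r. rel n r \<and> \<phi> n = r \<odot>\<^bsub>T\<^esub> t"
  proof (rule Hom_module_of_relation[OF _ _ N])
    show "\<exists>w r. rel n r \<and> w = r \<odot>\<^bsub>T\<^esub> t" if "n \<in> carrier N" for n using ex[OF that] by blast
    show "w = w'" if "n \<in> carrier N" "\<exists>r. rel n r \<and> w = r \<odot>\<^bsub>T\<^esub> t" "\<exists>r. rel n r \<and> w' = r \<odot>\<^bsub>T\<^esub> t" for n w w'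
      using uniq that by blast
    show "w \<in> carrier T" if "\<exists>r. rel n r \<and> w = r \<odot>\<^bsub>T\<^esub> t" for n w using that t(1) by (auto simp: rel_def)
  next
    fix n n' w w' assume n: "n \<in> carrier N" "n' \<in> carrier N"
      and "\<exists>r. rel n r \<and> w = r \<odot>\<^bsub>T\<^esub> t" "\<exists>r. rel n' r \<and> w' = r \<odot>\<^bsub>T\<^esub> t"
    then obtain r r' where r: "rel n r" "w = r \<odot>\<^bsub>T\<^esub> t" "rel n' r'" "w' = r' \<odot>\<^bsub>T\<^esub> t" by blast
    show "\<exists>r. rel (n \<oplus>\<^bsub>N\<^esub> n') r \<and> w \<oplus>\<^bsub>T\<^esub> w' = r \<odot>\<^bsub>T\<^esub> t"
      using rel_add[OF r(1,3) n] r t(1) by (intro exI[of _ "r \<oplus> r'"]) (simp add: rel_def T.smult_l_distr)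
  next
    fix s n w assume n: "s \<in> carrier R" "n \<in> carrier N" and "\<exists>r. rel n r \<and> w = r \<odot>\<^bsub>T\<^esub> t"
    then obtain r where r: "rel n r" "w = r \<odot>\<^bsub>T\<^esub> t" by blast
    show "\<exists>r. rel (s \<odot>\<^bsub>N\<^esub> n) r \<and> s \<odot>\<^bsub>T\<^esub> w = r \<odot>\<^bsub>T\<^esub> t"
      using rel_smult[OF r(1) n(2,1)] r n(1) t(1) by (intro exI[of _ "s \<otimes> r"]) (simp add: rel_def T.smult_assoc1)
  qed
  then obtain \<phi> where \<phi>: "\<phi> \<in> Hom_module R N T" "\<forall>n\<in>carrier N. \<exists>r. rel n r \<and> \<phi> n = r \<odot>\<^bsub>T\<^esub> t" ..
  have "rel x u" using u x(1) Dp(2) by (simp add: rel_def a_minus_def N.M.r_neg)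
  then have "\<phi> x = u \<odot>\<^bsub>T\<^esub> t" using \<phi>(2) uniq x(1) by metis
  then show ?thesis using \<phi>(1) D(2) by blast
qed

text \<open>Over a reduced ring, localizing at a minimal prime gives a field, so an element that survives
  the localization is detected by a functional. The functional takes values in the multiples of an
  element \<open>t\<close> that \<open>P\<close> annihilates, a copy of \<open>R/P\<close> inside \<open>R\<close>.\<close>

lemma (in reduced_noetherian_cring) functional_at_minimal_prime:
  fixes N :: "('a, 'n) module"
  assumes N: "module R N" and A: "finite A" "generating_set R N A" and P: "P \<in> minimal_primes R"
    and x: "x \<in> carrier N" "\<And>u. u \<in> carrier R - P \<Longrightarrow> u \<odot>\<^bsub>N\<^esub> x \<noteq> \<zero>\<^bsub>N\<^esub>"
  shows "\<exists>\<phi>\<in>Hom_module R N (ring_module R). \<phi> x \<in> carrier R - P"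
proof -
  interpret N: module R N by fact
  interpret P: primeideal P R by (rule minimal_primes_prime[OF P])
  have RM: "module R (ring_module R)" by (rule module_ring_module[OF is_cring])
  obtain t where t: "t \<in> carrier R" "t \<notin> P" "\<And>a. a \<in> P \<Longrightarrow> t \<otimes> a = \<zero>"
    using minimal_prime_annihilated[OF P] by blast
  have t': "a \<otimes> t = \<zero>" if "a \<in> P" for a
    using t(1) t(3)[OF that] m_comm[of a t] P.Icarr[OF that] by simp
  let ?D = "{n \<in> carrier N. t \<odot>\<^bsub>N\<^esub> n = \<zero>\<^bsub>N\<^esub>}"
  have "(\<lambda>n. n) \<in> Hom_module R N N" by (rule Hom_moduleI) auto
  then have D: "submodule ?D R N" by (intro submodule_Hom_kernel N Hom_module_smult t(1))
  have "\<exists>\<phi>\<in>Hom_module R N (ring_module R). \<exists>r\<in>carrier R - P. \<phi> x = r \<odot>\<^bsub>ring_module R\<^esub> t"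
  proof (rule functional_extension[OF N RM P.primeideal A D])
    show "a \<odot>\<^bsub>N\<^esub> n \<in> ?D" if "a \<in> P" "n \<in> carrier N" for a n
      using that t P.Icarr[OF that(1)] by (auto simp: N.smult_assoc1[symmetric])
    show "u \<odot>\<^bsub>N\<^esub> x \<notin> ?D" if u: "u \<in> carrier R - P" for u
    proof
      assume "u \<odot>\<^bsub>N\<^esub> x \<in> ?D"
      then have "(t \<otimes> u) \<odot>\<^bsub>N\<^esub> x = \<zero>\<^bsub>N\<^esub>" using u t x(1) by (auto simp: N.smult_assoc1)
      moreover have "t \<otimes> u \<in> carrier R - P" using u t P.I_prime by blast
      ultimately show False using x(2) by blast
    qed
  qed (simp_all add: x t t')
  then obtain \<phi> r where \<phi>: "\<phi> \<in> Hom_module R N (ring_module R)" "r \<in> carrier R - P" "\<phi> x = r \<otimes> t"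
    by auto
  have "\<phi> x \<in> carrier R - P" using \<phi> t P.I_prime by auto
  then show ?thesis using \<phi>(1) by blast
qed


section \<open>Generic freeness\<close>

text \<open>Here \<open>Q\<close> is the ring \<open>Q'\<close> viewed as an \<open>R\<close>-module, and \<open>N\<close> is the \<open>Q'\<close>-module \<open>N'\<close> viewed as an
  \<open>R\<close>-module. The cases that occur are \<open>\<^sup>e\<^sup>+\<^sup>1R\<close> over \<open>\<^sup>1R\<close>, an \<open>S\<close>-module over \<open>S\<close>, and \<open>\<^sup>1S\<close> over \<open>\<^sup>1R\<close>.\<close>

lemma generating_set_tower:
  assumes Q: "module R Q" and N: "module R N" and N': "module Q' N'"
    and A: "generating_set Q' N' A" and B: "generating_set R Q B"
    and eq: "carrier Q = carrier Q'" "add Q = add Q'" "ring.zero Q = ring.zero Q'"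
      "carrier N' = carrier N" "add N' = add N" "ring.zero N' = ring.zero N"
    and act: "\<And>r q n. r \<in> carrier R \<Longrightarrow> q \<in> carrier Q \<Longrightarrow> n \<in> carrier N \<Longrightarrow>
      r \<odot>\<^bsub>N\<^esub> (q \<odot>\<^bsub>N'\<^esub> n) = (r \<odot>\<^bsub>Q\<^esub> q) \<odot>\<^bsub>N'\<^esub> n"
  shows "generating_set R N ((\<lambda>(b, a). b \<odot>\<^bsub>N'\<^esub> a) ` (B \<times> A))"
  unfolding generating_set_def
proof (intro conjI allI impI)
  interpret Q: module R Q by fact
  interpret N: module R N by fact
  interpret N': module Q' N' by fact
  have AB: "A \<subseteq> carrier N" "B \<subseteq> carrier Q'" using A B eq by (auto simp: generating_set_def)
  show "(\<lambda>(b, a). b \<odot>\<^bsub>N'\<^esub> a) ` (B \<times> A) \<subseteq> carrier N"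
    using AB N'.smult_closed eq by auto
  fix H assume H: "submodule H R N" "(\<lambda>(b, a). b \<odot>\<^bsub>N'\<^esub> a) ` (B \<times> A) \<subseteq> H"
  note Hp = N.submodule_props[OF H(1)]
  have zeros: "q \<odot>\<^bsub>N'\<^esub> \<zero>\<^bsub>N\<^esub> = \<zero>\<^bsub>N\<^esub>" if "q \<in> carrier Q'" for q
    using N'.smult_r_null[OF that] unfolding eq .
  let ?G = "{n \<in> carrier N. \<forall>q\<in>carrier Q'. q \<odot>\<^bsub>N'\<^esub> n \<in> H}"
  have "submodule ?G Q' N'"
  proof (rule N'.submodule_criterion)
    show "\<zero>\<^bsub>N'\<^esub> \<in> ?G" unfolding eq using Hp(2) zeros by auto
  next
    fix n n' assume "n \<in> ?G" "n' \<in> ?G"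
    then show "n \<oplus>\<^bsub>N'\<^esub> n' \<in> ?G"
      using Hp(3) N'.smult_r_distr[unfolded eq(4,5)] unfolding eq by auto
  next
    fix q n assume qn: "q \<in> carrier Q'" "n \<in> ?G"
    have "q' \<odot>\<^bsub>N'\<^esub> (q \<odot>\<^bsub>N'\<^esub> n) \<in> H" if "q' \<in> carrier Q'" for q'
    proof -
      have "(q' \<otimes>\<^bsub>Q'\<^esub> q) \<odot>\<^bsub>N'\<^esub> n \<in> H" using qn N'.R.m_closed[OF that qn(1)] by blast
      then show ?thesis using N'.smult_assoc1[OF that qn(1), of n] qn(2) eq(4) by simp
    qed
    then show "q \<odot>\<^bsub>N'\<^esub> n \<in> ?G" using qn N'.smult_closed[of q n] eq(4) by auto
  qed (simp add: eq)
  moreover have "a \<in> ?G" if a: "a \<in> A" for a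
  proof -
    have ac: "a \<in> carrier N" using a AB by auto
    have "submodule {q \<in> carrier Q. q \<odot>\<^bsub>N'\<^esub> a \<in> H} R Q"
    proof (rule Q.submodule_criterion)
      show "\<zero>\<^bsub>Q\<^esub> \<in> {q \<in> carrier Q. q \<odot>\<^bsub>N'\<^esub> a \<in> H}"
        using N'.smult_l_null[of a] ac Hp(2) eq by simp
    next
      fix q q' assume "q \<in> {q \<in> carrier Q. q \<odot>\<^bsub>N'\<^esub> a \<in> H}" "q' \<in> {q \<in> carrier Q. q \<odot>\<^bsub>N'\<^esub> a \<in> H}"
      then show "q \<oplus>\<^bsub>Q\<^esub> q' \<in> {q \<in> carrier Q. q \<odot>\<^bsub>N'\<^esub> a \<in> H}"
        using N'.smult_l_distr[of q q' a] ac Hp(3) eq by simp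
    next
      fix r q assume "r \<in> carrier R" "q \<in> {q \<in> carrier Q. q \<odot>\<^bsub>N'\<^esub> a \<in> H}"
      then show "r \<odot>\<^bsub>Q\<^esub> q \<in> {q \<in> carrier Q. q \<odot>\<^bsub>N'\<^esub> a \<in> H}"
        using act[of r q a, symmetric] ac Hp(5) by simp
    qed auto
    moreover have "B \<subseteq> {q \<in> carrier Q. q \<odot>\<^bsub>N'\<^esub> a \<in> H}" using AB a H(2) eq by auto
    ultimately have "carrier Q \<subseteq> {q \<in> carrier Q. q \<odot>\<^bsub>N'\<^esub> a \<in> H}"
      using generating_setD[OF B] by blast
    then show ?thesis using ac eq(1) by auto
  qed
  ultimately have "carrier N' \<subseteq> ?G" using generating_setD[OF A] by blast
  show "carrier N \<subseteq> H"
  proof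
    fix n assume "n \<in> carrier N"
    then have n: "n \<in> carrier N'" using eq by simp
    then have "\<one>\<^bsub>Q'\<^esub> \<odot>\<^bsub>N'\<^esub> n \<in> H" using \<open>carrier N' \<subseteq> ?G\<close> N'.R.one_closed by blast
    then show "n \<in> H" using n by simp
  qed
qed

text \<open>The values at \<open>y\<close> of the endomorphisms of \<open>N\<close> that factor through a free module of finite rank.\<close>

definition trace_span :: "'a ring \<Rightarrow> ('a, 'm) module \<Rightarrow> 'm \<Rightarrow> 'm set" where
  "trace_span R N y = {z \<in> carrier N. \<forall>H. submodule H R N \<longrightarrow>
     (\<forall>\<phi>\<in>Hom_module R N (ring_module R). \<forall>x\<in>carrier N. \<phi> y \<odot>\<^bsub>N\<^esub> x \<in> H) \<longrightarrow> z \<in> H}"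

lemma trace_spanD:
  assumes "z \<in> trace_span R N y" "submodule H R N"
    "\<And>\<phi> x. \<phi> \<in> Hom_module R N (ring_module R) \<Longrightarrow> x \<in> carrier N \<Longrightarrow> \<phi> y \<odot>\<^bsub>N\<^esub> x \<in> H"
  shows "z \<in> H"
  using assms unfolding trace_span_def by blast

lemma
  assumes N: "module R N" and y: "y \<in> carrier N"
  shows submodule_trace_span: "submodule (trace_span R N y) R N"
    and trace_span_mem: "\<And>\<phi> x. \<phi> \<in> Hom_module R N (ring_module R) \<Longrightarrow> x \<in> carrier N \<Longrightarrow>
      \<phi> y \<odot>\<^bsub>N\<^esub> x \<in> trace_span R N y"
proof -
  interpret N: module R N by fact
  show "submodule (trace_span R N y) R N"
  proof (rule N.submodule_criterion)
    show "\<zero>\<^bsub>N\<^esub> \<in> trace_span R N y" unfolding trace_span_def using N.submodule_props(2) by blast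
    show "a \<oplus>\<^bsub>N\<^esub> b \<in> trace_span R N y" if "a \<in> trace_span R N y" "b \<in> trace_span R N y" for a b
      using that unfolding trace_span_def using N.submodule_props(3) by auto
    show "r \<odot>\<^bsub>N\<^esub> b \<in> trace_span R N y" if "r \<in> carrier R" "b \<in> trace_span R N y" for r b
      using that unfolding trace_span_def using N.submodule_props(5) by auto
  qed (auto simp: trace_span_def)
  show "\<phi> y \<odot>\<^bsub>N\<^esub> x \<in> trace_span R N y" if "\<phi> \<in> Hom_module R N (ring_module R)" "x \<in> carrier N" for \<phi> x
    using that Hom_moduleD(1)[OF that(1) y] unfolding trace_span_def by auto
qed

context reduced_noetherian_cring
begin

text \<open>At \<open>P\<close> the module becomes a finite-dimensional vector space over a field, whose identity map has finite
  rank. The induction builds \<open>\<theta>\<close> of finite rank that agrees with multiplication by some \<open>b \<notin> P\<close> on more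
  and more generators. The defect \<open>\<delta> = b - \<theta>\<close> vanishes on the generators treated so far. If no element
  outside \<open>P\<close> kills its value at the next one, \<open>a\<close>, then \<open>\<theta>\<close> is corrected to \<open>\<phi>(\<delta> a) \<theta> + \<phi>(\<delta> _) \<delta> a\<close>,
  with a functional \<open>\<phi>\<close> such that \<open>\<phi>(\<delta> a) \<notin> P\<close>.\<close>

lemma generic_trace_at_minimal_prime:
  fixes N :: "('a, 'n) module"
  assumes N: "module R N" and A: "finite A" "generating_set R N A" and P: "P \<in> minimal_primes R"
  shows "\<exists>b\<in>carrier R - P. \<forall>y\<in>carrier N. b \<odot>\<^bsub>N\<^esub> y \<in> trace_span R N y"
proof -
  interpret N: module R N by fact
  interpret P: primeideal P R by (rule minimal_primes_prime[OF P])
  have one: "\<one> \<in> carrier R - P" using P.one_imp_carrier P.I_notcarr by auto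
  note ts = N.submodule_props[OF submodule_trace_span[OF N]]
  have RM: "module R (ring_module R)" by (rule module_ring_module[OF is_cring])
  have "\<exists>b\<in>carrier R - P. \<exists>\<theta>\<in>Hom_module R N N. (\<forall>y\<in>carrier N. \<theta> y \<in> trace_span R N y) \<and>
      (\<forall>a\<in>C. \<theta> a = b \<odot>\<^bsub>N\<^esub> a)" if "finite C" "C \<subseteq> carrier N" for C
    using that
  proof (induction C)
    case empty
    show ?case
      by (rule bexI[OF _ one], rule bexI[OF _ Hom_module_const_zero[OF N]]) (simp add: ts(2))
  next
    case (insert a C)
    then obtain b \<theta> where b: "b \<in> carrier R - P" and \<theta>: "\<theta> \<in> Hom_module R N N"
      "\<And>y. y \<in> carrier N \<Longrightarrow> \<theta> y \<in> trace_span R N y" "\<And>a. a\<in>C \<Longrightarrow> \<theta> a = b \<odot>\<^bsub>N\<^esub> a" by auto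
    have bc: "b \<in> carrier R" using b by blast
    have ac: "a \<in> carrier N" "\<And>c. c \<in> C \<Longrightarrow> c \<in> carrier N" using insert by auto
    note \<theta>h = Hom_moduleD[OF \<theta>(1)]
    \<comment> \<open>The sum with \<open>(\<ominus> \<one>)\<close> makes \<open>\<delta>\<close> visibly a homomorphism.\<close>
    define \<delta> where "\<delta> y = b \<odot>\<^bsub>N\<^esub> y \<oplus>\<^bsub>N\<^esub> (\<ominus> \<one>) \<odot>\<^bsub>N\<^esub> \<theta> y" for y
    have \<delta>: "\<delta> \<in> Hom_module R N N"
    proof -
      have "(\<lambda>y. y) \<in> Hom_module R N N" by (rule Hom_moduleI) auto
      from Hom_module_add[OF N Hom_module_smult[OF N this bc] Hom_module_smult[OF N \<theta>(1), of "\<ominus> \<one>"]]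
      show ?thesis unfolding \<delta>_def by simp
    qed
    have \<delta>_eq: "\<delta> y = b \<odot>\<^bsub>N\<^esub> y \<ominus>\<^bsub>N\<^esub> \<theta> y" if "y \<in> carrier N" for y
      using that bc \<theta>h(1)[OF that] by (simp add: \<delta>_def a_minus_def N.smult_l_minus)
    note \<delta>h = Hom_moduleD[OF \<delta>]
    have \<delta>a: "\<delta> a \<in> carrier N" using \<delta>h(1) ac(1) .
    have \<delta>0: "\<delta> c = \<zero>\<^bsub>N\<^esub>" if "c \<in> C" for c
      using \<delta>_eq[OF ac(2)[OF that]] \<theta>(3)[OF that] bc ac(2)[OF that] by (simp add: a_minus_def N.M.r_neg)
    show ?case
    proof (cases "\<exists>u\<in>carrier R - P. u \<odot>\<^bsub>N\<^esub> \<delta> a = \<zero>\<^bsub>N\<^esub>")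
      case True
      then obtain u where u: "u \<in> carrier R - P" "u \<odot>\<^bsub>N\<^esub> \<delta> a = \<zero>\<^bsub>N\<^esub>" by blast
      have uc: "u \<in> carrier R" using u by blast
      have "u \<odot>\<^bsub>N\<^esub> \<theta> c = (u \<otimes> b) \<odot>\<^bsub>N\<^esub> c" if c: "c \<in> insert a C" for c
      proof -
        have cc: "c \<in> carrier N" using c ac by blast
        have "u \<odot>\<^bsub>N\<^esub> \<delta> c = \<zero>\<^bsub>N\<^esub>" using c u(2) \<delta>0 uc by (cases "c = a") auto
        then have "u \<odot>\<^bsub>N\<^esub> (b \<odot>\<^bsub>N\<^esub> c) \<ominus>\<^bsub>N\<^esub> u \<odot>\<^bsub>N\<^esub> \<theta> c = \<zero>\<^bsub>N\<^esub>"
          unfolding \<delta>_eq[OF cc] using uc bc cc \<theta>h(1)[OF cc]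
          by (simp add: a_minus_def N.smult_r_distr N.smult_r_minus)
        then show ?thesis using uc bc cc \<theta>h(1)[OF cc]
          by (metis N.M.minus_eq_zero_imp_eq N.smult_closed N.smult_assoc1)
      qed
      moreover have "u \<otimes> b \<in> carrier R - P" using u b P.I_prime by blast
      moreover have "u \<odot>\<^bsub>N\<^esub> \<theta> y \<in> trace_span R N y" if "y \<in> carrier N" for y
        using ts(5)[OF that uc \<theta>(2)[OF that]] .
      ultimately show ?thesis
        by (intro bexI[of _ "u \<otimes> b"] bexI[OF _ Hom_module_smult[OF N \<theta>(1) uc]]) auto
    next
      case False
      then obtain \<phi> where \<phi>: "\<phi> \<in> Hom_module R N (ring_module R)" and s: "\<phi> (\<delta> a) \<in> carrier R - P"
        using functional_at_minimal_prime[OF N A P \<delta>a] by blast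
      note \<phi>h = Hom_moduleD[OF \<phi>, simplified]
      from s have sc: "\<phi> (\<delta> a) \<in> carrier R" by blast
      define \<theta>' where "\<theta>' y = \<phi> (\<delta> a) \<odot>\<^bsub>N\<^esub> \<theta> y \<oplus>\<^bsub>N\<^esub> \<phi> (\<delta> y) \<odot>\<^bsub>N\<^esub> \<delta> a" for y
      have "(\<lambda>y. \<phi> (\<delta> y) \<odot>\<^bsub>N\<^esub> \<delta> a) \<in> Hom_module R N N"
        by (rule Hom_moduleI) (simp_all add: \<phi>h \<delta>h \<delta>a N.smult_l_distr N.smult_assoc1)
      from Hom_module_add[OF N Hom_module_smult[OF N \<theta>(1) sc] this]
      have 1: "\<theta>' \<in> Hom_module R N N" unfolding \<theta>'_def by simp
      have \<psi>: "(\<lambda>y. \<phi> (\<delta> y)) \<in> Hom_module R N (ring_module R)"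
        by (rule Hom_moduleI) (simp_all add: \<phi>h \<delta>h)
      have 2: "\<theta>' y \<in> trace_span R N y" if y: "y \<in> carrier N" for y
        unfolding \<theta>'_def
        by (rule ts(3)[OF y ts(5)[OF y sc \<theta>(2)[OF y]] trace_span_mem[OF N y \<psi> \<delta>a]])
      have 3: "\<theta>' c = (\<phi> (\<delta> a) \<otimes> b) \<odot>\<^bsub>N\<^esub> c" if c: "c \<in> insert a C" for c
      proof (cases "c = a")
        case True
        have "\<theta>' a = \<phi> (\<delta> a) \<odot>\<^bsub>N\<^esub> (\<theta> a \<oplus>\<^bsub>N\<^esub> \<delta> a)"
          unfolding \<theta>'_def using sc \<delta>a \<theta>h(1)[OF ac(1)] by (simp add: N.smult_r_distr)
        also have "\<theta> a \<oplus>\<^bsub>N\<^esub> \<delta> a = b \<odot>\<^bsub>N\<^esub> a"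
          unfolding \<delta>_eq[OF ac(1)] using bc ac(1) \<theta>h(1)[OF ac(1)]
          by (simp add: a_minus_def N.M.a_lcomm[of "\<theta> a" "b \<odot>\<^bsub>N\<^esub> a"] N.M.r_neg)
        finally show ?thesis using True sc bc ac by (simp add: N.smult_assoc1)
      next
        case False
        then have c: "c \<in> C" using c by blast
        have "\<phi> \<zero>\<^bsub>N\<^esub> = \<zero>" using Hom_module_zero[OF N RM \<phi>] by simp
        then show ?thesis
          unfolding \<theta>'_def \<delta>0[OF c] \<theta>(3)[OF c] using sc bc ac(2)[OF c] \<delta>a by (simp add: N.smult_assoc1)
      qed
      have "\<phi> (\<delta> a) \<otimes> b \<in> carrier R - P" using s b P.I_prime by blast
      then show ?thesis
        by (intro bexI[of _ "\<phi> (\<delta> a) \<otimes> b"] bexI[OF _ 1]) (use 2 3 in auto)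
    qed
  qed
  from this[of A] A obtain b \<theta> where b: "b \<in> carrier R - P" and \<theta>: "\<theta> \<in> Hom_module R N N"
    "\<And>y. y \<in> carrier N \<Longrightarrow> \<theta> y \<in> trace_span R N y" "\<And>a. a\<in>A \<Longrightarrow> \<theta> a = b \<odot>\<^bsub>N\<^esub> a"
    unfolding generating_set_def by auto
  note \<theta>h = Hom_moduleD[OF \<theta>(1)]
  have bc: "b \<in> carrier R" using b by blast
  have "submodule {y \<in> carrier N. \<theta> y = b \<odot>\<^bsub>N\<^esub> y} R N"
    by (rule N.submodule_criterion)
      (use bc in \<open>auto simp: \<theta>h Hom_module_zero[OF N N \<theta>(1)] N.smult_r_distr N.smult_assoc1[symmetric] m_comm\<close>)
  moreover have "A \<subseteq> {y \<in> carrier N. \<theta> y = b \<odot>\<^bsub>N\<^esub> y}"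
    using A(2) \<theta>(3) by (auto simp: generating_set_def)
  ultimately have "\<theta> y = b \<odot>\<^bsub>N\<^esub> y" if "y \<in> carrier N" for y
    using generating_setD[OF A(2) _ _ that] by blast
  then have "b \<odot>\<^bsub>N\<^esub> y \<in> trace_span R N y" if "y \<in> carrier N" for y
    using \<theta>(2)[OF that] that by metis
  then show ?thesis using b by blast
qed

lemma generic_trace:
  fixes N :: "('a, 'n) module"
  assumes N: "module R N" and A: "finite A" "generating_set R N A"
  shows "\<exists>b\<in>off_minimal_primes R. \<forall>y\<in>carrier N. b \<odot>\<^bsub>N\<^esub> y \<in> trace_span R N y"
proof -
  interpret N: module R N by fact
  note ts = N.submodule_props[OF submodule_trace_span[OF N]]
  let ?B = "{b \<in> carrier R. \<forall>y\<in>carrier N. b \<odot>\<^bsub>N\<^esub> y \<in> trace_span R N y}"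
  have "ideal ?B R"
    by (rule ideal_criterion) (auto simp: N.smult_l_distr N.smult_assoc1 ts)
  moreover have "\<not> ?B \<subseteq> P" if "P \<in> minimal_primes R" for P
    using generic_trace_at_minimal_prime[OF N A that] by blast
  ultimately show ?thesis using ideal_meets_off_minimal_primes[of ?B] by blast
qed

end


section \<open>Tight interiors\<close>

context char_p_cring
begin

abbreviation Fr where "Fr e \<equiv> frob_module p e R (ring_module R)"

lemma module_ring [simp]: "module R (ring_module R)"
  by (rule module_ring_module[OF is_cring])

lemma module_Fr [simp]: "module R (Fr e)"
  by (rule module_frob_module) simp

lemma finitely_generated_Fr:
  assumes "F_finite p R"
  shows "\<exists>A. finite A \<and> generating_set R (Fr e) A"
proof (induction e)
  case 0
  have "r \<in> H" if H: "submodule H R (Fr 0)" "{\<one>} \<subseteq> H" and r: "r \<in> carrier R" for H r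
  proof -
    interpret module R "Fr 0" by simp
    show ?thesis using submodule_props(5)[OF H(1) r, of \<one>] H(2) r by simp
  qed
  then have "generating_set R (Fr 0) {\<one>}" by (auto simp: generating_set_def)
  then show ?case by blast
next
  case (Suc e)
  then obtain A where A: "finite A" "generating_set R (Fr e) A" by blast
  obtain B where B: "finite B" "generating_set R (Fr 1) B"
    using assms by (auto simp: F_finite_def fg_module_iff)
  have "generating_set R (Fr (Suc e)) ((\<lambda>(b, a). b \<odot>\<^bsub>Fr e\<^esub> a) ` (B \<times> A))"
  proof (rule generating_set_tower[OF _ _ _ A(2) B(2)])
    fix r q n assume "r \<in> carrier R" "q \<in> carrier (Fr 1)" "n \<in> carrier (Fr (Suc e))"
    then show "r \<odot>\<^bsub>Fr (Suc e)\<^esub> (q \<odot>\<^bsub>Fr e\<^esub> n) = (r \<odot>\<^bsub>Fr 1\<^esub> q) \<odot>\<^bsub>Fr e\<^esub> n"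
      by (simp add: nat_pow_distrib nat_pow_pow m_assoc)
  qed simp_all
  moreover have "finite ((\<lambda>(b, a). b \<odot>\<^bsub>Fr e\<^esub> a) ` (B \<times> A))" using A(1) B(1) by simp
  ultimately show ?case by (intro exI conjI)
qed

lemma ideal_imp_submodule_Fr:
  assumes "ideal I R" shows "submodule I R (Fr e)"
proof -
  interpret I: ideal I R by fact
  interpret module R "Fr e" by simp
  show ?thesis by (rule submodule_criterion) (auto simp: I.I_l_closed intro: I.Icarr)
qed

lemma submodule_tight_interior_at:
  fixes M :: "('a, 'm) module"
  assumes M: "module R M" and c: "c \<in> carrier R"
  shows "submodule (tight_interior_at p R M c e0) R M"
  unfolding tight_interior_at_def
  by (rule submodule_submodule_sum[OF M submodule_Hom_values[OF M]]) (simp add: c)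

lemma tight_interior_atI:
  fixes M :: "('a, 'm) module"
  assumes M: "module R M" and c: "c \<in> carrier R" and g: "g \<in> Hom_module R (Fr e) M" and e: "e0 \<le> e"
  shows "g c \<in> tight_interior_at p R M c e0"
  unfolding tight_interior_at_def
  by (rule submodule_sum_upper[OF M, of e]) (use g e c Hom_moduleD(1)[OF g] in auto)

lemma tight_interior_at_least:
  fixes M :: "('a, 'm) module"
  assumes M: "module R M" and H: "H \<subseteq> carrier M" "\<zero>\<^bsub>M\<^esub> \<in> H"
      "\<And>a b. a \<in> H \<Longrightarrow> b \<in> H \<Longrightarrow> a \<oplus>\<^bsub>M\<^esub> b \<in> H"
    and g: "\<And>e g. e0 \<le> e \<Longrightarrow> g \<in> Hom_module R (Fr e) M \<Longrightarrow> g c \<in> H"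
  shows "tight_interior_at p R M c e0 \<subseteq> H"
  unfolding tight_interior_at_def
  by (rule submodule_sum_least[OF M H]) (use g in auto)

lemma submodule_tight_interior:
  fixes M :: "('a, 'm) module"
  assumes M: "module R M"
  shows "submodule (tight_interior p R M) R M"
proof -
  interpret M: module R M by fact
  have s: "submodule (tight_interior_at p R M c e0) R M" if "c \<in> off_minimal_primes R" for c e0
    using submodule_tight_interior_at[OF M] off_minimal_primes_carrier[OF that] .
  note sp = M.submodule_props[OF s]
  show ?thesis
  proof (rule M.submodule_criterion)
    show "tight_interior p R M \<subseteq> carrier M"
      unfolding tight_interior_def using sp(1)[OF one_off_minimal_primes] one_off_minimal_primes by blast
  qed (auto simp: tight_interior_def sp)
qed

lemma tight_interior_carrier:
  fixes M :: "('a, 'm) module"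
  assumes M: "module R M" and "x \<in> tight_interior p R M"
  shows "x \<in> carrier M"
proof -
  interpret M: module R M by fact
  show ?thesis using M.submodule_props(1)[OF submodule_tight_interior[OF M]] assms(2) by blast
qed

lemma tight_interior_at_Hom:
  fixes M :: "('a, 'm) module" and N :: "('a, 'n) module"
  assumes M: "module R M" and N: "module R N" and c: "c \<in> carrier R"
    and \<phi>: "\<phi> \<in> Hom_module R (frob_module p a R M) N"
    and x: "x \<in> tight_interior_at p R M c e0"
  shows "\<phi> x \<in> tight_interior_at p R N c e0"
proof -
  interpret N: module R N by fact
  interpret M: module R M by fact
  note tN = N.submodule_props[OF submodule_tight_interior_at[OF N c]]
  note \<phi>h = Hom_moduleD[OF \<phi>, simplified]
  let ?H = "{x \<in> carrier M. \<phi> x \<in> tight_interior_at p R N c e0}"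
  have "tight_interior_at p R M c e0 \<subseteq> ?H"
  proof (rule tight_interior_at_least[OF M])
    have "\<phi> \<zero>\<^bsub>M\<^esub> = \<zero>\<^bsub>N\<^esub>"
      using Hom_module_zero[OF module_frob_module[OF M] N \<phi>] by simp
    then show "\<zero>\<^bsub>M\<^esub> \<in> ?H" by (simp add: tN(2))
  next
    fix e g assume e: "e0 \<le> e" and g: "g \<in> Hom_module R (Fr e) M"
    have "(\<lambda>x. \<phi> (g x)) \<in> Hom_module R (Fr (e + a)) N"
      by (rule Hom_frob_comp[OF is_cring g \<phi>])
    from tight_interior_atI[OF N c this, of e0] e show "g c \<in> ?H"
      using Hom_moduleD(1)[OF g, of c] c by simp
  qed (auto simp: \<phi>h tN)
  then show ?thesis using x by blast
qed

lemma tight_interior_Hom: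
  fixes M :: "('a, 'm) module" and N :: "('a, 'n) module"
  assumes "module R M" "module R N" "\<phi> \<in> Hom_module R (frob_module p a R M) N"
    "x \<in> tight_interior p R M"
  shows "\<phi> x \<in> tight_interior p R N"
  using assms tight_interior_at_Hom[OF assms(1,2) off_minimal_primes_carrier assms(3)]
  unfolding tight_interior_def by blast

end

section \<open>Test elements\<close>

locale F_finite_reduced_ring = char_p_cring + reduced_noetherian_cring +
  assumes F_finite: "F_finite p R"
begin

lemma Frobenius_trace_element:
  "\<exists>b\<in>off_minimal_primes R. \<forall>y\<in>carrier R. b [^] p \<otimes> y \<in> trace_span R (Fr 1) y"
proof -
  from finitely_generated_Fr[OF F_finite, of 1]
  obtain A where A: "finite A" "generating_set R (Fr 1) A" by (elim exE conjE)
  obtain b where "b \<in> off_minimal_primes R" "\<forall>y\<in>carrier (Fr 1). b \<odot>\<^bsub>Fr 1\<^esub> y \<in> trace_span R (Fr 1) y"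
    using generic_trace[OF module_Fr A] by (elim bexE)
  then show ?thesis by (intro bexI[of _ b]) simp_all
qed

text \<open>For \<open>y = g d\<close>, the element \<open>b\<^sup>py\<close> is a combination of \<open>p\<close>-th powers of values \<open>\<phi>(y)\<close>, so it lies in the
  ideal of all values \<open>\<phi>(y)\<close>; in other words it is such a value.\<close>

lemma Hom_value_off_minimal_primes:
  assumes d: "d \<in> off_minimal_primes R"
  shows "\<exists>g\<in>Hom_module R (Fr e) (ring_module R). g d \<in> off_minimal_primes R"
proof (induction e)
  case 0
  have "(\<lambda>x. x) \<in> Hom_module R (Fr 0) (ring_module R)" by (rule Hom_moduleI) simp_all
  then show ?case using d by (intro bexI[of _ "\<lambda>x. x"])
next
  case (Suc e)
  then obtain g where g: "g \<in> Hom_module R (Fr e) (ring_module R)" "g d \<in> off_minimal_primes R" by blast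
  have gd: "g d \<in> carrier R" using off_minimal_primes_carrier[OF g(2)] .
  obtain b where b: "b \<in> off_minimal_primes R" "\<forall>y\<in>carrier R. b [^] p \<otimes> y \<in> trace_span R (Fr 1) y"
    using Frobenius_trace_element by blast
  let ?K = "(\<lambda>f. f (g d)) ` Hom_module R (Fr 1) (ring_module R)"
  have "submodule ?K R (ring_module R)" by (rule submodule_Hom_values) (simp_all add: gd)
  then have K: "ideal ?K R" using submodule_ring_module_iff[OF is_cring] by blast
  then interpret K: ideal ?K R .
  have "b [^] p \<otimes> g d \<in> ?K"
  proof (rule trace_spanD[OF b(2)[rule_format, OF gd] ideal_imp_submodule_Fr[OF K]])
    fix \<phi> x assume \<phi>: "\<phi> \<in> Hom_module R (Fr 1) (ring_module R)" and "x \<in> carrier (Fr 1)"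
    then have x: "x \<in> carrier R" and k: "\<phi> (g d) \<in> ?K" by auto
    obtain q where q: "p = Suc q" using p_gt_1 by (cases p) auto
    have kc: "\<phi> (g d) \<in> carrier R" using K.Icarr[OF k] .
    have "\<phi> (g d) [^] p \<otimes> x = (\<phi> (g d) [^] q \<otimes> x) \<otimes> \<phi> (g d)"
      unfolding q using kc x by (simp add: m_ac)
    then show "\<phi> (g d) \<odot>\<^bsub>Fr 1\<^esub> x \<in> ?K"
      using K.I_l_closed[OF k, of "\<phi> (g d) [^] q \<otimes> x"] kc x by simp
  qed
  then obtain f where f: "f \<in> Hom_module R (Fr 1) (ring_module R)" "f (g d) = b [^] p \<otimes> g d" by auto
  have "(\<lambda>x. f (g x)) \<in> Hom_module R (Fr (e + 1)) (ring_module R)"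
    by (rule Hom_frob_comp[OF is_cring g(1) f(1)])
  moreover have "b [^] p \<otimes> g d \<in> off_minimal_primes R"
    using off_minimal_primes_mult off_minimal_primes_pow b(1) g(2) by blast
  ultimately show ?case using f(2) by (intro bexI[of _ "\<lambda>x. f (g x)"]) simp_all
qed

text \<open>Let \<open>J\<close> be the ideal \<open>R\<^sub>*[d, e]\<close>. It meets \<open>R\<degree>\<close> and is stable under every linear \<open>\<phi> : \<^sup>1R \<rightarrow> R\<close>. For \<open>y \<in> J\<close>
  the element \<open>b\<^sup>py\<close> is a combination of powers \<open>\<phi>(y)\<^sup>p\<close>, and \<open>\<phi>(y) \<in> J\<close>, so \<open>b\<^sup>pJ \<subseteq> J\<^sup>2\<close>. By Nakayama's
  lemma an element congruent modulo \<open>J\<close> to a power of \<open>b\<close> kills \<open>J\<close>; it is zero as \<open>J\<close> contains a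
  nonzerodivisor, so a power of \<open>b\<close> lies in \<open>J\<close>. Its exponent depends on \<open>d\<close> and \<open>e\<close>, but can be lowered:
  if \<open>b\<^sup>m\<^sup>p \<in> J\<close>, then \<open>b\<^sup>m\<phi>(1) = \<phi>(b\<^sup>m\<^sup>p) \<in> J\<close> for all \<open>\<phi>\<close>, and therefore \<open>b\<^sup>m\<^sup>+\<^sup>p \<in> J\<close>. With
  \<open>m = \<lfloor>n/p\<rfloor> + 1\<close> this leads from an exponent \<open>n > 3p\<close> to a smaller one.\<close>

lemma ring_test_element:
  "\<exists>c\<in>off_minimal_primes R. \<forall>d\<in>off_minimal_primes R. \<forall>e. c \<in> tight_interior_at p R (ring_module R) d e"
proof -
  obtain b where b: "b \<in> off_minimal_primes R"
    and b_trace: "\<And>y. y\<in>carrier R \<Longrightarrow> b [^] p \<otimes> y \<in> trace_span R (Fr 1) y"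
    using Frobenius_trace_element by blast
  have bc: "b \<in> carrier R" using off_minimal_primes_carrier[OF b] .
  have "b [^] (3 * p) \<in> tight_interior_at p R (ring_module R) d e" if d: "d \<in> off_minimal_primes R" for d e
  proof -
    define J where "J = tight_interior_at p R (ring_module R) d e"
    have dc: "d \<in> carrier R" using off_minimal_primes_carrier[OF d] .
    have J: "ideal J R"
      using submodule_tight_interior_at[OF module_ring dc] submodule_ring_module_iff[OF is_cring]
      unfolding J_def by blast
    interpret J: ideal J R by (rule J)
    have \<phi>J: "\<phi> y \<in> J" if "\<phi> \<in> Hom_module R (Fr 1) (ring_module R)" "y \<in> J" for \<phi> y
      using tight_interior_at_Hom[OF module_ring module_ring dc that(1)] that(2) unfolding J_def .
    obtain g where g: "g \<in> Hom_module R (Fr e) (ring_module R)" "g d \<in> off_minimal_primes R"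
      using Hom_value_off_minimal_primes[OF d] by blast
    have gJ: "g d \<in> J" unfolding J_def by (rule tight_interior_atI[OF module_ring dc g(1)]) simp
    let ?JJ = "{i \<otimes> n | i n. i \<in> J \<and> n \<in> J}"
    have JJc: "?JJ \<subseteq> carrier R" using J.Icarr by auto
    interpret JJ: ideal "Idl ?JJ" R by (rule genideal_ideal[OF JJc])
    obtain q where q: "p = Suc (Suc q)" using p_gt_1 by (metis less_iff_Suc_add add_Suc plus_1_eq_Suc)
    have "b [^] p \<otimes> y \<in> Idl ?JJ" if y: "y \<in> J" for y
    proof (rule trace_spanD[OF b_trace[OF J.Icarr[OF y]] ideal_imp_submodule_Fr[OF JJ.ideal_axioms]])
      fix \<phi> x assume \<phi>: "\<phi> \<in> Hom_module R (Fr 1) (ring_module R)" and "x \<in> carrier (Fr 1)"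
      then have x: "x \<in> carrier R" and k: "\<phi> y \<in> J" using \<phi>J y by auto
      have kc: "\<phi> y \<in> carrier R" using J.Icarr[OF k] .
      have "\<phi> y [^] p \<otimes> x = (\<phi> y [^] q \<otimes> x) \<otimes> (\<phi> y \<otimes> \<phi> y)"
        unfolding q using kc x by (simp add: m_ac)
      moreover have "\<phi> y \<otimes> \<phi> y \<in> Idl ?JJ" using genideal_self[OF JJc] k by blast
      ultimately show "\<phi> y \<odot>\<^bsub>Fr 1\<^esub> x \<in> Idl ?JJ"
        using JJ.I_l_closed[of "\<phi> y \<otimes> \<phi> y" "\<phi> y [^] q \<otimes> x"] kc x by simp
    qed
    note JJ = this
    define \<beta> where "\<beta> = b [^] p"
    have \<beta>c: "\<beta> \<in> carrier R" using bc by (simp add: \<beta>_def)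
    define W where "W = {w \<in> carrier R. \<exists>k::nat. w \<ominus> \<beta> [^] k \<in> J}"
    have "\<exists>w\<in>W. \<forall>y\<in>J. w \<otimes> y = \<zero>"
    proof (rule nakayama[OF J J])
      show "W \<subseteq> carrier R" by (auto simp: W_def)
      show "\<beta> \<in> W" using \<beta>c J.zero_closed by (auto simp: W_def r_neg a_minus_def intro!: exI[of _ "1::nat"])
      show "\<beta> \<otimes> y \<in> Idl ?JJ" if "y \<in> J" for y using JJ[OF that] by (simp add: \<beta>_def)
    next
      fix v w assume "v \<in> W" "w \<in> W"
      then obtain k l :: nat where kl: "v \<in> carrier R" "w \<in> carrier R" "v \<ominus> \<beta> [^] k \<in> J" "w \<ominus> \<beta> [^] l \<in> J"
        by (auto simp: W_def)
      have "v \<otimes> w \<ominus> \<beta> [^] (k + l) = w \<otimes> (v \<ominus> \<beta> [^] k) \<oplus> \<beta> [^] k \<otimes> (w \<ominus> \<beta> [^] l)"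
      proof -
        define s t where "s = \<beta> [^] k" and "t = \<beta> [^] l"
        have st: "s \<in> carrier R" "t \<in> carrier R" using \<beta>c by (auto simp: s_def t_def)
        have "v \<otimes> w \<ominus> s \<otimes> t = w \<otimes> (v \<ominus> s) \<oplus> s \<otimes> (w \<ominus> t)"
          using st kl(1,2) by algebra
        then show ?thesis using \<beta>c by (simp add: s_def t_def nat_pow_mult)
      qed
      then have "v \<otimes> w \<ominus> \<beta> [^] (k + l) \<in> J"
        using kl \<beta>c J.I_l_closed J.a_closed by simp
      then show "v \<otimes> w \<in> W" using kl by (auto simp: W_def)
    next
      fix w a assume "w \<in> W" and a: "a \<in> J"
      then obtain k :: nat where k: "w \<in> carrier R" "w \<ominus> \<beta> [^] k \<in> J" by (auto simp: W_def)
      have ac: "a \<in> carrier R" using J.Icarr[OF a] .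
      have "w \<ominus> a \<ominus> \<beta> [^] k = (w \<ominus> \<beta> [^] k) \<ominus> a"
        using k(1) ac \<beta>c by (simp add: a_minus_def a_ac)
      then have "w \<ominus> a \<ominus> \<beta> [^] k \<in> J"
        using J.a_closed[OF k(2) J.a_inv_closed[OF a]] by (simp add: a_minus_def)
      then show "w \<ominus> a \<in> W" using k ac by (auto simp: W_def)
    qed
    then obtain w where w: "w \<in> W" "w \<otimes> g d = \<zero>" using gJ by blast
    have wc: "w \<in> carrier R" using w by (simp add: W_def)
    have "w = \<zero>"
      using off_minimal_primes_nonzerodivisor[OF g(2) wc] w(2) wc off_minimal_primes_carrier[OF g(2)]
      by (simp add: m_comm)
    then obtain k :: nat where "\<zero> \<ominus> \<beta> [^] k \<in> J" using w by (auto simp: W_def)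
    then have "\<beta> [^] k \<in> J" using J.a_inv_closed[of "\<zero> \<ominus> \<beta> [^] k"] \<beta>c by (simp add: a_minus_def)
    then have ex: "b [^] (p * k) \<in> J" using bc by (simp add: \<beta>_def nat_pow_pow)
    have mono: "b [^] n \<in> J" if "b [^] m \<in> J" "m \<le> n" for m n :: nat
    proof -
      have "b [^] n = b [^] (n - m) \<otimes> b [^] m" using bc that(2) by (simp add: nat_pow_mult)
      then show ?thesis using J.I_l_closed[OF that(1)] bc by simp
    qed
    have descent: "b [^] (m + p) \<in> J" if m: "b [^] (m * p) \<in> J" for m :: nat
    proof -
      have mc: "b [^] m \<in> carrier R" using bc by simp
      have mp: "b [^] (m * p) = (b [^] m) [^] p" using bc by (simp add: nat_pow_pow)
      have id: "ideal {z \<in> carrier R. \<forall>y\<in>{b [^] m}. z \<otimes> y \<in> J} R" by (rule colon_ideal[OF J]) (use bc in auto)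
      have "b [^] p \<otimes> \<one> \<in> {z \<in> carrier R. \<forall>y\<in>{b [^] m}. z \<otimes> y \<in> J}"
      proof (rule trace_spanD[OF b_trace[OF one_closed] ideal_imp_submodule_Fr[OF id]])
        fix \<phi> x assume \<phi>: "\<phi> \<in> Hom_module R (Fr 1) (ring_module R)" and "x \<in> carrier (Fr 1)"
        then have x: "x \<in> carrier R" by simp
        have 1: "\<phi> \<one> \<in> carrier R" using Hom_moduleD(1)[OF \<phi>] by simp
        have "\<phi> (b [^] m \<odot>\<^bsub>Fr 1\<^esub> \<one>) = b [^] m \<otimes> \<phi> \<one>"
          using Hom_moduleD(3)[OF \<phi> mc, of \<one>] by simp
        moreover have "b [^] m \<odot>\<^bsub>Fr 1\<^esub> \<one> \<in> J" using m mp mc by simp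
        ultimately have mem: "b [^] m \<otimes> \<phi> \<one> \<in> J" using \<phi>J[OF \<phi>] by metis
        have "\<phi> \<one> [^] p \<otimes> x \<otimes> b [^] m = (\<phi> \<one> [^] Suc q \<otimes> x) \<otimes> (b [^] m \<otimes> \<phi> \<one>)"
          unfolding q using 1 x mc by (simp add: m_ac)
        then have "\<phi> \<one> [^] p \<otimes> x \<otimes> b [^] m \<in> J"
          using J.I_l_closed[OF mem, of "\<phi> \<one> [^] Suc q \<otimes> x"] 1 x by simp
        then show "\<phi> \<one> \<odot>\<^bsub>Fr 1\<^esub> x \<in> {z \<in> carrier R. \<forall>y\<in>{b [^] m}. z \<otimes> y \<in> J}"
          using 1 x by simp
      qed
      then show ?thesis using bc by (simp add: nat_pow_mult add.commute)
    qed
    \<comment> \<open>The descent applies to every exponent above \<open>3p\<close>, so the least one is at most \<open>3p\<close>.\<close>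
    define n where "n = (LEAST n. b [^] (n::nat) \<in> J)"
    have n: "b [^] n \<in> J" unfolding n_def by (rule LeastI[of "\<lambda>n. b [^] (n::nat) \<in> J", OF ex])
    have "n \<le> 3 * p"
    proof (rule ccontr)
      assume "\<not> n \<le> 3 * p"
      then have n3: "3 * p < n" by simp
      define m where "m = n div p + 1"
      have "n \<le> m * p" using p_gt_1 unfolding m_def
        by (metis add.commute dividend_less_div_times less_imp_le_nat mult.commute mult_Suc plus_1_eq_Suc zero_less_one less_trans)
      then have "b [^] (m + p) \<in> J" using descent mono n by blast
      then have "n \<le> m + p" unfolding n_def by (rule Least_le)
      moreover have "n div p \<le> n div 2" using p_gt_1 by (intro div_le_mono2) auto
      ultimately have "n \<le> n div 2 + 1 + p" unfolding m_def by linarith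
      then show False using n3 p_gt_1 by linarith
    qed
    then show ?thesis using mono[OF n] unfolding J_def by blast
  qed
  then show ?thesis using off_minimal_primes_pow[OF b] by blast
qed

lemma test_element:
  "\<exists>c\<in>off_minimal_primes R. \<forall>M :: ('a, 'm) module. module R M \<longrightarrow>
     (\<forall>x\<in>carrier M. c \<odot>\<^bsub>M\<^esub> x \<in> tight_interior p R M)"
proof -
  obtain c where c: "c \<in> off_minimal_primes R"
    "\<And>d e. d\<in>off_minimal_primes R \<Longrightarrow> c \<in> tight_interior_at p R (ring_module R) d e"
    using ring_test_element by blast
  have "c \<odot>\<^bsub>M\<^esub> x \<in> tight_interior p R M" if M: "module R M" and x: "x \<in> carrier M" for M :: "('a, 'm) module" and x
  proof -
    interpret M: module R M by fact
    have h: "(\<lambda>r. r \<odot>\<^bsub>M\<^esub> x) \<in> Hom_module R (frob_module p 0 R (ring_module R)) M"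
      by (rule Hom_moduleI) (use x in \<open>simp_all add: M.smult_l_distr M.smult_assoc1\<close>)
    show ?thesis
      unfolding tight_interior_def
      using tight_interior_at_Hom[OF module_ring M off_minimal_primes_carrier h c(2)] by blast
  qed
  then show ?thesis using c(1) by blast
qed

end


section \<open>Krull's intersection theorem for Frobenius powers\<close>

text \<open>The contraction to \<open>R\<close> of the ideal generated by \<open>I\<close> in the local ring at \<open>P\<close>. Saturated ideals stand for
  the ideals of that ring.\<close>

definition prime_saturation :: "'a ring \<Rightarrow> 'a set \<Rightarrow> 'a set \<Rightarrow> 'a set" where
  "prime_saturation R P I = {x \<in> carrier R. \<exists>u\<in>carrier R - P. u \<otimes>\<^bsub>R\<^esub> x \<in> I}"

context noetherian_cring
begin

lemma prime_saturation_mono: "I \<subseteq> J \<Longrightarrow> prime_saturation R P I \<subseteq> prime_saturation R P J"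
  by (auto simp: prime_saturation_def)

context
  fixes P assumes P: "primeideal P R"
begin

lemma prime_complement_mult: "u \<in> carrier R - P \<Longrightarrow> v \<in> carrier R - P \<Longrightarrow> u \<otimes> v \<in> carrier R - P"
  using primeideal.I_prime[OF P, of u v] by auto

lemma prime_complement_one: "\<one> \<in> carrier R - P"
proof -
  interpret P: primeideal P R by (rule P)
  show ?thesis using P.one_imp_carrier P.I_notcarr by auto
qed

lemma subset_prime_saturation: "I \<subseteq> carrier R \<Longrightarrow> I \<subseteq> prime_saturation R P I"
  using prime_complement_one by (auto simp: prime_saturation_def intro!: bexI[of _ \<one>])

lemma ideal_prime_saturation:
  assumes "ideal I R" shows "ideal (prime_saturation R P I) R"
proof -
  interpret I: ideal I R by fact
  show ?thesis
  proof (rule ideal_criterion)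
    show "prime_saturation R P I \<subseteq> carrier R" by (auto simp: prime_saturation_def)
    show "\<zero> \<in> prime_saturation R P I"
      using subset_prime_saturation[OF I.a_subset] I.zero_closed by blast
  next
    fix a b assume "a \<in> prime_saturation R P I" "b \<in> prime_saturation R P I"
    then obtain u v where *: "a \<in> carrier R" "b \<in> carrier R" "u \<in> carrier R - P" "v \<in> carrier R - P"
      "u \<otimes> a \<in> I" "v \<otimes> b \<in> I" by (auto simp: prime_saturation_def)
    have c: "u \<in> carrier R" "v \<in> carrier R" using * by auto
    have "(u \<otimes> v) \<otimes> (a \<oplus> b) = v \<otimes> (u \<otimes> a) \<oplus> u \<otimes> (v \<otimes> b)"
      using *(1,2) c by (simp add: r_distr m_ac)
    then have "(u \<otimes> v) \<otimes> (a \<oplus> b) \<in> I" using *(5,6) c I.I_l_closed by simp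
    then show "a \<oplus> b \<in> prime_saturation R P I"
      using *(1,2) prime_complement_mult[OF *(3,4)] unfolding prime_saturation_def by auto
  next
    fix a x assume "a \<in> prime_saturation R P I" and x: "x \<in> carrier R"
    then obtain u where *: "a \<in> carrier R" "u \<in> carrier R - P" "u \<otimes> a \<in> I" by (auto simp: prime_saturation_def)
    have "u \<otimes> (x \<otimes> a) = x \<otimes> (u \<otimes> a)" using * x by (simp add: m_lcomm)
    then have "u \<otimes> (x \<otimes> a) \<in> I" using * x I.I_l_closed by simp
    then show "x \<otimes> a \<in> prime_saturation R P I" using * x unfolding prime_saturation_def by auto
  qed
qed

lemma prime_saturation_idem: "prime_saturation R P (prime_saturation R P I) \<subseteq> prime_saturation R P I"
proof
  fix x assume "x \<in> prime_saturation R P (prime_saturation R P I)"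
  then obtain u v where *: "x \<in> carrier R" "u \<in> carrier R - P" "v \<in> carrier R - P" "v \<otimes> (u \<otimes> x) \<in> I"
    by (auto simp: prime_saturation_def)
  then have "(v \<otimes> u) \<otimes> x \<in> I" by (simp add: m_assoc)
  then show "x \<in> prime_saturation R P I"
    using * prime_complement_mult[OF *(3,2)] unfolding prime_saturation_def by blast
qed

text \<open>The chain of ideals \<open>(D : a\<^sup>k)\<close> becomes stationary at some \<open>k\<close>. Then \<open>D + a\<^sup>kR\<close> meets \<open>N\<close> no more than \<open>D\<close>
  does, up to saturation: if \<open>ux = d + a\<^sup>km\<close> with \<open>x \<in> N\<close>, then \<open>ax \<in> D\<close> gives \<open>a\<^sup>k\<^sup>+\<^sup>1m \<in> D\<close>, hence
  \<open>a\<^sup>km \<in> D\<close> and \<open>ux \<in> D\<close>. By maximality of \<open>D\<close> it contains \<open>a\<^sup>k\<close>.\<close>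

lemma exists_power_in_maximal_saturated_ideal:
  assumes N: "ideal N R" and D: "ideal D R" "prime_saturation R P D \<subseteq> D"
    and K: "\<And>a n. a \<in> P \<Longrightarrow> n \<in> N \<Longrightarrow> a \<otimes> n \<in> D"
    and max: "\<And>E. ideal E R \<Longrightarrow> D \<subseteq> E \<Longrightarrow> prime_saturation R P E \<subseteq> E \<Longrightarrow> E \<inter> N \<subseteq> D \<Longrightarrow> E = D"
    and a: "a \<in> P"
  shows "\<exists>k::nat. a [^] k \<in> D"
proof -
  interpret N: ideal N R by fact
  interpret D: ideal D R by fact
  interpret P: primeideal P R by (rule P)
  have ac: "a \<in> carrier R" using P.Icarr[OF a] .
  define C where "C k = {x \<in> carrier R. \<forall>y\<in>{a [^] (k::nat)}. x \<otimes> y \<in> D}" for k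
  have iC: "ideal (C k) R" for k unfolding C_def by (rule colon_ideal[OF D(1)]) (use ac in auto)
  have "\<exists>I\<in>range C. \<forall>J\<in>range C. I \<subseteq> J \<longrightarrow> J = I" by (rule ex_maximal_ideal) (use iC in auto)
  then obtain I where I: "I \<in> range C" "\<forall>J\<in>range C. I \<subseteq> J \<longrightarrow> J = I" by (elim bexE)
  then obtain k where Ik: "I = C k" by auto
  have k: "C j = C k" if "C k \<subseteq> C j" for j using I(2)[rule_format, of "C j"] that Ik by simp
  have "C k \<subseteq> C (Suc k)"
  proof
    fix x assume "x \<in> C k"
    then have x: "x \<in> carrier R" "x \<otimes> a [^] k \<in> D" by (auto simp: C_def)
    then have "x \<otimes> a [^] k \<otimes> a \<in> D" using D.I_r_closed ac by blast
    then show "x \<in> C (Suc k)" using x ac by (simp add: C_def m_assoc)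
  qed
  then have Ck: "C (Suc k) = C k" by (rule k)
  define t where "t = a [^] k"
  have tc: "t \<in> carrier R" using ac by (simp add: t_def)
  have stable: "t \<otimes> m \<in> D" if m: "m \<in> carrier R" "a \<otimes> (t \<otimes> m) \<in> D" for m
  proof -
    have "m \<otimes> a [^] Suc k = a \<otimes> (t \<otimes> m)" using m ac by (simp add: t_def m_ac)
    then have "m \<in> C (Suc k)" using m by (simp add: C_def)
    then have "m \<otimes> t \<in> D" unfolding Ck by (simp add: C_def t_def)
    then show ?thesis using m_comm[OF m(1) tc] by simp
  qed
  define E where "E = {d \<oplus> m \<otimes> t | d m. d \<in> D \<and> m \<in> carrier R}"
  have E: "ideal E R" and DE: "D \<subseteq> E"
    unfolding E_def by (rule ideal_add_multiples[OF is_cring D(1) oneideal tc])+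
  interpret E: ideal E R by (rule E)
  have tE: "t \<in> E" unfolding E_def using tc D.zero_closed by (intro CollectI exI[of _ \<zero>] exI[of _ \<one>]) auto
  have Esub: "E \<subseteq> prime_saturation R P E" by (rule subset_prime_saturation[OF E.a_subset])
  have "prime_saturation R P E \<inter> N \<subseteq> D"
  proof
    fix x assume "x \<in> prime_saturation R P E \<inter> N"
    then obtain u where u: "x \<in> N" "u \<in> carrier R - P" "u \<otimes> x \<in> E"
      unfolding prime_saturation_def by blast
    from u(3) obtain m d where m: "m \<in> carrier R" "d \<in> D" "u \<otimes> x = d \<oplus> m \<otimes> t"
      unfolding E_def by blast
    then have "u \<otimes> x = t \<otimes> m \<oplus> d" using tc D.Icarr by (simp add: a_comm m_comm)
    note x = u(1,2) m(1,2) this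
    have c: "x \<in> carrier R" "u \<in> carrier R" "d \<in> carrier R" using x N.Icarr D.Icarr by auto
    have "a \<otimes> (t \<otimes> m) \<oplus> a \<otimes> d = u \<otimes> (a \<otimes> x)"
      using x(3,5) c ac tc by (metis m_lcomm r_distr m_closed)
    then have "a \<otimes> (t \<otimes> m) = u \<otimes> (a \<otimes> x) \<oplus> \<ominus> (a \<otimes> d)"
      using x(3) c ac tc by (metis add.inv_solve_right m_closed)
    moreover have "u \<otimes> (a \<otimes> x) \<in> D" using D.I_l_closed[OF K[OF a x(1)] c(2)] .
    moreover have "\<ominus> (a \<otimes> d) \<in> D" using D.I_l_closed[OF x(4) ac] D.a_inv_closed by blast
    ultimately have "a \<otimes> (t \<otimes> m) \<in> D" using D.a_closed by simp
    then have "u \<otimes> x \<in> D" unfolding x(5) using stable x D.a_closed by blast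
    then have "x \<in> prime_saturation R P D" using c x(2) by (auto simp: prime_saturation_def)
    then show "x \<in> D" using D(2) by blast
  qed
  then have "prime_saturation R P E = D"
    using max[OF ideal_prime_saturation[OF E]] DE Esub prime_saturation_idem by blast
  then show ?thesis using tE Esub t_def by blast
qed

end

lemma uniform_finite_power:
  assumes "ideal D R" "finite B" "B \<subseteq> carrier R" "\<And>a. a \<in> B \<Longrightarrow> \<exists>k::nat. a [^] k \<in> D"
  shows "\<exists>k::nat. \<forall>n\<ge>k. \<forall>a\<in>B. a [^] n \<in> D"
proof -
  interpret D: ideal D R by fact
  obtain k :: "_ \<Rightarrow> nat" where k: "\<And>a. a \<in> B \<Longrightarrow> a [^] k a \<in> D" using assms(4) by metis
  have "a [^] n \<in> D" if "a \<in> B" "Max (insert 0 (k ` B)) \<le> n" for a n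
  proof -
    have kn: "k a \<le> n" using that assms(2) by (meson Max_ge finite_imageI finite_insert image_eqI insertI2 le_trans)
    have ac: "a \<in> carrier R" using that assms(3) by blast
    have "a [^] n = a [^] (n - k a) \<otimes> a [^] k a" using kn ac by (simp add: nat_pow_mult)
    then show ?thesis using D.I_l_closed[OF k[OF that(1)]] ac by simp
  qed
  then show ?thesis by blast
qed

end

context char_p_cring
begin

definition frobenius_power where
  "frobenius_power P e = Idl {a [^] (p ^ e) | a. a \<in> P}"

lemma
  assumes "ideal P R"
  shows ideal_frobenius_power: "ideal (frobenius_power P e) R"
    and frobenius_power_mem: "a \<in> P \<Longrightarrow> a [^] (p ^ e) \<in> frobenius_power P e"
    and frobenius_power_least: "ideal D R \<Longrightarrow> (\<And>a. a \<in> P \<Longrightarrow> a [^] (p ^ e) \<in> D) \<Longrightarrow> frobenius_power P e \<subseteq> D"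
proof -
  interpret P: ideal P R by fact
  have c: "{a [^] (p ^ e) | a. a \<in> P} \<subseteq> carrier R" using P.Icarr by auto
  show "ideal (frobenius_power P e) R" unfolding frobenius_power_def by (rule genideal_ideal[OF c])
  show "a [^] (p ^ e) \<in> frobenius_power P e" if "a \<in> P"
    unfolding frobenius_power_def using genideal_self[OF c] that by blast
  show "frobenius_power P e \<subseteq> D" if "ideal D R" "\<And>a. a \<in> P \<Longrightarrow> a [^] (p ^ e) \<in> D"
    unfolding frobenius_power_def by (rule genideal_minimal[OF that(1)]) (use that(2) in auto)
qed

lemma frobenius_power_antimono:
  assumes "ideal P R" "e \<le> e'"
  shows "frobenius_power P e' \<subseteq> frobenius_power P e"
proof (rule frobenius_power_least[OF assms(1) ideal_frobenius_power[OF assms(1)]])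
  interpret P: ideal P R by fact
  interpret Q: ideal "frobenius_power P e" R by (rule ideal_frobenius_power[OF assms(1)])
  fix a assume a: "a \<in> P"
  have ac: "a \<in> carrier R" using P.Icarr[OF a] .
  have "p ^ e \<le> p ^ e'" using assms(2) p_gt_1 by (intro power_increasing) auto
  then have "a [^] (p ^ e') = a [^] (p ^ e' - p ^ e) \<otimes> a [^] (p ^ e)" using ac by (simp add: nat_pow_mult)
  then show "a [^] (p ^ e') \<in> frobenius_power P e"
    using Q.I_l_closed[OF frobenius_power_mem[OF assms(1) a]] ac by simp
qed

text \<open>Think of \<open>R\<close> as local with maximal ideal \<open>P\<close>. Let \<open>N\<close> be the intersection of the Frobenius powers of \<open>P\<close>
  and \<open>D\<close> maximal among the ideals that contain \<open>PN\<close> and meet \<open>N\<close> in \<open>PN\<close>. Every element of \<open>P\<close> has a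
  power in \<open>D\<close>, so \<open>D\<close> contains a Frobenius power of \<open>P\<close> and with it \<open>N\<close>. Hence \<open>N = PN\<close>, and Nakayama's
  lemma applies.\<close>

lemma Krull_intersection_frobenius_powers:
  assumes P: "primeideal P R"
    and c: "c \<in> carrier R" "\<And>e. c \<in> prime_saturation R P (frobenius_power P e)"
  shows "\<exists>w\<in>carrier R - P. w \<otimes> c = \<zero>"
proof -
  interpret P: primeideal P R by (rule P)
  note sat = ideal_prime_saturation[OF P] subset_prime_saturation[OF P] prime_saturation_idem[OF P]
  have iF: "ideal (frobenius_power P e) R" for e by (rule ideal_frobenius_power[OF P.ideal_axioms])
  define N where "N = (\<Inter>e. prime_saturation R P (frobenius_power P e))"
  have N: "ideal N R"
    unfolding N_def by (rule i_Intersect) (use sat(1)[OF iF] in auto)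
  interpret N: ideal N R by (rule N)
  define PN where "PN = Idl {a \<otimes> n | a n. a \<in> P \<and> n \<in> N}"
  have PNc: "{a \<otimes> n | a n. a \<in> P \<and> n \<in> N} \<subseteq> carrier R" using P.Icarr N.Icarr by auto
  interpret PN: ideal PN R unfolding PN_def by (rule genideal_ideal[OF PNc])
  have PNmem: "a \<otimes> n \<in> PN" if "a \<in> P" "n \<in> N" for a n
    unfolding PN_def using genideal_self[OF PNc] that by blast
  define K where "K = prime_saturation R P PN"
  have K: "ideal K R" "PN \<subseteq> K" "prime_saturation R P K \<subseteq> K"
    unfolding K_def using sat(1)[OF PN.ideal_axioms] sat(2)[OF PN.a_subset] sat(3) by auto
  define \<D> where "\<D> = {D. ideal D R \<and> K \<subseteq> D \<and> prime_saturation R P D \<subseteq> D \<and> D \<inter> N \<subseteq> K}"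
  have "K \<in> \<D>" using K by (auto simp: \<D>_def)
  then have "\<exists>D\<in>\<D>. \<forall>E\<in>\<D>. D \<subseteq> E \<longrightarrow> E = D"
    by (intro ex_maximal_ideal) (auto simp: \<D>_def)
  then obtain D where D: "ideal D R" "K \<subseteq> D" "prime_saturation R P D \<subseteq> D" "D \<inter> N \<subseteq> K"
    and max: "\<And>E. E \<in> \<D> \<Longrightarrow> D \<subseteq> E \<Longrightarrow> E = D" by (auto simp: \<D>_def)
  interpret D: ideal D R by (rule D(1))
  have pow: "\<exists>k::nat. a [^] k \<in> D" if a: "a \<in> P" for a
  proof (rule exists_power_in_maximal_saturated_ideal[OF P N D(1,3) _ _ a])
    show "b \<otimes> n \<in> D" if "b \<in> P" "n \<in> N" for b n using PNmem[OF that] K(2) D(2) by blast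
    show "E = D" if "ideal E R" "D \<subseteq> E" "prime_saturation R P E \<subseteq> E" "E \<inter> N \<subseteq> D" for E
      by (rule max) (use that D in \<open>auto simp: \<D>_def\<close>)
  qed
  obtain B where B: "B \<subseteq> carrier R" "finite B" "P = Idl B" using finetely_gen[OF P.ideal_axioms] by blast
  have BP: "B \<subseteq> P" using genideal_self[OF B(1)] B(3) by simp
  obtain k :: nat where k: "\<forall>n\<ge>k. \<forall>a\<in>B. a [^] n \<in> D"
    using uniform_finite_power[OF D(1) B(2,1)] pow BP by blast
  have "k \<le> p ^ k" using power_gt_expt[of p k] p_gt_1 by simp
  then have Bk: "a [^] (p ^ k) \<in> D" if "a \<in> B" for a using k that by blast
  have "ideal {a \<in> carrier R. a [^] (p ^ k) \<in> D} R"
  proof (rule ideal_criterion)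
    show "\<zero> \<in> {a \<in> carrier R. a [^] (p ^ k) \<in> D}" using zero_frobenius D.zero_closed by simp
  qed (auto simp: frobenius_add nat_pow_distrib D.I_l_closed)
  then have "P \<subseteq> {a \<in> carrier R. a [^] (p ^ k) \<in> D}"
    unfolding B(3) by (rule genideal_minimal) (use B(1) Bk in auto)
  then have "frobenius_power P k \<subseteq> D" by (intro frobenius_power_least[OF P.ideal_axioms D(1)]) auto
  then have "prime_saturation R P (frobenius_power P k) \<subseteq> prime_saturation R P D"
    by (rule prime_saturation_mono)
  moreover have "N \<subseteq> prime_saturation R P (frobenius_power P k)"
    unfolding N_def by (rule INT_lower) simp
  ultimately have "N \<subseteq> D" using D(3) by (meson order_trans)
  then have NK: "N \<subseteq> K" using D(4) by auto
  obtain G where G: "G \<subseteq> carrier R" "finite G" "N = Idl G" using finetely_gen[OF N] by blast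
  have GN: "G \<subseteq> N" using genideal_self[OF G(1)] G(3) by simp
  have "\<exists>u\<in>carrier R - P. \<forall>n\<in>F. n \<otimes> u \<in> PN" if "finite F" "F \<subseteq> N" for F
    using that
  proof (induction F)
    case empty
    then show ?case using prime_complement_one[OF P] by auto
  next
    case (insert n F)
    then obtain u where u: "u \<in> carrier R - P" "\<forall>n\<in>F. n \<otimes> u \<in> PN" by auto
    have nN: "n \<in> N" "F \<subseteq> carrier R" "n \<in> carrier R" using insert.prems N.a_subset by auto
    then obtain v where v: "v \<in> carrier R - P" "v \<otimes> n \<in> PN" using NK by (auto simp: K_def prime_saturation_def)
    have "m \<otimes> (u \<otimes> v) \<in> PN" if m: "m \<in> insert n F" for m
    proof (cases "m = n")
      case True
      then have "m \<otimes> (u \<otimes> v) = u \<otimes> (v \<otimes> n)" using u v nN by (simp add: m_ac)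
      then show ?thesis using PN.I_l_closed[OF v(2)] u by simp
    next
      case False
      then have mF: "m \<in> F" "m \<in> carrier R" using m nN by auto
      have "m \<otimes> (u \<otimes> v) = (m \<otimes> u) \<otimes> v" using u v mF by (simp add: m_assoc)
      then show ?thesis using PN.I_r_closed[of "m \<otimes> u" v] u v mF by simp
    qed
    then show ?case using prime_complement_mult[OF P u(1) v(1)] by blast
  qed
  from this[OF G(2) GN] obtain u where u: "u \<in> carrier R - P" "\<forall>n\<in>G. n \<otimes> u \<in> PN" by blast
  have "ideal {n \<in> carrier R. \<forall>y\<in>{u}. n \<otimes> y \<in> PN} R" by (rule colon_ideal[OF PN.ideal_axioms]) (use u in auto)
  then have Nu: "N \<subseteq> {n \<in> carrier R. \<forall>y\<in>{u}. n \<otimes> y \<in> PN}"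
    unfolding G(3) by (rule genideal_minimal) (use G(1) u in auto)
  have "\<exists>w\<in>carrier R - P. \<forall>y\<in>N. w \<otimes> y = \<zero>"
  proof (rule nakayama[OF P.ideal_axioms N _ _ _ u(1)])
    show "v \<otimes> w \<in> carrier R - P" if "v \<in> carrier R - P" "w \<in> carrier R - P" for v w
      using prime_complement_mult[OF P that] .
    show "w \<ominus> a \<in> carrier R - P" if w: "w \<in> carrier R - P" and a: "a \<in> P" for w a
    proof -
      have c: "w \<in> carrier R" "a \<in> carrier R" using w P.Icarr[OF a] by auto
      have "w \<ominus> a \<notin> P"
      proof
        assume "w \<ominus> a \<in> P"
        then have "(w \<ominus> a) \<oplus> a \<in> P" using a P.a_closed by blast
        then show False using w c by (simp add: a_minus_def a_assoc l_neg)
      qed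
      then show ?thesis using c by simp
    qed
    show "u \<otimes> y \<in> Idl {i \<otimes> n | i n. i \<in> P \<and> n \<in> N}" if "y \<in> N" for y
      using Nu that m_comm[of u y] N.Icarr[OF that] u unfolding PN_def by auto
  qed auto
  moreover have "c \<in> N" using c by (simp add: N_def)
  ultimately show ?thesis by blast
qed

end


section \<open>Finite extensions\<close>

lemma finite_extension_ops:
  assumes ext: "finite_extension R S"
  shows "carrier R \<subseteq> carrier S" "monoid.mult R = monoid.mult S" "one R = one S"
    "ring.zero R = ring.zero S" "add R = add S" "x [^]\<^bsub>R\<^esub> (n::nat) = x [^]\<^bsub>S\<^esub> n"
proof -
  have R: "R = S\<lparr>carrier := carrier R\<rparr>" and sub: "subring (carrier R) S"
    using ext by (simp_all add: finite_extension_def)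
  interpret sub: subring "carrier R" S by (rule sub)
  show "carrier R \<subseteq> carrier S" by (rule sub.subset[simplified])
  have ops: "monoid.mult (S\<lparr>carrier := C\<rparr>) = monoid.mult S" "one (S\<lparr>carrier := C\<rparr>) = one S"
    "ring.zero (S\<lparr>carrier := C\<rparr>) = ring.zero S" "add (S\<lparr>carrier := C\<rparr>) = add S"
    "x [^]\<^bsub>S\<lparr>carrier := C\<rparr>\<^esub> n = x [^]\<^bsub>S\<^esub> n" for C
    by (simp_all add: nat_pow_def)
  show "monoid.mult R = monoid.mult S" by (subst R) (rule ops)
  show "one R = one S" by (subst R) (rule ops)
  show "ring.zero R = ring.zero S" by (subst R) (rule ops)
  show "add R = add S" by (subst R) (rule ops)
  show "x [^]\<^bsub>R\<^esub> n = x [^]\<^bsub>S\<^esub> n" by (subst R) (rule ops)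
qed

lemma module_restrict_scalars:
  assumes ext: "finite_extension R S" and R: "cring R" and M: "module S M"
  shows "module R M"
proof -
  interpret M: module S M by fact
  note ops = finite_extension_ops[OF ext]
  show ?thesis
    by (rule moduleI[OF R M.abelian_group_axioms])
      (use ops(1) in \<open>auto simp: ops(2-5) M.smult_l_distr M.smult_r_distr M.smult_assoc1 subset_iff\<close>)
qed

lemma submodule_restrict_scalars:
  assumes ext: "finite_extension R S" and "submodule H S M"
  shows "submodule H R M"
proof -
  interpret submodule H S M by fact
  show ?thesis
    using finite_extension_ops(1)[OF ext] smult_closed
    by (intro submodule.intro subgroup_axioms submodule_axioms.intro) auto
qed

lemma generating_set_over_larger_ring:
  assumes "generating_set R N A" "A \<subseteq> carrier N'" "carrier N' = carrier N"
    "\<And>H. submodule H S N' \<Longrightarrow> submodule H R N"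
  shows "generating_set S N' A"
  using assms unfolding generating_set_def by simp

lemma fg_module_restrict_scalars:
  assumes ext: "finite_extension R S" and R: "cring R" and M: "fg_module S M"
  shows "fg_module R M"
proof -
  have mM: "module S M" using M by (simp add: fg_module_def)
  interpret M: module S M by (rule mM)
  note ops = finite_extension_ops[OF ext]
  obtain A where A: "finite A" "generating_set S M A" using M by (auto simp: fg_module_iff)
  obtain B where B: "finite B" "generating_set R (ring_module S) B"
    using ext by (auto simp: fg_module_iff finite_extension_def)
  have "generating_set R M ((\<lambda>(b, a). b \<odot>\<^bsub>M\<^esub> a) ` (B \<times> A))"
  proof (rule generating_set_tower[OF _ _ mM A(2) B(2)])
    show "module R (ring_module S)" using ext by (simp add: finite_extension_def fg_module_def)
    show "module R M" by (rule module_restrict_scalars[OF ext R mM])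
    show "r \<odot>\<^bsub>M\<^esub> (q \<odot>\<^bsub>M\<^esub> n) = (r \<odot>\<^bsub>ring_module S\<^esub> q) \<odot>\<^bsub>M\<^esub> n"
      if "r \<in> carrier R" "q \<in> carrier (ring_module S)" "n \<in> carrier M" for r q n
      using that ops(1) M.smult_assoc1[of r q n] by auto
  qed simp_all
  moreover have "finite ((\<lambda>(b, a). b \<odot>\<^bsub>M\<^esub> a) ` (B \<times> A))" using A(1) B(1) by simp
  ultimately show ?thesis
    unfolding fg_module_iff using module_restrict_scalars[OF ext R mM] by (intro conjI exI)
qed

lemma F_finite_finite_extension:
  assumes R: "char_p_cring R p" and S: "char_p_cring S p" and F: "F_finite p R"
    and ext: "finite_extension R S"
  shows "F_finite p S"
proof -
  interpret R: char_p_cring R p by (rule R)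
  interpret S: char_p_cring S p by (rule S)
  note ops = finite_extension_ops[OF ext]
  have mS: "module R (ring_module S)" using ext by (simp add: finite_extension_def fg_module_def)
  obtain A where A: "finite A" "generating_set R (ring_module S) A"
    using ext by (auto simp: fg_module_iff finite_extension_def)
  obtain B where B: "finite B" "generating_set R (R.Fr 1) B"
    using F by (auto simp: fg_module_iff F_finite_def)
  let ?G = "(\<lambda>(b, a). b \<odot>\<^bsub>ring_module S\<^esub> a) ` (B \<times> A)"
  have G: "generating_set R (frob_module p 1 R (ring_module S)) ?G"
  proof (rule generating_set_tower[OF _ _ mS A(2) B(2)])
    show "module R (frob_module p 1 R (ring_module S))" by (rule R.module_frob_module[OF mS])
    show "r \<odot>\<^bsub>frob_module p 1 R (ring_module S)\<^esub> (q \<odot>\<^bsub>ring_module S\<^esub> n) = (r \<odot>\<^bsub>R.Fr 1\<^esub> q) \<odot>\<^bsub>ring_module S\<^esub> n"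
      if "r \<in> carrier R" "q \<in> carrier (R.Fr 1)" "n \<in> carrier (frob_module p 1 R (ring_module S))" for r q n
      using that ops(1) by (auto simp: ops(2,6) S.m_assoc subset_iff)
  qed simp_all
  have "generating_set S (S.Fr 1) ?G"
  proof (rule generating_set_over_larger_ring[OF G])
    show "?G \<subseteq> carrier (S.Fr 1)" using G by (simp add: generating_set_def)
    fix H assume H: "submodule H S (S.Fr 1)"
    interpret Fr: module S "S.Fr 1" by simp
    interpret N: module R "frob_module p 1 R (ring_module S)" by (rule R.module_frob_module[OF mS])
    show "submodule H R (frob_module p 1 R (ring_module S))"
      by (rule N.submodule_criterion)
        (use Fr.submodule_props[OF H] ops(1) in \<open>auto simp: ops(6) subset_iff\<close>)
  qed simp
  moreover have "finite ?G" using A(1) B(1) by simp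
  ultimately show ?thesis unfolding F_finite_def fg_module_iff by (intro conjI exI) simp_all
qed

text \<open>If every element were killed by something outside \<open>P\<close>, all fractions would be equal.\<close>

lemma module_support_nonzero:
  assumes M: "module S M" and P: "P \<in> module_support S M"
  shows "\<exists>x\<in>carrier M. \<forall>u\<in>carrier S - P. u \<odot>\<^bsub>M\<^esub> x \<noteq> \<zero>\<^bsub>M\<^esub>"
proof (rule ccontr)
  interpret M: module S M by fact
  interpret P: primeideal P S using P by (simp add: module_support_def prime_spec_def)
  assume "\<not> ?thesis"
  then have kill: "\<exists>u\<in>carrier S - P. u \<odot>\<^bsub>M\<^esub> x = \<zero>\<^bsub>M\<^esub>" if "x \<in> carrier M" for x using that by blast
  let ?U = "carrier S - P"
  have one: "\<one>\<^bsub>S\<^esub> \<in> ?U" using P.one_imp_carrier P.I_notcarr by auto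
  have mult: "u \<otimes>\<^bsub>S\<^esub> v \<in> ?U" if "u \<in> ?U" "v \<in> ?U" for u v using that P.I_prime[of u v] by auto
  have "frac_rel M ?U `` {(x, s)} = carrier M \<times> ?U" if x: "x \<in> carrier M" and s: "s \<in> ?U" for x s
  proof -
    have "\<exists>u\<in>?U. u \<odot>\<^bsub>M\<^esub> (t \<odot>\<^bsub>M\<^esub> x) = u \<odot>\<^bsub>M\<^esub> (s \<odot>\<^bsub>M\<^esub> y)" if y: "y \<in> carrier M" and t: "t \<in> ?U" for y t
    proof -
      obtain u v where u: "u \<in> ?U" "u \<odot>\<^bsub>M\<^esub> x = \<zero>\<^bsub>M\<^esub>" and v: "v \<in> ?U" "v \<odot>\<^bsub>M\<^esub> y = \<zero>\<^bsub>M\<^esub>"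
        using kill x y by blast
      have c: "u \<in> carrier S" "v \<in> carrier S" "s \<in> carrier S" "t \<in> carrier S" using u v s t by auto
      have "(u \<otimes>\<^bsub>S\<^esub> v) \<odot>\<^bsub>M\<^esub> (t \<odot>\<^bsub>M\<^esub> x) = (v \<otimes>\<^bsub>S\<^esub> t) \<odot>\<^bsub>M\<^esub> (u \<odot>\<^bsub>M\<^esub> x)"
        using c x by (simp add: M.smult_assoc1[symmetric] M.m_ac)
      moreover have "(u \<otimes>\<^bsub>S\<^esub> v) \<odot>\<^bsub>M\<^esub> (s \<odot>\<^bsub>M\<^esub> y) = (u \<otimes>\<^bsub>S\<^esub> s) \<odot>\<^bsub>M\<^esub> (v \<odot>\<^bsub>M\<^esub> y)"
        using c y by (simp add: M.smult_assoc1[symmetric] M.m_ac)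
      ultimately have "(u \<otimes>\<^bsub>S\<^esub> v) \<odot>\<^bsub>M\<^esub> (t \<odot>\<^bsub>M\<^esub> x) = (u \<otimes>\<^bsub>S\<^esub> v) \<odot>\<^bsub>M\<^esub> (s \<odot>\<^bsub>M\<^esub> y)"
        using u(2) v(2) c by simp
      then show ?thesis using mult[OF u(1) v(1)] by blast
    qed
    then show ?thesis using x s by (auto simp: frac_rel_def)
  qed
  then have "localization M ?U = {frac_rel M ?U `` {(\<zero>\<^bsub>M\<^esub>, \<one>\<^bsub>S\<^esub>)}}"
    unfolding localization_def quotient_def using one by auto
  then show False using P by (simp add: module_support_def)
qed

locale F_finite_reduced_extension =
  R: F_finite_reduced_ring R p + S: F_finite_reduced_ring S p for R S :: "'a ring" and p :: nat +
  assumes ext: "finite_extension R S"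
begin

lemmas ops = finite_extension_ops[OF ext]

lemma module_S [simp]: "module R (ring_module S)"
  using ext by (simp add: finite_extension_def fg_module_def)

lemma contract_prime:
  assumes "primeideal Q S" shows "primeideal (Q \<inter> carrier R) R"
proof -
  interpret Q: primeideal Q S by fact
  have id: "ideal (Q \<inter> carrier R) R"
    by (rule R.ideal_criterion)
      (use ops(1) Q.I_l_closed Q.a_closed Q.zero_closed in \<open>auto simp: ops(2-5)[symmetric] subset_iff\<close>)
  have "\<one>\<^bsub>S\<^esub> \<notin> Q" using Q.one_imp_carrier Q.I_notcarr by blast
  then have "carrier R \<noteq> Q \<inter> carrier R" using R.one_closed ops(3) by auto
  moreover have "a \<in> Q \<inter> carrier R \<or> b \<in> Q \<inter> carrier R"
    if "a \<in> carrier R" "b \<in> carrier R" "a \<otimes>\<^bsub>R\<^esub> b \<in> Q \<inter> carrier R" for a b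
    using that ops(1) Q.I_prime[of a b] by (auto simp: ops(2))
  ultimately show ?thesis by (intro primeidealI[OF id R.is_cring])
qed

text \<open>If no \<open>Q\<close> contracted into \<open>P\<close>, a product of elements of the contractions that lie outside \<open>P\<close> would be
  in all minimal primes of \<open>S\<close>, hence zero.\<close>

lemma minimal_prime_is_contracted:
  assumes P: "P \<in> minimal_primes R"
  shows "\<exists>Q\<in>minimal_primes S. Q \<inter> carrier R = P"
proof -
  interpret P: primeideal P R by (rule R.minimal_primes_prime[OF P])
  have "\<exists>Q\<in>minimal_primes S. Q \<inter> carrier R \<subseteq> P"
  proof (rule ccontr)
    assume no: "\<not> ?thesis"
    have "\<exists>x\<in>carrier R - P. \<forall>Q\<in>F. x \<in> Q" if "finite F" "F \<subseteq> minimal_primes S" for F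
      using that
    proof (induction F)
      case empty
      then show ?case using R.prime_complement_one[OF P.primeideal] by auto
    next
      case (insert Q F)
      then obtain x where x: "x \<in> carrier R - P" "\<forall>Q\<in>F. x \<in> Q" by auto
      have Q: "Q \<in> minimal_primes S" using insert.prems by blast
      then obtain y where y: "y \<in> Q" "y \<in> carrier R - P" using no by blast
      have c: "x \<in> carrier S" "y \<in> carrier S" using x y ops(1) by auto
      have "x \<otimes>\<^bsub>R\<^esub> y \<in> Q'" if Q': "Q' \<in> insert Q F" for Q'
      proof -
        have "Q' \<in> minimal_primes S" using Q' insert.prems by blast
        then interpret Q': primeideal Q' S by (rule S.minimal_primes_prime)
        have "x \<in> Q' \<or> y \<in> Q'" using Q' x y by blast
        then show ?thesis using Q'.I_l_closed Q'.I_r_closed c by (auto simp: ops(2))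
      qed
      then show ?case using R.prime_complement_mult[OF P.primeideal x(1) y(2)] by blast
    qed
    from this[OF S.finite_minimal_primes] obtain x where x: "x \<in> carrier R - P" "\<forall>Q\<in>minimal_primes S. x \<in> Q"
      by blast
    then have "x = \<zero>\<^bsub>S\<^esub>" using ops(1) by (intro S.zero_if_in_minimal_primes) auto
    then show False using x P.zero_closed ops(4) by simp
  qed
  then obtain Q where Q: "Q \<in> minimal_primes S" "Q \<inter> carrier R \<subseteq> P" by blast
  have "primeideal (Q \<inter> carrier R) R" by (rule contract_prime[OF S.minimal_primes_prime[OF Q(1)]])
  then have "Q \<inter> carrier R = P" using P Q(2) unfolding minimal_primes_def prime_spec_def by auto
  then show ?thesis using Q(1) by blast
qed

lemma off_minimal_primes_not_in_frobenius_power: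
  assumes c: "c \<in> off_minimal_primes R" and P: "primeideal P R"
  shows "\<exists>e0. \<forall>e\<ge>e0. c \<notin> prime_saturation R P (R.frobenius_power P e)"
proof -
  interpret P: primeideal P R by (rule P)
  have cc: "c \<in> carrier R" using R.off_minimal_primes_carrier[OF c] .
  have "\<exists>e. c \<notin> prime_saturation R P (R.frobenius_power P e)"
  proof (rule ccontr)
    assume "\<not> ?thesis"
    then obtain w where w: "w \<in> carrier R - P" "w \<otimes>\<^bsub>R\<^esub> c = \<zero>\<^bsub>R\<^esub>"
      using R.Krull_intersection_frobenius_powers[OF P cc] by blast
    then have "w = \<zero>\<^bsub>R\<^esub>" using R.off_minimal_primes_nonzerodivisor[OF c, of w] cc by (simp add: R.m_comm)
    then show False using w P.zero_closed by blast
  qed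
  then obtain e0 where "c \<notin> prime_saturation R P (R.frobenius_power P e0)" by blast
  then have "c \<notin> prime_saturation R P (R.frobenius_power P e)" if "e0 \<le> e" for e
    using R.prime_saturation_mono[OF R.frobenius_power_antimono[OF P.ideal_axioms that], of P] by blast
  then show ?thesis by blast
qed

text \<open>For fixed \<open>e\<close> the values \<open>\<psi>(\<^sup>ec)\<close> form an ideal of \<open>S\<close>, so it is enough to leave one minimal prime \<open>Q\<close> at a
  time, with \<open>e\<close> so large that \<open>c\<close> avoids the Frobenius power of each of the contractions. Near \<open>Q\<close> the
  target is \<open>tR\<close>, where \<open>t \<notin> Q\<close> and \<open>tQ = 0\<close>.\<close>

lemma Hom_value_off_minimal_primes_extension:
  assumes c: "c \<in> off_minimal_primes R"
  shows "\<exists>e. \<exists>\<psi>\<in>Hom_module R (R.Fr e) (ring_module S). \<psi> c \<in> off_minimal_primes S"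
proof -
  have cc: "c \<in> carrier R" using R.off_minimal_primes_carrier[OF c] .
  have "\<forall>Q\<in>minimal_primes S. \<exists>e0. \<forall>e\<ge>e0. c \<notin> prime_saturation R (Q \<inter> carrier R) (R.frobenius_power (Q \<inter> carrier R) e)"
    using off_minimal_primes_not_in_frobenius_power[OF c contract_prime] S.minimal_primes_prime by simp
  then obtain e0 where e0: "\<And>Q e. Q \<in> minimal_primes S \<Longrightarrow> e0 Q \<le> e \<Longrightarrow>
    c \<notin> prime_saturation R (Q \<inter> carrier R) (R.frobenius_power (Q \<inter> carrier R) e)"
    by metis
  define e where "e = Max (insert 0 (e0 ` minimal_primes S))"
  have e: "e0 Q \<le> e" if "Q \<in> minimal_primes S" for Q
    unfolding e_def using that S.finite_minimal_primes by (intro Max_ge) auto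
  let ?K = "(\<lambda>f. f c) ` Hom_module R (R.Fr e) (ring_module S)"
  interpret RS: module R "ring_module S" by simp
  have K: "submodule ?K R (ring_module S)" by (rule submodule_Hom_values) (simp_all add: cc)
  have "ideal ?K S"
  proof (rule S.ideal_criterion)
    fix a s assume "a \<in> ?K" and s: "s \<in> carrier S"
    then obtain f where f: "f \<in> Hom_module R (R.Fr e) (ring_module S)" "a = f c" by blast
    note fh = Hom_moduleD[OF f(1)]
    have "(\<lambda>x. s \<otimes>\<^bsub>S\<^esub> f x) \<in> Hom_module R (R.Fr e) (ring_module S)"
    proof (rule Hom_moduleI)
      fix r x assume r: "r \<in> carrier R" and x: "x \<in> carrier (R.Fr e)"
      have "f x \<in> carrier S" "r \<in> carrier S" using fh(1)[OF x] r ops(1) by auto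
      then show "s \<otimes>\<^bsub>S\<^esub> f (r \<odot>\<^bsub>R.Fr e\<^esub> x) = r \<odot>\<^bsub>ring_module S\<^esub> (s \<otimes>\<^bsub>S\<^esub> f x)"
        unfolding fh(3)[OF r x] using s by (simp add: S.m_lcomm)
    next
      fix x y assume x: "x \<in> carrier (R.Fr e)" and y: "y \<in> carrier (R.Fr e)"
      have "f x \<in> carrier S" "f y \<in> carrier S" using fh(1)[OF x] fh(1)[OF y] by auto
      then show "s \<otimes>\<^bsub>S\<^esub> f (x \<oplus>\<^bsub>R.Fr e\<^esub> y) = s \<otimes>\<^bsub>S\<^esub> f x \<oplus>\<^bsub>ring_module S\<^esub> s \<otimes>\<^bsub>S\<^esub> f y"
        unfolding fh(2)[OF x y] using s by (simp add: S.r_distr)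
    qed (use fh(1) s in simp)
    then show "s \<otimes>\<^bsub>S\<^esub> a \<in> ?K" unfolding f(2) by (rule rev_image_eqI) simp
  qed (use RS.submodule_props[OF K] in auto)
  moreover have "\<not> ?K \<subseteq> Q" if Q: "Q \<in> minimal_primes S" for Q
  proof -
    define P where "P = Q \<inter> carrier R"
    interpret Q: primeideal Q S by (rule S.minimal_primes_prime[OF Q])
    interpret P: primeideal P R unfolding P_def by (rule contract_prime[OF Q.primeideal])
    have notin: "c \<notin> prime_saturation R P (R.frobenius_power P e)"
      unfolding P_def by (rule e0[OF Q e[OF Q]])
    from R.finitely_generated_Fr[OF R.F_finite, of e]
    obtain A where A: "finite A" "generating_set R (R.Fr e) A" by (elim exE conjE)
    obtain t where t: "t \<in> carrier S" "t \<notin> Q" "\<And>a. a \<in> Q \<Longrightarrow> t \<otimes>\<^bsub>S\<^esub> a = \<zero>\<^bsub>S\<^esub>"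
      using S.minimal_prime_annihilated[OF Q] by blast
    let ?D = "R.frobenius_power P e"
    interpret D: ideal ?D R by (rule R.ideal_frobenius_power[OF P.ideal_axioms])
    have "\<exists>\<phi>\<in>Hom_module R (R.Fr e) (ring_module S). \<exists>r\<in>carrier R - P. \<phi> c = r \<odot>\<^bsub>ring_module S\<^esub> t"
    proof (rule functional_extension[OF R.module_Fr module_S P.primeideal A R.ideal_imp_submodule_Fr[OF D.ideal_axioms]])
      show "a \<odot>\<^bsub>R.Fr e\<^esub> n \<in> ?D" if "a \<in> P" "n \<in> carrier (R.Fr e)" for a n
        using D.I_r_closed[OF R.frobenius_power_mem[OF P.ideal_axioms that(1)], of n] that(2) by simp
      show "u \<odot>\<^bsub>R.Fr e\<^esub> c \<notin> ?D" if u: "u \<in> carrier R - P" for u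
      proof
        assume *: "u \<odot>\<^bsub>R.Fr e\<^esub> c \<in> ?D"
        have "u [^]\<^bsub>R\<^esub> n \<in> carrier R - P" for n :: nat
        proof (induction n)
          case 0
          then show ?case using R.prime_complement_one[OF P.primeideal] by simp
        next
          case (Suc n)
          then show ?case using R.prime_complement_mult[OF P.primeideal Suc u] by simp
        qed
        then show False using notin * cc unfolding prime_saturation_def by auto
      qed
      show "a \<odot>\<^bsub>ring_module S\<^esub> t = \<zero>\<^bsub>ring_module S\<^esub>" if "a \<in> P" for a
        using t(1) t(3)[of a] that Q.Icarr[of a] S.m_comm[of a t] by (auto simp: P_def)
    qed (simp_all add: cc t)
    then obtain \<phi> r where \<phi>: "\<phi> \<in> Hom_module R (R.Fr e) (ring_module S)" "r \<in> carrier R - P" "\<phi> c = r \<otimes>\<^bsub>S\<^esub> t"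
      by auto
    have "r \<otimes>\<^bsub>S\<^esub> t \<notin> Q" using Q.I_prime[of r t] \<phi>(2) t ops(1) by (auto simp: P_def)
    then show ?thesis using \<phi>(1,3) by (metis image_eqI subsetD)
  qed
  ultimately obtain x where "x \<in> ?K" "x \<in> off_minimal_primes S"
    using S.ideal_meets_off_minimal_primes[of ?K] by blast
  then show ?thesis by auto
qed

lemma Hom_restrict_scalars:
  assumes "f \<in> Hom_module S (frob_module p e S M) N"
  shows "f \<in> Hom_module R (frob_module p e R M) N"
  using assms ops(1) by (auto simp: Hom_module_def ops(6))

lemma tight_interior_over_extension:
  fixes M :: "('a, 'm) module"
  assumes M: "module S M"
  shows "tight_interior p S M \<subseteq> tight_interior p R M"
proof
  fix x assume x: "x \<in> tight_interior p S M"
  have RM: "module R M" by (rule module_restrict_scalars[OF ext R.is_cring M])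
  interpret RM: module R M by (rule RM)
  have "x \<in> tight_interior_at p R M c e0" if c: "c \<in> off_minimal_primes R" for c e0
  proof -
    have cc: "c \<in> carrier R" using R.off_minimal_primes_carrier[OF c] .
    note tp = RM.submodule_props[OF R.submodule_tight_interior_at[OF RM cc, of e0]]
    obtain e1 \<psi> where \<psi>: "\<psi> \<in> Hom_module R (R.Fr e1) (ring_module S)" "\<psi> c \<in> off_minimal_primes S"
      using Hom_value_off_minimal_primes_extension[OF c] by blast
    have "tight_interior_at p S M (\<psi> c) e0 \<subseteq> tight_interior_at p R M c e0"
    proof (rule S.tight_interior_at_least[OF M tp(1-3)])
      fix e g assume e: "e0 \<le> e" and g: "g \<in> Hom_module S (S.Fr e) M"
      have "(\<lambda>x. g (\<psi> x)) \<in> Hom_module R (R.Fr (e1 + e)) M"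
        by (rule Hom_frob_comp[OF R.is_cring \<psi>(1) Hom_restrict_scalars[OF g]])
      from R.tight_interior_atI[OF RM cc this, of e0] e
      show "g (\<psi> c) \<in> tight_interior_at p R M c e0" by simp
    qed
    moreover have "x \<in> tight_interior_at p S M (\<psi> c) e0" using x \<psi>(2) by (auto simp: tight_interior_def)
    ultimately show ?thesis by blast
  qed
  then show "x \<in> tight_interior p R M" by (simp add: tight_interior_def)
qed

text \<open>A minimal prime \<open>P\<close> of \<open>R\<close> has a minimal prime \<open>Q\<close> of \<open>S\<close> over it. Some \<open>m \<in> M\<close> is not killed by any
  element outside \<open>Q\<close>, and for a test element \<open>c\<close> of \<open>S\<close> the same holds for \<open>cm \<in> M\<^sub>*\<^sub>S\<close>. In particular
  \<open>cm\<close> is not killed by any element of \<open>R\<close> outside \<open>P\<close>, so a functional takes it out of \<open>P\<close>.\<close>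

lemma functionals_on_tight_interior_meet_off_minimal_primes:
  fixes M :: "('a, 'm) module"
  assumes M: "fg_module S M" and supp: "module_support S M = prime_spec S"
  shows "\<exists>c\<in>off_minimal_primes R. c \<in> submodule_sum (ring_module R) (Hom_module R M (ring_module R))
    (\<lambda>\<phi>. \<phi> ` tight_interior p S M)"
proof -
  have SM: "module S M" using M by (simp add: fg_module_def)
  interpret SM: module S M by (rule SM)
  have RM: "module R M" by (rule module_restrict_scalars[OF ext R.is_cring SM])
  interpret RM: module R M by (rule RM)
  let ?J = "submodule_sum (ring_module R) (Hom_module R M (ring_module R)) (\<lambda>\<phi>. \<phi> ` tight_interior p S M)"
  have T: "submodule (tight_interior p S M) R M"
    by (rule submodule_restrict_scalars[OF ext S.submodule_tight_interior[OF SM]])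
  have "submodule ?J R (ring_module R)"
    by (rule submodule_submodule_sum[OF R.module_ring submodule_Hom_image[OF RM R.module_ring T]])
  then have "ideal ?J R" using submodule_ring_module_iff[OF R.is_cring] by blast
  moreover have "\<not> ?J \<subseteq> P" if P: "P \<in> minimal_primes R" for P
  proof -
    interpret P: primeideal P R by (rule R.minimal_primes_prime[OF P])
    obtain Q where Q: "Q \<in> minimal_primes S" "Q \<inter> carrier R = P"
      using minimal_prime_is_contracted[OF P] by blast
    interpret Q: primeideal Q S by (rule S.minimal_primes_prime[OF Q(1)])
    have "Q \<in> module_support S M" unfolding supp by (simp add: prime_spec_def Q.primeideal)
    then obtain m where m: "m \<in> carrier M" "\<And>u. u \<in> carrier S - Q \<Longrightarrow> u \<odot>\<^bsub>M\<^esub> m \<noteq> \<zero>\<^bsub>M\<^esub>"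
      using module_support_nonzero[OF SM] by blast
    obtain c where c: "c \<in> off_minimal_primes S"
      "\<forall>M :: ('a, 'm) module. module S M \<longrightarrow> (\<forall>x\<in>carrier M. c \<odot>\<^bsub>M\<^esub> x \<in> tight_interior p S M)"
      using S.test_element by blast
    define x where "x = c \<odot>\<^bsub>M\<^esub> m"
    have cc: "c \<in> carrier S" "c \<notin> Q" using c(1) Q(1) by (auto simp: off_minimal_primes_def)
    have xc: "x \<in> carrier M" using cc m(1) by (simp add: x_def)
    have xT: "x \<in> tight_interior p S M" unfolding x_def using c(2) SM m(1) by blast
    have x: "u \<odot>\<^bsub>M\<^esub> x \<noteq> \<zero>\<^bsub>M\<^esub>" if u: "u \<in> carrier R - P" for u
    proof -
      have uc: "u \<in> carrier S" "u \<notin> Q" using u Q(2) ops(1) by auto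
      then have "u \<otimes>\<^bsub>S\<^esub> c \<in> carrier S - Q" using cc Q.I_prime by auto
      then have "(u \<otimes>\<^bsub>S\<^esub> c) \<odot>\<^bsub>M\<^esub> m \<noteq> \<zero>\<^bsub>M\<^esub>" by (rule m(2))
      then show ?thesis using uc cc m(1) by (simp add: x_def SM.smult_assoc1)
    qed
    from fg_module_restrict_scalars[OF ext R.is_cring M]
    obtain A where A: "finite A" "generating_set R M A" by (auto simp: fg_module_iff)
    obtain \<phi> where \<phi>: "\<phi> \<in> Hom_module R M (ring_module R)" "\<phi> x \<in> carrier R - P"
      using R.functional_at_minimal_prime[OF RM A P xc x] by blast
    then have "\<phi> x \<notin> P" by blast
    moreover have "\<phi> x \<in> ?J"
      by (rule submodule_sum_upper[OF R.module_ring \<phi>(1)]) (use xT Hom_moduleD(1)[OF \<phi>(1) xc] in auto)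
    ultimately show ?thesis by blast
  qed
  ultimately show ?thesis using R.ideal_meets_off_minimal_primes[of ?J] by blast
qed

theorem tight_interior_finite_extension:
  fixes L :: "('a, 'l) module" and M :: "('a, 'm) module"
  assumes L: "module R L" and M: "fg_module S M" and supp: "module_support S M = prime_spec S"
  shows "tight_interior p R L =
    submodule_sum L (UNIV :: nat set) (\<lambda>e.
      submodule_sum L (Hom_module R (frob_module p e R M) L) (\<lambda>\<phi>. \<phi> ` tight_interior p S M))"
    (is "_ = ?sum")
proof
  have SM: "module S M" using M by (simp add: fg_module_def)
  have RM: "module R M" by (rule module_restrict_scalars[OF ext R.is_cring SM])
  interpret L: module R L by (rule L)
  interpret RM: module R M by (rule RM)
  let ?T = "tight_interior p S M"
  have T: "submodule ?T R M"
    by (rule submodule_restrict_scalars[OF ext S.submodule_tight_interior[OF SM]])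
  have TF: "submodule ?T R (frob_module p e R M)" for e
  proof -
    interpret F: module R "frob_module p e R M" by (rule R.module_frob_module[OF RM])
    show ?thesis by (rule F.submodule_criterion) (use RM.submodule_props[OF T] in auto)
  qed
  have sub: "submodule (submodule_sum L (Hom_module R (frob_module p e R M) L) (\<lambda>\<phi>. \<phi> ` ?T)) R L" for e
    by (rule submodule_submodule_sum[OF L submodule_Hom_image[OF R.module_frob_module[OF RM] L TF]])
  have sum: "submodule ?sum R L" by (rule submodule_submodule_sum[OF L sub])
  note sp = L.submodule_props[OF sum]
  note tp = L.submodule_props[OF R.submodule_tight_interior[OF L]]
  show "?sum \<subseteq> tight_interior p R L"
  proof (intro submodule_sum_least[OF L tp(1-3)] subsetI)
    fix e \<phi> y assume \<phi>: "\<phi> \<in> Hom_module R (frob_module p e R M) L" and "y \<in> \<phi> ` ?T"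
    then obtain x where x: "x \<in> ?T" "y = \<phi> x" by blast
    have "x \<in> tight_interior p R M" using tight_interior_over_extension[OF SM] x(1) by blast
    then show "y \<in> tight_interior p R L" unfolding x(2) by (rule R.tight_interior_Hom[OF RM L \<phi>])
  qed
  have mem: "\<phi> x \<in> ?sum" if \<phi>: "\<phi> \<in> Hom_module R (frob_module p e R M) L" and x: "x \<in> ?T" for e \<phi> x
  proof -
    have "\<phi> x \<in> carrier L"
      using Hom_moduleD(1)[OF \<phi>, of x] S.tight_interior_carrier[OF SM x] by simp
    then have "\<phi> x \<in> submodule_sum L (Hom_module R (frob_module p e R M) L) (\<lambda>\<phi>. \<phi> ` ?T)"
      using \<phi> x by (intro submodule_sum_upper[OF L \<phi>]) auto
    then show ?thesis
      using L.submodule_props(1)[OF sub] by (intro submodule_sum_upper[OF L, of e]) auto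
  qed
  obtain c where c: "c \<in> off_minimal_primes R"
    "c \<in> submodule_sum (ring_module R) (Hom_module R M (ring_module R)) (\<lambda>\<phi>. \<phi> ` ?T)"
    using functionals_on_tight_interior_meet_off_minimal_primes[OF M supp] by blast
  have "tight_interior_at p R L c 0 \<subseteq> ?sum"
  proof (rule R.tight_interior_at_least[OF L sp(1-3)])
    fix e g assume g: "g \<in> Hom_module R (R.Fr e) L"
    note gh = Hom_moduleD[OF g, simplified]
    let ?H = "{y \<in> carrier R. g y \<in> ?sum}"
    have g0: "g \<zero>\<^bsub>R\<^esub> = \<zero>\<^bsub>L\<^esub>" using Hom_module_zero[OF R.module_Fr L g] by simp
    have "submodule_sum (ring_module R) (Hom_module R M (ring_module R)) (\<lambda>\<phi>. \<phi> ` ?T) \<subseteq> ?H"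
    proof (rule submodule_sum_least[OF R.module_ring])
      fix \<phi> assume \<phi>: "\<phi> \<in> Hom_module R M (ring_module R)"
      show "\<phi> ` ?T \<subseteq> ?H"
      proof
        fix y assume "y \<in> \<phi> ` ?T"
        then obtain x where x: "x \<in> ?T" "y = \<phi> x" by blast
        have yc: "y \<in> carrier R"
          using Hom_moduleD(1)[OF \<phi> S.tight_interior_carrier[OF SM x(1)]] x(2) by simp
        have "\<phi> \<in> Hom_module R (frob_module p 0 R M) (ring_module R)"
          using \<phi> Hom_frob_zero[OF R.is_cring RM] by blast
        from Hom_frob_comp[OF R.is_cring this g]
        have "(\<lambda>x. g (\<phi> x)) \<in> Hom_module R (frob_module p e R M) L" by simp
        from mem[OF this x(1)] show "y \<in> ?H" using yc x(2) by simp
      qed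
    qed (use sp g0 gh in auto)
    then show "g c \<in> ?sum" using c(2) by blast
  qed
  then show "tight_interior p R L \<subseteq> ?sum" using c(1) unfolding tight_interior_def by blast
qed

end


section \<open>Quotients and syzygies\<close>

text \<open>The quotient is realized on representatives of the cosets, so that its elements have the same type as
  those of \<open>F\<close>.\<close>

lemma quotient_module_exists:
  fixes F :: "('a, 'n) module"
  assumes F: "module R F" and V: "submodule V R F"
  shows "\<exists>N \<pi>. module R (N :: ('a, 'n) module) \<and> \<pi> \<in> Hom_module R F N \<and>
    (\<forall>x\<in>carrier F. \<pi> x = \<zero>\<^bsub>N\<^esub> \<longleftrightarrow> x \<in> V)"
proof -
  interpret F: module R F by fact
  note Vp = F.submodule_props[OF V]
  define \<pi> where "\<pi> x = (SOME y. y \<in> carrier F \<and> x \<ominus>\<^bsub>F\<^esub> y \<in> V)" for x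
  have \<pi>: "\<pi> x \<in> carrier F" "x \<ominus>\<^bsub>F\<^esub> \<pi> x \<in> V" if x: "x \<in> carrier F" for x
  proof -
    have "x \<in> carrier F \<and> x \<ominus>\<^bsub>F\<^esub> x \<in> V" using x Vp(2) by (simp add: a_minus_def F.M.r_neg)
    then have "\<pi> x \<in> carrier F \<and> x \<ominus>\<^bsub>F\<^esub> \<pi> x \<in> V" unfolding \<pi>_def by (rule someI)
    then show "\<pi> x \<in> carrier F" "x \<ominus>\<^bsub>F\<^esub> \<pi> x \<in> V" by auto
  qed
  have \<pi>_eqI: "\<pi> x = \<pi> y" if "x \<in> carrier F" "y \<in> carrier F" "x \<ominus>\<^bsub>F\<^esub> y \<in> V" for x y
  proof -
    have "x \<ominus>\<^bsub>F\<^esub> z \<in> V \<longleftrightarrow> y \<ominus>\<^bsub>F\<^esub> z \<in> V" if z: "z \<in> carrier F" for z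
    proof
      assume "x \<ominus>\<^bsub>F\<^esub> z \<in> V"
      then have "(x \<ominus>\<^bsub>F\<^esub> z) \<ominus>\<^bsub>F\<^esub> (x \<ominus>\<^bsub>F\<^esub> y) \<in> V" using Vp(4) that \<open>x \<ominus>\<^bsub>F\<^esub> y \<in> V\<close> by blast
      then show "y \<ominus>\<^bsub>F\<^esub> z \<in> V" using F.M.minus_minus_cancel \<open>x \<in> carrier F\<close> \<open>y \<in> carrier F\<close> z by simp
    next
      assume "y \<ominus>\<^bsub>F\<^esub> z \<in> V"
      then have "(x \<ominus>\<^bsub>F\<^esub> y) \<oplus>\<^bsub>F\<^esub> (y \<ominus>\<^bsub>F\<^esub> z) \<in> V" using Vp(3) \<open>x \<ominus>\<^bsub>F\<^esub> y \<in> V\<close> by blast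
      moreover have "(x \<ominus>\<^bsub>F\<^esub> y) \<oplus>\<^bsub>F\<^esub> (y \<ominus>\<^bsub>F\<^esub> z) = x \<ominus>\<^bsub>F\<^esub> z"
        using \<open>x \<in> carrier F\<close> \<open>y \<in> carrier F\<close> z by (simp add: a_minus_def F.M.a_assoc F.M.r_neg1 F.M.r_neg2)
      ultimately show "x \<ominus>\<^bsub>F\<^esub> z \<in> V" by simp
    qed
    then have "(\<lambda>z. z \<in> carrier F \<and> x \<ominus>\<^bsub>F\<^esub> z \<in> V) = (\<lambda>z. z \<in> carrier F \<and> y \<ominus>\<^bsub>F\<^esub> z \<in> V)" by auto
    then show ?thesis unfolding \<pi>_def by simp
  qed
  have \<pi>_add: "\<pi> (\<pi> x \<oplus>\<^bsub>F\<^esub> \<pi> y) = \<pi> (x \<oplus>\<^bsub>F\<^esub> y)" if xy: "x \<in> carrier F" "y \<in> carrier F" for x y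
  proof (rule sym, rule \<pi>_eqI)
    have "(x \<oplus>\<^bsub>F\<^esub> y) \<ominus>\<^bsub>F\<^esub> (\<pi> x \<oplus>\<^bsub>F\<^esub> \<pi> y) = (x \<ominus>\<^bsub>F\<^esub> \<pi> x) \<oplus>\<^bsub>F\<^esub> (y \<ominus>\<^bsub>F\<^esub> \<pi> y)"
      using xy \<pi>(1) by (simp add: a_minus_def F.M.minus_add F.M.a_ac)
    then show "(x \<oplus>\<^bsub>F\<^esub> y) \<ominus>\<^bsub>F\<^esub> (\<pi> x \<oplus>\<^bsub>F\<^esub> \<pi> y) \<in> V" using Vp(3) \<pi>(2) xy by simp
  qed (use xy \<pi>(1) in auto)
  have \<pi>_smult: "\<pi> (r \<odot>\<^bsub>F\<^esub> \<pi> x) = \<pi> (r \<odot>\<^bsub>F\<^esub> x)" if x: "x \<in> carrier F" and r: "r \<in> carrier R" for x r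
  proof (rule sym, rule \<pi>_eqI)
    have "r \<odot>\<^bsub>F\<^esub> x \<ominus>\<^bsub>F\<^esub> r \<odot>\<^bsub>F\<^esub> \<pi> x = r \<odot>\<^bsub>F\<^esub> (x \<ominus>\<^bsub>F\<^esub> \<pi> x)"
      using x r \<pi>(1) by (simp add: a_minus_def F.smult_r_distr F.smult_r_minus)
    then show "r \<odot>\<^bsub>F\<^esub> x \<ominus>\<^bsub>F\<^esub> r \<odot>\<^bsub>F\<^esub> \<pi> x \<in> V" using Vp(5)[OF r \<pi>(2)[OF x]] by simp
  qed (use x r \<pi>(1) in auto)
  have \<pi>\<pi>: "\<pi> (\<pi> x) = \<pi> x" if "x \<in> carrier F" for x
    by (rule sym, rule \<pi>_eqI) (use that \<pi> in auto)
  define N :: "('a, 'n) module" where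
    "N = \<lparr>carrier = \<pi> ` carrier F, monoid.mult = (\<lambda>_ _. undefined), one = undefined,
       ring.zero = \<pi> \<zero>\<^bsub>F\<^esub>, add = (\<lambda>x y. \<pi> (x \<oplus>\<^bsub>F\<^esub> y)), smult = (\<lambda>r x. \<pi> (r \<odot>\<^bsub>F\<^esub> x))\<rparr>"
  have N [simp]: "carrier N = \<pi> ` carrier F" "\<zero>\<^bsub>N\<^esub> = \<pi> \<zero>\<^bsub>F\<^esub>" "x \<oplus>\<^bsub>N\<^esub> y = \<pi> (x \<oplus>\<^bsub>F\<^esub> y)"
    "r \<odot>\<^bsub>N\<^esub> x = \<pi> (r \<odot>\<^bsub>F\<^esub> x)" for x y r by (simp_all add: N_def)
  have 1: "\<pi> (\<pi> x \<oplus>\<^bsub>F\<^esub> y) = \<pi> (x \<oplus>\<^bsub>F\<^esub> y)" "\<pi> (y \<oplus>\<^bsub>F\<^esub> \<pi> x) = \<pi> (y \<oplus>\<^bsub>F\<^esub> x)"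
    if "x \<in> carrier F" "y \<in> carrier F" for x y
    using \<pi>_add[of "\<pi> x" y] \<pi>_add[of x y] \<pi>_add[of y "\<pi> x"] \<pi>_add[of y x] that \<pi>(1) by (simp_all add: \<pi>\<pi>)
  have ag: "abelian_group N"
  proof (rule abelian_groupI)
    fix a assume "a \<in> carrier N"
    then obtain x where x: "x \<in> carrier F" "a = \<pi> x" by auto
    show "\<exists>b\<in>carrier N. b \<oplus>\<^bsub>N\<^esub> a = \<zero>\<^bsub>N\<^esub>"
      using x by (intro bexI[of _ "\<pi> (\<ominus>\<^bsub>F\<^esub> x)"]) (auto simp: \<pi>_add F.M.l_neg)
  next
    fix a b c assume "a \<in> carrier N" "b \<in> carrier N" "c \<in> carrier N"
    then obtain x y z where "x \<in> carrier F" "y \<in> carrier F" "z \<in> carrier F" "a = \<pi> x" "b = \<pi> y" "c = \<pi> z"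
      by auto
    then show "a \<oplus>\<^bsub>N\<^esub> b \<oplus>\<^bsub>N\<^esub> c = a \<oplus>\<^bsub>N\<^esub> (b \<oplus>\<^bsub>N\<^esub> c)"
      by (simp add: \<pi>_add F.M.a_assoc)
  next
    fix a b assume "a \<in> carrier N" "b \<in> carrier N"
    then obtain x y where "x \<in> carrier F" "y \<in> carrier F" "a = \<pi> x" "b = \<pi> y" by auto
    then show "a \<oplus>\<^bsub>N\<^esub> b = b \<oplus>\<^bsub>N\<^esub> a" by (simp add: \<pi>_add F.M.a_comm)
  qed (auto simp: 1 \<pi>(1) \<pi>\<pi>)
  have add: "\<pi> x \<oplus>\<^bsub>N\<^esub> \<pi> y = \<pi> (x \<oplus>\<^bsub>F\<^esub> y)" if "x \<in> carrier F" "y \<in> carrier F" for x y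
    using that by (simp add: \<pi>_add)
  have smult: "r \<odot>\<^bsub>N\<^esub> \<pi> x = \<pi> (r \<odot>\<^bsub>F\<^esub> x)" if "r \<in> carrier R" "x \<in> carrier F" for r x
    using that by (simp add: \<pi>_smult)
  have elem: "\<exists>x\<in>carrier F. a = \<pi> x" if "a \<in> carrier N" for a using that by auto
  have "module R N"
  proof (rule moduleI[OF F.is_cring ag])
    fix r a assume "r \<in> carrier R" "a \<in> carrier N"
    then show "r \<odot>\<^bsub>N\<^esub> a \<in> carrier N" using elem[of a] smult by (auto simp del: N(4))
  next
    fix r s a assume "r \<in> carrier R" "s \<in> carrier R" "a \<in> carrier N"
    then show "(r \<oplus>\<^bsub>R\<^esub> s) \<odot>\<^bsub>N\<^esub> a = r \<odot>\<^bsub>N\<^esub> a \<oplus>\<^bsub>N\<^esub> s \<odot>\<^bsub>N\<^esub> a"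
      using elem[of a] by (auto simp: smult add F.smult_l_distr simp del: N)
  next
    fix r a b assume "r \<in> carrier R" "a \<in> carrier N" "b \<in> carrier N"
    then show "r \<odot>\<^bsub>N\<^esub> (a \<oplus>\<^bsub>N\<^esub> b) = r \<odot>\<^bsub>N\<^esub> a \<oplus>\<^bsub>N\<^esub> r \<odot>\<^bsub>N\<^esub> b"
      using elem[of a] elem[of b] by (auto simp: smult add F.smult_r_distr simp del: N)
  next
    fix r s a assume "r \<in> carrier R" "s \<in> carrier R" "a \<in> carrier N"
    then show "(r \<otimes>\<^bsub>R\<^esub> s) \<odot>\<^bsub>N\<^esub> a = r \<odot>\<^bsub>N\<^esub> (s \<odot>\<^bsub>N\<^esub> a)"
      using elem[of a] by (auto simp: smult F.smult_assoc1 simp del: N)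
  next
    fix a assume "a \<in> carrier N"
    then show "\<one>\<^bsub>R\<^esub> \<odot>\<^bsub>N\<^esub> a = a" using elem[of a] by (auto simp: smult simp del: N)
  qed
  moreover have "\<pi> \<in> Hom_module R F N"
    by (rule Hom_moduleI) (auto simp: \<pi>_add \<pi>_smult)
  moreover have "\<pi> x = \<zero>\<^bsub>N\<^esub> \<longleftrightarrow> x \<in> V" if x: "x \<in> carrier F" for x
  proof
    assume "\<pi> x = \<zero>\<^bsub>N\<^esub>"
    then have eq: "\<pi> x = \<pi> \<zero>\<^bsub>F\<^esub>" by simp
    have "x = (x \<ominus>\<^bsub>F\<^esub> \<pi> x) \<ominus>\<^bsub>F\<^esub> (\<zero>\<^bsub>F\<^esub> \<ominus>\<^bsub>F\<^esub> \<pi> \<zero>\<^bsub>F\<^esub>)"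
      using x \<pi>(1) unfolding eq by (simp add: a_minus_def F.M.a_assoc F.M.l_neg)
    then show "x \<in> V" using Vp(4)[OF \<pi>(2)[OF x] \<pi>(2)[OF F.M.zero_closed]] by simp
  next
    assume "x \<in> V"
    then have "x \<ominus>\<^bsub>F\<^esub> \<zero>\<^bsub>F\<^esub> \<in> V" using Vp(4)[OF _ Vp(2)] by blast
    then show "\<pi> x = \<zero>\<^bsub>N\<^esub>" using \<pi>_eqI[OF x] by simp
  qed
  ultimately show ?thesis by blast
qed

text \<open>Since only the coordinates in \<open>A\<close> are compared, this is finite generation of submodules of a free
  module of finite rank. The induction on \<open>A\<close> splits off the ideal of values in one coordinate.\<close>

lemma (in noetherian_cring) fun_submodule_finitely_generated:
  fixes K :: "('i \<Rightarrow> 'a) set"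
  assumes A: "finite A" and K: "submodule K R (fun_module R)"
  shows "\<exists>G. finite G \<and> G \<subseteq> K \<and> (\<forall>H. submodule H R (fun_module R) \<longrightarrow> G \<subseteq> H \<longrightarrow>
    (\<forall>f\<in>K. \<exists>h\<in>H. \<forall>x\<in>A. f x = h x))"
  using A K
proof (induction A arbitrary: K)
  case empty
  interpret F: module R "fun_module R" by (rule module_fun_module[OF is_cring])
  show ?case by (rule exI[of _ "{}"]) (auto dest: F.submodule_props(2))
next
  case (insert a A)
  have mF: "module R (fun_module R :: ('a, 'i \<Rightarrow> 'a) module)" by (rule module_fun_module[OF is_cring])
  interpret F: module R "fun_module R :: ('a, 'i \<Rightarrow> 'a) module" by (rule mF)
  have RM: "module R (ring_module R)" by (rule module_ring_module[OF is_cring])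
  note Kp = F.submodule_props[OF insert.prems]
  have ideal_ev: "ideal ((\<lambda>f. f a) ` H) R" if "submodule H R (fun_module R)" for H :: "('i \<Rightarrow> 'a) set"
    using submodule_Hom_image[OF mF RM that Hom_evaluation] submodule_ring_module_iff[OF is_cring] by blast
  have minus: "(f \<ominus>\<^bsub>fun_module R\<^esub> h) i = f i \<ominus> h i" if "f \<in> K" "h \<in> K" for f h i
    using Hom_module_minus[OF mF RM Hom_evaluation, of f h i] that Kp(1)
    by (simp add: minus_ring_module[OF is_cring] subset_iff)
  define K0 where "K0 = {f \<in> K. f a = \<zero>}"
  have "submodule K0 R (fun_module R)"
    by (rule F.submodule_criterion) (use Kp(1,2) Kp(3) Kp(5) in \<open>auto simp: K0_def\<close>)
  from insert.IH[OF this] obtain G where G: "finite G" "G \<subseteq> K0"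
    "\<forall>H. submodule H R (fun_module R) \<longrightarrow> G \<subseteq> H \<longrightarrow> (\<forall>f\<in>K0. \<exists>h\<in>H. \<forall>x\<in>A. f x = h x)"
    by (elim exE conjE)
  obtain B where B: "B \<subseteq> carrier R" "finite B" "(\<lambda>f. f a) ` K = Idl B"
    using finetely_gen[OF ideal_ev[OF insert.prems]] by blast
  have "B \<subseteq> (\<lambda>f. f a) ` K" using genideal_self[OF B(1)] B(3) by simp
  then obtain C where C: "finite C" "C \<subseteq> K" "B = (\<lambda>f. f a) ` C" using B(2) finite_subset_image by metis
  have "\<exists>h\<in>H. \<forall>x\<in>insert a A. f x = h x"
    if H: "submodule H R (fun_module R)" "G \<union> C \<subseteq> H" and f: "f \<in> K" for H f
  proof -
    note Hp = F.submodule_props[OF H(1)]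
    define H' where "H' = H \<inter> K"
    have H': "submodule H' R (fun_module R)"
      by (rule F.submodule_criterion) (use Hp(1-3,5) Kp(2,3,5) in \<open>auto simp: H'_def\<close>)
    have "B \<subseteq> (\<lambda>f. f a) ` H'" unfolding C(3) H'_def using C(2) H(2) by blast
    then have "Idl B \<subseteq> (\<lambda>f. f a) ` H'" by (rule genideal_minimal[OF ideal_ev[OF H']])
    moreover have "f a \<in> Idl B" using f B(3) by blast
    ultimately obtain h where h: "h \<in> H" "h \<in> K" "f a = h a" by (auto simp: H'_def)
    have fc: "f i \<in> carrier R" "h i \<in> carrier R" for i using f h Kp(1) by auto
    define k where "k = f \<ominus>\<^bsub>fun_module R\<^esub> h"
    have k: "k \<in> K" "k i = f i \<ominus> h i" for i using Kp(4)[OF f h(2)] minus[OF f h(2)] by (simp_all add: k_def)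
    then have k0: "k \<in> K0" using h(3) fc by (simp add: K0_def)
    define H0 where "H0 = {h \<in> H. h a = \<zero>}"
    have "submodule H0 R (fun_module R)"
      by (rule F.submodule_criterion) (use Hp(1,2) Hp(3) Hp(5) in \<open>auto simp: H0_def\<close>)
    moreover have "G \<subseteq> H0" using G(2) H(2) by (auto simp: H0_def K0_def)
    ultimately have "\<exists>h\<in>H0. \<forall>x\<in>A. k x = h x" using G(3) k0 by simp
    then obtain l where l: "l \<in> H0" "\<forall>x\<in>A. k x = l x" by (elim bexE)
    then have kl: "k x = l x" if "x \<in> insert a A" for x using that k0 by (auto simp: H0_def K0_def)
    have "f x = l x \<oplus> h x" if x: "x \<in> insert a A" for x
      unfolding kl[OF x, symmetric] k(2) using fc[of x] by (simp add: a_minus_def a_assoc l_neg)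
    moreover have "l \<in> H" using l(1) by (simp add: H0_def)
    ultimately show ?thesis using Hp(3)[OF _ h(1), of l] by (intro bexI[of _ "\<lambda>i. l i \<oplus> h i"]) simp_all
  qed
  moreover have "finite (G \<union> C)" "G \<union> C \<subseteq> K" using G(1,2) C(1,2) by (auto simp: K0_def)
  ultimately show ?case by (intro exI[of _ "G \<union> C"] conjI allI impI ballI)
qed

definition syzygies :: "'a ring \<Rightarrow> ('a, 'n) module \<Rightarrow> 'n set \<Rightarrow> ('n \<Rightarrow> 'a) set" where
  "syzygies R N A = {s \<in> carrier (fun_module R). lincomb N A (\<lambda>x. x) s = \<zero>\<^bsub>N\<^esub>}"

text \<open>The functional sends the linear combination of generators with coefficients \<open>s\<close> to the sum of the
  \<open>s x \<cdot> v x\<close>. This depends only on the combination because \<open>v\<close>, being orthogonal to the generators \<open>G\<close> of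
  the relations, is orthogonal to all relations.\<close>

lemma functional_from_syzygies:
  fixes N :: "('a, 'n) module"
  assumes R: "cring R" and N: "module R N" and A: "finite A" "generating_set R N A"
    and G: "\<And>H f. submodule H R (fun_module R) \<Longrightarrow> G \<subseteq> H \<Longrightarrow> f \<in> syzygies R N A \<Longrightarrow> \<exists>h\<in>H. \<forall>x\<in>A. f x = h x"
      "G \<subseteq> syzygies R N A"
    and v: "\<And>x. v x \<in> carrier R" "\<And>g. g \<in> G \<Longrightarrow> lincomb (ring_module R) A g v = \<zero>\<^bsub>R\<^esub>"
    and d: "d \<in> A"
  shows "\<exists>\<phi>\<in>Hom_module R N (ring_module R). \<phi> d = v d"
proof -
  interpret cring R by fact
  interpret N: module R N by fact
  have RM: "module R (ring_module R)" by (rule module_ring_module[OF R])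
  interpret RM: module R "ring_module R" by (rule RM)
  have mF: "module R (fun_module R :: ('a, 'n \<Rightarrow> 'a) module)" by (rule module_fun_module[OF R])
  interpret F: module R "fun_module R :: ('a, 'n \<Rightarrow> 'a) module" by (rule mF)
  have AN: "A \<subseteq> carrier N" "\<And>x. x \<in> A \<Longrightarrow> x \<in> carrier N" using A(2) by (auto simp: generating_set_def)
  have vM: "\<And>x. x \<in> A \<Longrightarrow> v x \<in> carrier (ring_module R)" using v(1) by simp
  let ?n = "lincomb N A (\<lambda>x. x)" and ?v = "lincomb (ring_module R) A v"
  have n_hom: "?n \<in> Hom_module R (fun_module R) N" by (rule Hom_lincomb[OF N AN(2) A(1)])
  have v_hom: "?v \<in> Hom_module R (fun_module R) (ring_module R)" by (rule Hom_lincomb[OF RM vM A(1)])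
  note nh = Hom_moduleD[OF n_hom] and vh = Hom_moduleD[OF v_hom]
  let ?H = "{s \<in> carrier (fun_module R). ?v s = \<zero>\<^bsub>ring_module R\<^esub>}"
  have H: "submodule ?H R (fun_module R)" by (rule submodule_Hom_kernel[OF mF RM v_hom])
  have GH: "G \<subseteq> ?H"
  proof
    fix g assume g: "g \<in> G"
    then have gc: "g \<in> carrier (fun_module R)" using G(2) by (auto simp: syzygies_def)
    then have "?v g = lincomb (ring_module R) A g v" using v(1) by (intro lincomb_ring_commute[OF R]) auto
    then show "g \<in> ?H" using v(2)[OF g] gc by simp
  qed
  have kill: "?v s = \<zero>\<^bsub>R\<^esub>" if s: "s \<in> syzygies R N A" for s
  proof -
    obtain h where h: "h \<in> ?H" "\<forall>x\<in>A. s x = h x" using G(1)[OF H GH s] by blast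
    have "?v s = ?v h" by (rule lincomb_cong[OF RM vM]) (use h in auto)
    then show ?thesis using h(1) by simp
  qed
  define rel where "rel n w \<longleftrightarrow> (\<exists>s\<in>carrier (fun_module R). n = ?n s \<and> w = ?v s)" for n w
  have "\<exists>\<phi>\<in>Hom_module R N (ring_module R). \<forall>n\<in>carrier N. rel n (\<phi> n)"
  proof (rule Hom_module_of_relation[OF _ _ N])
    show "\<exists>w. rel n w" if "n \<in> carrier N" for n
      using that generating_set_iff_lincomb[OF N A(1) AN(1)] A(2) unfolding rel_def by blast
    show "w \<in> carrier (ring_module R)" if "rel n w" for n w using that vh(1) by (auto simp: rel_def)
  next
    fix n w w' assume "rel n w" "rel n w'"
    then obtain s s' where s: "s \<in> carrier (fun_module R)" "s' \<in> carrier (fun_module R)" "?n s = ?n s'" "w = ?v s" "w' = ?v s'"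
      by (auto simp: rel_def)
    have "?n (s \<ominus>\<^bsub>fun_module R\<^esub> s') = \<zero>\<^bsub>N\<^esub>"
      unfolding Hom_module_minus[OF mF N n_hom s(1,2)] s(3) using nh(1)[OF s(2)] by (simp add: a_minus_def N.M.r_neg)
    then have "s \<ominus>\<^bsub>fun_module R\<^esub> s' \<in> syzygies R N A"
      using F.M.minus_closed[OF s(1,2)] by (simp add: syzygies_def)
    then have "?v s \<ominus>\<^bsub>ring_module R\<^esub> ?v s' = \<zero>\<^bsub>ring_module R\<^esub>"
      using kill Hom_module_minus[OF mF RM v_hom s(1,2)] by simp
    then show "w = w'" unfolding s(4,5) by (rule RM.M.minus_eq_zero_imp_eq[OF _ vh(1)[OF s(1)] vh(1)[OF s(2)]])
  next
    fix n n' w w' assume "rel n w" "rel n' w'"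
    then obtain s s' where s: "s \<in> carrier (fun_module R)" "s' \<in> carrier (fun_module R)"
      "n = ?n s" "n' = ?n s'" "w = ?v s" "w' = ?v s'" by (auto simp: rel_def)
    then show "rel (n \<oplus>\<^bsub>N\<^esub> n') (w \<oplus>\<^bsub>ring_module R\<^esub> w')"
      unfolding rel_def using nh(2)[OF s(1,2)] vh(2)[OF s(1,2)] F.M.a_closed[OF s(1,2)] by metis
  next
    fix r n w assume r: "r \<in> carrier R" and "rel n w"
    then obtain s where s: "s \<in> carrier (fun_module R)" "n = ?n s" "w = ?v s" by (auto simp: rel_def)
    then show "rel (r \<odot>\<^bsub>N\<^esub> n) (r \<odot>\<^bsub>ring_module R\<^esub> w)"
      unfolding rel_def using nh(3)[OF r s(1)] vh(3)[OF r s(1)] F.smult_closed[OF r s(1)] by metis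
  qed
  then obtain \<phi> where \<phi>: "\<phi> \<in> Hom_module R N (ring_module R)" "\<forall>n\<in>carrier N. rel n (\<phi> n)" ..
  obtain s where s: "s \<in> carrier (fun_module R)" "d = ?n s" "\<phi> d = ?v s"
    using \<phi>(2) AN(2)[OF d] by (auto simp: rel_def)
  let ?e = "\<lambda>x. if x = d then \<one>\<^bsub>R\<^esub> else \<zero>\<^bsub>R\<^esub>"
  have e: "?e \<in> carrier (fun_module R)" by simp
  have "?n ?e = d" by (rule lincomb_unit[OF N AN(2) A(1) d])
  then have "?n (s \<ominus>\<^bsub>fun_module R\<^esub> ?e) = \<zero>\<^bsub>N\<^esub>"
    unfolding Hom_module_minus[OF mF N n_hom s(1) e] using s(2) AN(2)[OF d] by (simp add: a_minus_def N.M.r_neg)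
  then have "s \<ominus>\<^bsub>fun_module R\<^esub> ?e \<in> syzygies R N A"
    using F.M.minus_closed[OF s(1) e] by (simp add: syzygies_def)
  then have "?v s \<ominus>\<^bsub>ring_module R\<^esub> ?v ?e = \<zero>\<^bsub>ring_module R\<^esub>"
    using kill Hom_module_minus[OF mF RM v_hom s(1) e] by simp
  then have "?v s = ?v ?e" by (rule RM.M.minus_eq_zero_imp_eq[OF _ vh(1)[OF s(1)] vh(1)[OF e]])
  moreover have "?v ?e = v d" by (rule lincomb_unit[OF RM vM A(1) d])
  ultimately show ?thesis using \<phi>(1) s(3) by auto
qed


section \<open>Vanishing of tensors\<close>

lemma bilinear_map_kills_tensor_kernel:
  fixes M :: "('a, 'm) module" and N :: "('a, 'n) module" and T :: "('a, 't) module"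
  assumes M: "module R M" and N: "module R N" and T: "module R T"
    and \<beta>: "\<And>x y. x \<in> carrier M \<Longrightarrow> y \<in> carrier N \<Longrightarrow> \<beta> x y \<in> carrier T"
      "\<And>x x' y. x \<in> carrier M \<Longrightarrow> x' \<in> carrier M \<Longrightarrow> y \<in> carrier N \<Longrightarrow> \<beta> (x \<oplus>\<^bsub>M\<^esub> x') y = \<beta> x y \<oplus>\<^bsub>T\<^esub> \<beta> x' y"
      "\<And>x y y'. x \<in> carrier M \<Longrightarrow> y \<in> carrier N \<Longrightarrow> y' \<in> carrier N \<Longrightarrow> \<beta> x (y \<oplus>\<^bsub>N\<^esub> y') = \<beta> x y \<oplus>\<^bsub>T\<^esub> \<beta> x y'"
      "\<And>r x y. r \<in> carrier R \<Longrightarrow> x \<in> carrier M \<Longrightarrow> y \<in> carrier N \<Longrightarrow> \<beta> (r \<odot>\<^bsub>M\<^esub> x) y = \<beta> x (r \<odot>\<^bsub>N\<^esub> y)"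
    and x: "x \<in> carrier M" and y: "y \<in> carrier N" and k: "frag_of (x, y) \<in> tensor_kernel R M N"
  shows "\<beta> x y = \<zero>\<^bsub>T\<^esub>"
proof -
  interpret M: module R M by fact
  interpret N: module R N by fact
  interpret T: module R T by fact
  let ?S = "carrier M \<times> carrier N"
  have gT: "group (add_monoid T)" by (rule comm_group.axioms(2)[OF T.a_comm_group])
  have "(\<lambda>(x, y). \<beta> x y) ` ?S \<subseteq> carrier (add_monoid T)" using \<beta>(1) by auto
  then obtain h where h: "h \<in> hom (free_Abelian_group ?S) (add_monoid T)"
    "\<And>s. s \<in> ?S \<Longrightarrow> h (frag_of s) = (\<lambda>(x, y). \<beta> x y) s"
    by (rule comm_group.free_Abelian_group_universal[OF T.a_comm_group]) blast
  interpret h: group_hom "free_Abelian_group ?S" "add_monoid T" h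
    by (rule group_hom.intro) (simp_all add: group_hom_axioms_def h gT)
  have hdiff: "h (u - v) = h u \<ominus>\<^bsub>T\<^esub> h v"
    if "u \<in> carrier (free_Abelian_group ?S)" "v \<in> carrier (free_Abelian_group ?S)" for u v
  proof -
    have "u - v = u \<otimes>\<^bsub>free_Abelian_group ?S\<^esub> inv\<^bsub>free_Abelian_group ?S\<^esub> v" using that by simp
    then have "h (u - v) = h u \<otimes>\<^bsub>add_monoid T\<^esub> inv\<^bsub>add_monoid T\<^esub> h v"
      using that h.hom_mult[of u "inv\<^bsub>free_Abelian_group ?S\<^esub> v"] h.hom_inv[of v] h.G.inv_closed[of v] by metis
    then show ?thesis by (simp add: a_minus_def a_inv_def)
  qed
  have diffc: "u - v \<in> carrier (free_Abelian_group ?S)"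
    if "u \<in> carrier (free_Abelian_group ?S)" "v \<in> carrier (free_Abelian_group ?S)" for u v
    using that keys_diff[of u v] by (auto dest: subsetD)
  have hf: "h (frag_of (x, y)) = \<beta> x y" "frag_of (x, y) \<in> carrier (free_Abelian_group ?S)"
    if "x \<in> carrier M" "y \<in> carrier N" for x y using h(2) that by auto
  have "tensor_relations R M N \<subseteq> kernel (free_Abelian_group ?S) (add_monoid T) h"
  proof
    fix u assume u: "u \<in> tensor_relations R M N"
    have "h u = \<zero>\<^bsub>T\<^esub>"
      using u unfolding tensor_relations_def
    proof (elim UnE CollectE exE conjE)
      fix a a' b assume *: "u = frag_of (a \<oplus>\<^bsub>M\<^esub> a', b) - frag_of (a, b) - frag_of (a', b)"
        "a \<in> carrier M" "a' \<in> carrier M" "b \<in> carrier N"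
      then show ?thesis
        using \<beta>(1) by (simp only: hdiff diffc hf M.a_closed \<beta>(2)) (simp add: a_minus_def T.M.a_ac T.M.r_neg T.M.r_neg1 T.M.r_neg2)
    next
      fix a b b' assume *: "u = frag_of (a, b \<oplus>\<^bsub>N\<^esub> b') - frag_of (a, b) - frag_of (a, b')"
        "a \<in> carrier M" "b \<in> carrier N" "b' \<in> carrier N"
      then show ?thesis
        using \<beta>(1) by (simp only: hdiff diffc hf N.a_closed \<beta>(3)) (simp add: a_minus_def T.M.a_ac T.M.r_neg T.M.r_neg1 T.M.r_neg2)
    next
      fix r a b assume *: "u = frag_of (r \<odot>\<^bsub>M\<^esub> a, b) - frag_of (a, r \<odot>\<^bsub>N\<^esub> b)"
        "r \<in> carrier R" "a \<in> carrier M" "b \<in> carrier N"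
      then show ?thesis
        using \<beta>(1) by (simp only: hdiff diffc hf N.smult_closed M.smult_closed \<beta>(4)) (simp add: a_minus_def T.M.r_neg)
    qed
    then show "u \<in> kernel (free_Abelian_group ?S) (add_monoid T) h"
      using subsetD[OF tensor_relations_carrier[OF M.a_closed M.smult_closed N] u] by (simp add: kernel_def)
  qed
  then have "tensor_kernel R M N \<subseteq> kernel (free_Abelian_group ?S) (add_monoid T) h"
    unfolding tensor_kernel_def by (rule h.G.generate_subgroup_incl[OF _ h.subgroup_kernel])
  then have "h (frag_of (x, y)) = \<zero>\<^bsub>T\<^esub>" using k by (auto simp: kernel_def)
  then show ?thesis using hf(1)[OF x y] by simp
qed

context
  fixes R :: "'a ring" and M :: "('a, 'm) module" and N :: "('a, 'n) module"
  assumes M: "module R M" and N: "module R N"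
begin

interpretation M: module R M by (rule M)
interpretation N: module R N by (rule N)

lemma tensor_kernel_relations:
  "x \<in> carrier M \<Longrightarrow> x' \<in> carrier M \<Longrightarrow> y \<in> carrier N \<Longrightarrow>
    frag_of (x \<oplus>\<^bsub>M\<^esub> x', y) - frag_of (x, y) - frag_of (x', y) \<in> tensor_kernel R M N"
  "x \<in> carrier M \<Longrightarrow> y \<in> carrier N \<Longrightarrow> y' \<in> carrier N \<Longrightarrow>
    frag_of (x, y \<oplus>\<^bsub>N\<^esub> y') - frag_of (x, y) - frag_of (x, y') \<in> tensor_kernel R M N"
  "r \<in> carrier R \<Longrightarrow> x \<in> carrier M \<Longrightarrow> y \<in> carrier N \<Longrightarrow>
    frag_of (r \<odot>\<^bsub>M\<^esub> x, y) - frag_of (x, r \<odot>\<^bsub>N\<^esub> y) \<in> tensor_kernel R M N"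
  unfolding tensor_kernel_def tensor_relations_def by (rule generate.incl, blast)+

lemma tensor_kernel_add: "u \<in> tensor_kernel R M N \<Longrightarrow> v \<in> tensor_kernel R M N \<Longrightarrow> u + v \<in> tensor_kernel R M N"
  unfolding tensor_kernel_def using generate.eng by fastforce

lemma tensor_kernel_0: "0 \<in> tensor_kernel R M N"
  unfolding tensor_kernel_def
  using generate.one[of "free_Abelian_group (carrier M \<times> carrier N)" "tensor_relations R M N"] by simp

lemma tensor_kernel_uminus:
  assumes "u \<in> tensor_kernel R M N" shows "- u \<in> tensor_kernel R M N"
proof -
  let ?F = "free_Abelian_group (carrier M \<times> carrier N)"
  interpret F: group ?F by simp
  have rc: "tensor_relations R M N \<subseteq> carrier ?F"
    by (rule tensor_relations_carrier[OF M.a_closed M.smult_closed N])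
  have sg: "subgroup (tensor_kernel R M N) ?F"
    unfolding tensor_kernel_def by (rule F.generate_is_subgroup[OF rc])
  have "u \<in> carrier ?F" using subgroup.subset[OF sg] assms by blast
  then show ?thesis using subgroup.m_inv_closed[OF sg assms] by simp
qed

lemma tensor_kernel_diff: "u \<in> tensor_kernel R M N \<Longrightarrow> v \<in> tensor_kernel R M N \<Longrightarrow> u - v \<in> tensor_kernel R M N"
  using tensor_kernel_add[OF _ tensor_kernel_uminus] by fastforce

lemma tensor_kernel_sum: "(\<And>i. i \<in> I \<Longrightarrow> f i \<in> tensor_kernel R M N) \<Longrightarrow> sum f I \<in> tensor_kernel R M N"
  by (induction I rule: infinite_finite_induct) (auto intro: tensor_kernel_0 tensor_kernel_add)

lemma tensor_kernel_zero_left: "y \<in> carrier N \<Longrightarrow> frag_of (\<zero>\<^bsub>M\<^esub>, y) \<in> tensor_kernel R M N"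
  using tensor_kernel_uminus[OF tensor_kernel_relations(1)[of "\<zero>\<^bsub>M\<^esub>" "\<zero>\<^bsub>M\<^esub>" y]] by simp

lemma tensor_kernel_zero_right: "x \<in> carrier M \<Longrightarrow> frag_of (x, \<zero>\<^bsub>N\<^esub>) \<in> tensor_kernel R M N"
  using tensor_kernel_uminus[OF tensor_kernel_relations(2)[of x "\<zero>\<^bsub>N\<^esub>" "\<zero>\<^bsub>N\<^esub>"]] by simp

lemma tensor_kernel_finsum_left:
  assumes "finite I" "\<And>i. i \<in> I \<Longrightarrow> x i \<in> carrier M" "y \<in> carrier N"
  shows "frag_of (\<Oplus>\<^bsub>M\<^esub>i\<in>I. x i, y) - (\<Sum>i\<in>I. frag_of (x i, y)) \<in> tensor_kernel R M N"
  using assms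
proof (induction I)
  case empty
  then show ?case using tensor_kernel_zero_left by simp
next
  case (insert i I)
  have c: "(\<Oplus>\<^bsub>M\<^esub>i\<in>I. x i) \<in> carrier M" using insert by (intro M.finsum_closed) auto
  have s: "(\<Oplus>\<^bsub>M\<^esub>i\<in>insert i I. x i) = x i \<oplus>\<^bsub>M\<^esub> (\<Oplus>\<^bsub>M\<^esub>i\<in>I. x i)"
    using insert by (intro M.finsum_insert) auto
  have "frag_of (x i \<oplus>\<^bsub>M\<^esub> (\<Oplus>\<^bsub>M\<^esub>i\<in>I. x i), y) - frag_of (x i, y) - frag_of (\<Oplus>\<^bsub>M\<^esub>i\<in>I. x i, y) \<in> tensor_kernel R M N"
    using insert c by (intro tensor_kernel_relations) auto
  from tensor_kernel_add[OF this insert.IH] show ?case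
    unfolding s using insert by (simp add: algebra_simps)
qed

lemma tensor_kernel_finsum_right:
  assumes "finite I" "\<And>i. i \<in> I \<Longrightarrow> y i \<in> carrier N" "x \<in> carrier M"
  shows "frag_of (x, \<Oplus>\<^bsub>N\<^esub>i\<in>I. y i) - (\<Sum>i\<in>I. frag_of (x, y i)) \<in> tensor_kernel R M N"
  using assms
proof (induction I)
  case empty
  then show ?case using tensor_kernel_zero_right by simp
next
  case (insert i I)
  have c: "(\<Oplus>\<^bsub>N\<^esub>i\<in>I. y i) \<in> carrier N" using insert by (intro N.finsum_closed) auto
  have s: "(\<Oplus>\<^bsub>N\<^esub>i\<in>insert i I. y i) = y i \<oplus>\<^bsub>N\<^esub> (\<Oplus>\<^bsub>N\<^esub>i\<in>I. y i)"
    using insert by (intro N.finsum_insert) auto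
  have "frag_of (x, y i \<oplus>\<^bsub>N\<^esub> (\<Oplus>\<^bsub>N\<^esub>i\<in>I. y i)) - frag_of (x, y i) - frag_of (x, \<Oplus>\<^bsub>N\<^esub>i\<in>I. y i) \<in> tensor_kernel R M N"
    using insert c by (intro tensor_kernel_relations) auto
  from tensor_kernel_add[OF this insert.IH] show ?case
    unfolding s using insert by (simp add: algebra_simps)
qed

text \<open>The sum of all \<open>x \<otimes> w x\<close> regroups as the sum over \<open>g\<close> of \<open>(\<Sum>x. g x \<cdot> x) \<otimes> y g\<close>, which is zero because
  each \<open>g\<close> is a syzygy; and all its terms except \<open>d \<otimes> w d\<close> vanish. By the equational criterion every
  vanishing tensor \<open>d \<otimes> z\<close> arises in this way, so the modules with such an element \<open>z\<close> have a universal
  one among them.\<close>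

lemma tensor_vanishes_by_syzygies:
  assumes A: "finite A" "A \<subseteq> carrier M" and G: "finite G" "G \<subseteq> syzygies R M A"
    and y: "\<And>g. g \<in> G \<Longrightarrow> y g \<in> carrier N"
    and w: "\<And>x. x \<in> A \<Longrightarrow> w x = lincomb N G y (\<lambda>g. g x)" "\<And>x. x \<in> A \<Longrightarrow> x \<noteq> d \<Longrightarrow> w x = \<zero>\<^bsub>N\<^esub>"
    and d: "d \<in> A"
  shows "frag_of (d, w d) \<in> tensor_kernel R M N"
proof -
  have gc: "g x \<in> carrier R" if "g \<in> G" for g x using G(2) that by (auto simp: syzygies_def)
  have xc: "x \<in> carrier M" if "x \<in> A" for x using A(2) that by blast
  have gx: "g x \<odot>\<^bsub>M\<^esub> x \<in> carrier M" "g x \<odot>\<^bsub>N\<^esub> y g \<in> carrier N" if "g \<in> G" "x \<in> A" for g x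
    using gc xc y that by auto
  have 1: "(\<Sum>x\<in>A. frag_of (x, w x) - (\<Sum>g\<in>G. frag_of (x, g x \<odot>\<^bsub>N\<^esub> y g))) \<in> tensor_kernel R M N"
    by (rule tensor_kernel_sum) (simp add: w(1) lincomb_def tensor_kernel_finsum_right[OF G(1)] gx xc)
  have 2: "(\<Sum>x\<in>A. \<Sum>g\<in>G. frag_of (g x \<odot>\<^bsub>M\<^esub> x, y g) - frag_of (x, g x \<odot>\<^bsub>N\<^esub> y g)) \<in> tensor_kernel R M N"
    by (intro tensor_kernel_sum tensor_kernel_relations(3)) (auto simp: gc xc y)
  have 3: "(\<Sum>g\<in>G. \<Sum>x\<in>A. frag_of (g x \<odot>\<^bsub>M\<^esub> x, y g)) \<in> tensor_kernel R M N"
  proof (rule tensor_kernel_sum)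
    fix g assume g: "g \<in> G"
    have "(\<Oplus>\<^bsub>M\<^esub>x\<in>A. g x \<odot>\<^bsub>M\<^esub> x) = \<zero>\<^bsub>M\<^esub>" using G(2) g by (auto simp: syzygies_def lincomb_def)
    then have "frag_of (\<zero>\<^bsub>M\<^esub>, y g) - (\<Sum>x\<in>A. frag_of (g x \<odot>\<^bsub>M\<^esub> x, y g)) \<in> tensor_kernel R M N"
      using tensor_kernel_finsum_left[OF A(1), of "\<lambda>x. g x \<odot>\<^bsub>M\<^esub> x" "y g"] gx g y by simp
    from tensor_kernel_diff[OF tensor_kernel_zero_left[OF y[OF g]] this]
    show "(\<Sum>x\<in>A. frag_of (g x \<odot>\<^bsub>M\<^esub> x, y g)) \<in> tensor_kernel R M N" by simp
  qed
  have "(\<Sum>x\<in>A. \<Sum>g\<in>G. frag_of (g x \<odot>\<^bsub>M\<^esub> x, y g)) \<in> tensor_kernel R M N"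
    using 3 by (subst sum.swap)
  from tensor_kernel_add[OF 1 tensor_kernel_diff[OF this 2]]
  have 4: "(\<Sum>x\<in>A. frag_of (x, w x)) \<in> tensor_kernel R M N"
    by (simp add: sum_subtractf)
  have 5: "(\<Sum>x\<in>A - {d}. frag_of (x, w x)) \<in> tensor_kernel R M N"
    by (rule tensor_kernel_sum) (auto simp: w(2) xc tensor_kernel_zero_right)
  show ?thesis
    using tensor_kernel_diff[OF 4 5] by (simp add: sum.remove[OF A(1) d])
qed

end

section \<open>The big test ideal as a tight interior\<close>

text \<open>A linear \<open>g : \<^sup>eR \<rightarrow> R\<close> induces \<open>\<^sup>eR \<otimes> N \<rightarrow> N\<close>, and \<open>\<^sup>ec \<otimes> z\<close> goes to \<open>g(\<^sup>ec)z\<close>.\<close>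

lemma (in char_p_cring) tight_interior_subset_big_test_ideal:
  "tight_interior p R (ring_module R) \<subseteq> big_test_ideal p R"
proof
  fix r assume r: "r \<in> tight_interior p R (ring_module R)"
  have rc: "r \<in> carrier R" using tight_interior_carrier[OF module_ring r] by simp
  have "r \<odot>\<^bsub>N\<^esub> z = \<zero>\<^bsub>N\<^esub>" if N: "module R N" and z: "z \<in> tight_closure_zero p R N" for N :: "('a, 'a list) module" and z
  proof -
    interpret N: module R N by (rule N)
    obtain c e0 where zN: "z \<in> carrier N" and c: "c \<in> off_minimal_primes R"
      and pt: "\<And>e. e0 \<le> e \<Longrightarrow> pure_tensor R (Fr e) N c z = \<one>\<^bsub>tensor_product R (Fr e) N\<^esub>"
      using z unfolding tight_closure_zero_def by blast
    have cc: "c \<in> carrier R" using off_minimal_primes_carrier[OF c] .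
    have kill: "g c \<odot>\<^bsub>N\<^esub> z = \<zero>\<^bsub>N\<^esub>" if e: "e0 \<le> e" and g: "g \<in> Hom_module R (Fr e) (ring_module R)" for e g
    proof -
      interpret Fe: module R "Fr e" by simp
      note gh = Hom_moduleD[OF g]
      have "frag_of (c, z) \<in> tensor_kernel R (Fr e) N"
        using pure_tensor_eq_one_iff[OF Fe.a_closed Fe.smult_closed N, of c z] pt[OF e] cc zN by simp
      from bilinear_map_kills_tensor_kernel[OF module_Fr N N _ _ _ _ _ zN this, of "\<lambda>x y. g x \<odot>\<^bsub>N\<^esub> y"]
      show ?thesis
        using gh cc by (simp add: N.smult_l_distr N.smult_r_distr N.smult_assoc1[symmetric] m_comm)
    qed
    let ?H = "{s \<in> carrier R. s \<odot>\<^bsub>N\<^esub> z = \<zero>\<^bsub>N\<^esub>}"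
    have "tight_interior_at p R (ring_module R) c e0 \<subseteq> ?H"
    proof (rule tight_interior_at_least[OF module_ring])
      show "g c \<in> ?H" if "e0 \<le> e" "g \<in> Hom_module R (Fr e) (ring_module R)" for e g
        using kill[OF that] Hom_moduleD(1)[OF that(2), of c] cc by simp
    qed (use zN in \<open>auto simp: N.smult_l_distr\<close>)
    then show ?thesis using r c unfolding tight_interior_def by blast
  qed
  then show "r \<in> big_test_ideal p R" using rc by (simp add: big_test_ideal_def annihilator_def)
qed

text \<open>The module \<open>N\<close> is universal for the vanishing of \<open>\<^sup>ed \<otimes> z\<close> for all \<open>e \<ge> e0\<close>. For each \<open>e\<close> choose finitely
  many generators \<open>x \<in> A e\<close> of \<open>\<^sup>eR\<close>, among them \<open>d\<close>, and finitely many generators \<open>g \<in> G e\<close> of the relations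
  between them. Besides \<open>z\<close>, take symbols \<open>y\<^bsub>e,g\<^esub>\<close>, and for \<open>x \<in> A e\<close> let \<open>\<rho>\<^bsub>e,x\<^esub>\<close> be the sum of all \<open>g x \<cdot> y\<^bsub>e,g\<^esub>\<close>.
  Imposing \<open>\<rho>\<^bsub>e,x\<^esub> = 0\<close> for \<open>x \<noteq> d\<close> and \<open>\<rho>\<^bsub>e,d\<^esub> = z\<close> makes all \<open>\<^sup>ed \<otimes> z\<close> vanish.

  If \<open>rz = 0\<close> in \<open>N\<close>, then \<open>r\<close> times the symbol \<open>z\<close> is a combination of these relations, with coefficients \<open>v\<^bsub>e,x\<^esub>\<close> say. Comparing the
  coordinates at \<open>y\<^bsub>e,g\<^esub>\<close> shows that \<open>v\<^bsub>e,_\<^esub>\<close> is orthogonal to every \<open>g \<in> G e\<close>, that is, it extends to a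
  linear map \<open>\<phi>\<^bsub>e\<^esub> : \<^sup>eR \<rightarrow> R\<close>. Comparing the coordinates at \<open>z\<close> shows that \<open>r\<close> is up to sign the sum of the
  \<open>v\<^bsub>e,d\<^esub> = \<phi>\<^bsub>e\<^esub>(\<^sup>ed)\<close>, and this lies in \<open>R\<^sub>*[d, e0]\<close>.

  In the proof the symbols are coordinates of a function: \<open>None\<close> for \<open>z\<close>, which is represented by \<open>\<zeta>\<close>, and
  \<open>Some (e, g)\<close> for \<open>y\<^bsub>e,g\<^esub>\<close>, which is represented by \<open>\<delta> e g\<close>. The sign in \<open>\<zeta>\<close> turns the relation
  \<open>\<rho>\<^bsub>e,d\<^esub> - z\<close> into the vector \<open>\<eta>\<close> with entry 1 at \<open>None\<close>.\<close>

lemma (in char_p_cring) tight_closure_zero_realizes_tight_interior_at: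
  assumes F: "F_finite p R" and d: "d \<in> off_minimal_primes R"
  shows "\<exists>(N :: ('a, (nat \<times> ('a \<Rightarrow> 'a)) option \<Rightarrow> 'a) module) z. module R N \<and> z \<in> tight_closure_zero p R N \<and>
    (\<forall>r\<in>carrier R. r \<odot>\<^bsub>N\<^esub> z = \<zero>\<^bsub>N\<^esub> \<longrightarrow> r \<in> tight_interior_at p R (ring_module R) d e0)"
proof -
  have dc: "d \<in> carrier R" using off_minimal_primes_carrier[OF d] .
  have "\<forall>e. \<exists>A. finite A \<and> generating_set R (Fr e) A" using finitely_generated_Fr[OF F] by blast
  then obtain A0 where A0: "\<And>e. finite (A0 e)" "\<And>e. generating_set R (Fr e) (A0 e)" by metis
  define A where "A e = insert d (A0 e)" for e
  have A: "finite (A e)" "generating_set R (Fr e) (A e)" "d \<in> A e" "A e \<subseteq> carrier (Fr e)" for e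
    using A0 dc by (auto simp: A_def generating_set_def)
  have t: "\<And>e x. x \<in> A e \<Longrightarrow> x \<in> carrier (Fr e)" using A(4) by blast
  have syz: "submodule (syzygies R (Fr e) (A e)) R (fun_module R)" for e
    unfolding syzygies_def
    by (rule submodule_Hom_kernel[OF module_fun_module[OF is_cring] module_Fr Hom_lincomb[OF module_Fr t A(1)]])
  have "\<forall>e. \<exists>G. finite G \<and> G \<subseteq> syzygies R (Fr e) (A e) \<and> (\<forall>H. submodule H R (fun_module R) \<longrightarrow> G \<subseteq> H \<longrightarrow>
      (\<forall>f\<in>syzygies R (Fr e) (A e). \<exists>h\<in>H. \<forall>x\<in>A e. f x = h x))"
    using fun_submodule_finitely_generated[OF A(1) syz] by (rule allI)
  from choice[OF this] obtain G where *: "\<forall>e. finite (G e) \<and> G e \<subseteq> syzygies R (Fr e) (A e) \<and>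
      (\<forall>H. submodule H R (fun_module R) \<longrightarrow> G e \<subseteq> H \<longrightarrow>
      (\<forall>f\<in>syzygies R (Fr e) (A e). \<exists>h\<in>H. \<forall>x\<in>A e. f x = h x))" ..
  note G = *[THEN spec, THEN conjunct1] *[THEN spec, THEN conjunct2, THEN conjunct1]
    *[THEN spec, THEN conjunct2, THEN conjunct2]
  have gc: "g x \<in> carrier R" if "g \<in> G e" for g e x using G(2) that by (auto simp: syzygies_def)
  let ?F = "fun_module R :: ('a, (nat \<times> ('a \<Rightarrow> 'a)) option \<Rightarrow> 'a) module"
  have mF: "module R ?F" by (rule module_fun_module[OF is_cring])
  interpret F: module R ?F by (rule mF)
  interpret RM: module R "ring_module R" by (rule module_ring)
  define row where "row v e g = lincomb (ring_module R) (A e) g (v e)" for v :: "nat \<Rightarrow> 'a \<Rightarrow> 'a" and e g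
  have row_hom: "lincomb (ring_module R) (A e) g \<in> Hom_module R (fun_module R) (ring_module R)" if "g \<in> G e" for e g
    by (rule Hom_lincomb[OF module_ring _ A(1)]) (simp add: gc[OF that])
  \<comment> \<open>\<open>f\<close> is a combination of the relations, \<open>v e x\<close> being the coefficient at \<open>(e, x)\<close>. The coefficients at
    \<open>d\<close> vanish off the finite set \<open>E\<close>, so that they have a sum; those at \<open>x \<noteq> d\<close> may be nonzero for
    infinitely many \<open>e\<close>. Coordinates that belong to none of the symbols are arbitrary, hence divided out.\<close>
  define combined where "combined f v E \<longleftrightarrow> finite E \<and> E \<subseteq> {e0..} \<and> (\<forall>e x. v e x \<in> carrier R) \<and> (\<forall>e. e \<notin> E \<longrightarrow> v e d = \<zero>) \<and>
    f None = (\<Oplus>\<^bsub>ring_module R\<^esub>e\<in>E. v e d) \<and> (\<forall>e\<ge>e0. \<forall>g\<in>G e. f (Some (e, g)) = row v e g)" for f v E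
  define V where "V = {f \<in> carrier ?F. \<exists>v E. combined f v E}"
  have V: "submodule V R ?F"
  proof (rule F.submodule_criterion)
    show "V \<subseteq> carrier ?F" by (auto simp: V_def)
    have "row (\<lambda>_ _. \<zero>) e g = \<zero>" if "g \<in> G e" for e g
      unfolding row_def using lincomb_zero[OF module_ring _ A(1), of e g] gc[OF that] by simp
    then have "combined (\<lambda>_. \<zero>) (\<lambda>_ _. \<zero>) {}" by (simp add: combined_def)
    then show "\<zero>\<^bsub>?F\<^esub> \<in> V" by (auto simp: V_def)
  next
    fix f f' assume "f \<in> V" "f' \<in> V"
    then obtain v E v' E' where f: "f \<in> carrier ?F" "combined f v E" and f': "f' \<in> carrier ?F" "combined f' v' E'"
      by (auto simp: V_def)
    have vc: "v e x \<in> carrier R" "v' e x \<in> carrier R" for e x using f f' by (auto simp: combined_def)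
    have E: "finite E" "finite E'" "E \<subseteq> {e0..}" "E' \<subseteq> {e0..}" "\<And>e. e \<notin> E \<Longrightarrow> v e d = \<zero>" "\<And>e. e \<notin> E' \<Longrightarrow> v' e d = \<zero>"
      using f f' by (auto simp: combined_def)
    have "(\<Oplus>\<^bsub>ring_module R\<^esub>e\<in>E. v e d) = (\<Oplus>\<^bsub>ring_module R\<^esub>e\<in>E \<union> E'. v e d)"
      by (rule RM.M.add.finprod_mono_neutral_cong_left) (use E vc in auto)
    moreover have "(\<Oplus>\<^bsub>ring_module R\<^esub>e\<in>E'. v' e d) = (\<Oplus>\<^bsub>ring_module R\<^esub>e\<in>E \<union> E'. v' e d)"
      by (rule RM.M.add.finprod_mono_neutral_cong_left) (use E vc in auto)
    moreover have "(\<Oplus>\<^bsub>ring_module R\<^esub>e\<in>E \<union> E'. v e d \<oplus> v' e d) =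
        (\<Oplus>\<^bsub>ring_module R\<^esub>e\<in>E \<union> E'. v e d) \<oplus> (\<Oplus>\<^bsub>ring_module R\<^esub>e\<in>E \<union> E'. v' e d)"
      using RM.M.finsum_addf[of "\<lambda>e. v e d" "E \<union> E'" "\<lambda>e. v' e d"] vc by simp
    ultimately have N: "f None \<oplus> f' None = (\<Oplus>\<^bsub>ring_module R\<^esub>e\<in>E \<union> E'. v e d \<oplus> v' e d)"
      using f f' by (simp add: combined_def)
    have "row (\<lambda>e x. v e x \<oplus> v' e x) e g = row v e g \<oplus> row v' e g" if "g \<in> G e" for e g
      unfolding row_def using Hom_moduleD(2)[OF row_hom[OF that], of "v e" "v' e"] vc by simp
    then have "combined (\<lambda>i. f i \<oplus> f' i) (\<lambda>e x. v e x \<oplus> v' e x) (E \<union> E')"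
      using f f' E vc N by (auto simp: combined_def)
    then show "f \<oplus>\<^bsub>?F\<^esub> f' \<in> V" using f f' by (auto simp: V_def)
  next
    fix r f assume r: "r \<in> carrier R" and "f \<in> V"
    then obtain v E where f: "f \<in> carrier ?F" "combined f v E" by (auto simp: V_def)
    have vc: "v e x \<in> carrier R" for e x using f by (auto simp: combined_def)
    have E: "finite E" using f by (auto simp: combined_def)
    have N: "r \<otimes> f None = (\<Oplus>\<^bsub>ring_module R\<^esub>e\<in>E. r \<otimes> v e d)"
      using f RM.finsum_smult_ldistr[OF E r, of "\<lambda>e. v e d"] vc by (simp add: combined_def)
    have "row (\<lambda>e x. r \<otimes> v e x) e g = r \<otimes> row v e g" if "g \<in> G e" for e g
      unfolding row_def using Hom_moduleD(3)[OF row_hom[OF that] r, of "v e"] vc by simp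
    then have "combined (\<lambda>i. r \<otimes> f i) (\<lambda>e x. r \<otimes> v e x) E"
      using f E vc N r by (auto simp: combined_def)
    then show "r \<odot>\<^bsub>?F\<^esub> f \<in> V" using f r by (auto simp: V_def)
  qed
  obtain N \<pi> where N: "module R (N :: ('a, (nat \<times> ('a \<Rightarrow> 'a)) option \<Rightarrow> 'a) module)" "\<pi> \<in> Hom_module R ?F N"
    "\<And>f. f \<in> carrier ?F \<Longrightarrow> \<pi> f = \<zero>\<^bsub>N\<^esub> \<longleftrightarrow> f \<in> V"
    using quotient_module_exists[OF mF V] by blast
  interpret N: module R N by (rule N(1))
  note \<pi>h = Hom_moduleD[OF N(2)]
  define \<rho> where "\<rho> e x i = (case i of None \<Rightarrow> \<zero> | Some (e', g) \<Rightarrow> if e' = e \<and> g \<in> G e then g x else \<zero>)"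
    for e x and i :: "(nat \<times> ('a \<Rightarrow> 'a)) option"
  define \<zeta> where "\<zeta> i = (if i = None then \<ominus> \<one> else \<zero>)" for i :: "(nat \<times> ('a \<Rightarrow> 'a)) option"
  define \<delta> where "\<delta> e g i = (if i = Some (e, g) then \<one> else \<zero>)" for e g and i :: "(nat \<times> ('a \<Rightarrow> 'a)) option"
  define u where "u e x = (\<lambda>e' x'. if e' = e \<and> x' = x then \<one> else \<zero>)" for e :: nat and x :: 'a
  have \<rho>c: "\<rho> e x \<in> carrier ?F" for e x by (auto simp: \<rho>_def gc split: option.split)
  have \<zeta>c: "\<zeta> \<in> carrier ?F" by (auto simp: \<zeta>_def)
  have \<delta>c: "\<delta> e g \<in> carrier ?F" for e g by (auto simp: \<delta>_def)
  have row_u: "row (u e x) e' g = (if e' = e then g x else \<zero>)" if x: "x \<in> A e" and g: "g \<in> G e'" for e x e' g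
  proof (cases "e' = e")
    case True
    then show ?thesis
      unfolding row_def u_def using lincomb_unit[OF module_ring _ A(1) x, of g] gc[OF g] by simp
  next
    case False
    then show ?thesis
      unfolding row_def u_def using lincomb_zero[OF module_ring _ A(1), of e' g] gc[OF g] by simp
  qed
  have \<pi>\<rho>: "\<pi> (\<rho> e x) = \<zero>\<^bsub>N\<^esub>" if e: "e0 \<le> e" and x: "x \<in> A e" "x \<noteq> d" for e x
  proof -
    have "combined (\<rho> e x) (u e x) {}"
      using x row_u by (auto simp: combined_def \<rho>_def u_def)
    then show ?thesis using N(3)[OF \<rho>c] \<rho>c by (auto simp: V_def)
  qed
  have \<pi>\<rho>d: "\<pi> (\<rho> e d) = \<pi> \<zeta>" if e: "e0 \<le> e" for e
  proof -
    define \<eta> where "\<eta> i = (if i = None then \<one> else \<rho> e d i)" for i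
    have \<eta>c: "\<eta> \<in> carrier ?F" using \<rho>c by (auto simp: \<eta>_def)
    have "(\<Oplus>\<^bsub>ring_module R\<^esub>e'\<in>{e}. u e d e' d) = \<one>" by (simp add: u_def RM.M.finsum_insert)
    then have "combined \<eta> (u e d) {e}"
      using e A(3) row_u by (auto simp: combined_def \<eta>_def \<rho>_def u_def)
    then have "\<pi> \<eta> = \<zero>\<^bsub>N\<^esub>" using N(3)[OF \<eta>c] \<eta>c by (auto simp: V_def)
    moreover have "\<rho> e d = \<eta> \<oplus>\<^bsub>?F\<^esub> \<zeta>"
      using \<rho>c[of e d] by (auto simp: \<eta>_def \<zeta>_def fun_eq_iff r_neg) (simp add: \<rho>_def)
    ultimately show ?thesis using \<pi>h(2)[OF \<eta>c \<zeta>c] \<pi>h(1)[OF \<zeta>c] by simp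
  qed
  have \<rho>_sum: "\<pi> (\<rho> e x) = lincomb N (G e) (\<lambda>g. \<pi> (\<delta> e g)) (\<lambda>g. g x)" for e x
  proof -
    have c: "g x \<odot>\<^bsub>?F\<^esub> \<delta> e g \<in> carrier ?F" if "g \<in> G e" for g using gc[OF that] \<delta>c by auto
    have "(\<Oplus>\<^bsub>?F\<^esub>g\<in>G e. g x \<odot>\<^bsub>?F\<^esub> \<delta> e g) i = \<rho> e x i" for i
    proof -
      have ev: "(\<Oplus>\<^bsub>?F\<^esub>g\<in>G e. g x \<odot>\<^bsub>?F\<^esub> \<delta> e g) i = (\<Oplus>\<^bsub>ring_module R\<^esub>g\<in>G e. g x \<otimes> \<delta> e g i)"
        using Hom_module_finsum[OF mF module_ring Hom_evaluation, of "G e" "\<lambda>g. g x \<odot>\<^bsub>?F\<^esub> \<delta> e g" i] c by simp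
      show ?thesis
      proof (cases "\<exists>g\<in>G e. i = Some (e, g)")
        case True
        then obtain g where g: "g \<in> G e" "i = Some (e, g)" by blast
        have "(\<Oplus>\<^bsub>ring_module R\<^esub>g'\<in>G e. g' x \<otimes> \<delta> e g' i) = (\<Oplus>\<^bsub>ring_module R\<^esub>g'\<in>G e. if g = g' then g' x else \<zero>\<^bsub>ring_module R\<^esub>)"
          using gc g by (intro RM.M.finsum_cong') (auto simp: \<delta>_def)
        also have "\<dots> = g x" using G(1) g gc by (subst RM.M.add.finprod_singleton) auto
        finally show ?thesis using g ev by (simp add: \<rho>_def)
      next
        case False
        have "(\<Oplus>\<^bsub>ring_module R\<^esub>g'\<in>G e. g' x \<otimes> \<delta> e g' i) = (\<Oplus>\<^bsub>ring_module R\<^esub>g'\<in>G e. \<zero>\<^bsub>ring_module R\<^esub>)"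
          using gc False by (intro RM.M.finsum_cong') (auto simp: \<delta>_def)
        moreover have "\<rho> e x i = \<zero>" using False by (auto simp: \<rho>_def split: option.split)
        ultimately show ?thesis using ev by (simp add: RM.M.finsum_zero del: ring_module_simps) simp
      qed
    qed
    then have "\<rho> e x = (\<Oplus>\<^bsub>?F\<^esub>g\<in>G e. g x \<odot>\<^bsub>?F\<^esub> \<delta> e g)" by (simp add: fun_eq_iff)
    then have "\<pi> (\<rho> e x) = (\<Oplus>\<^bsub>N\<^esub>g\<in>G e. \<pi> (g x \<odot>\<^bsub>?F\<^esub> \<delta> e g))"
      using Hom_module_finsum[OF mF N(1,2), of "G e" "\<lambda>g. g x \<odot>\<^bsub>?F\<^esub> \<delta> e g"] c by simp
    also have "\<dots> = lincomb N (G e) (\<lambda>g. \<pi> (\<delta> e g)) (\<lambda>g. g x)"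
      unfolding lincomb_def by (rule N.finsum_cong') (use \<pi>h(1,3) gc \<delta>c in auto)
    finally show ?thesis .
  qed
  have "frag_of (d, \<pi> \<zeta>) \<in> tensor_kernel R (Fr e) N" if e: "e0 \<le> e" for e
    unfolding \<pi>\<rho>d[OF e, symmetric]
    by (rule tensor_vanishes_by_syzygies[OF module_Fr N(1) A(1) A(4) G(1,2) \<pi>h(1)[OF \<delta>c] \<rho>_sum \<pi>\<rho>[OF e] A(3)])
  then have "pure_tensor R (Fr e) N d (\<pi> \<zeta>) = \<one>\<^bsub>tensor_product R (Fr e) N\<^esub>" if "e0 \<le> e" for e
  proof -
    interpret Fe: module R "Fr e" by simp
    show ?thesis
      using pure_tensor_eq_one_iff[OF Fe.a_closed Fe.smult_closed N(1), of d "\<pi> \<zeta>"] dc \<pi>h(1)[OF \<zeta>c]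
        \<open>\<And>e. e0 \<le> e \<Longrightarrow> frag_of (d, \<pi> \<zeta>) \<in> tensor_kernel R (Fr e) N\<close>[OF that] by simp
  qed
  then have z: "\<pi> \<zeta> \<in> tight_closure_zero p R N"
    unfolding tight_closure_zero_def using d \<pi>h(1)[OF \<zeta>c] by blast
  let ?J = "tight_interior_at p R (ring_module R) d e0"
  note Jp = RM.submodule_props[OF submodule_tight_interior_at[OF module_ring dc, of e0]]
  have "s \<in> ?J" if s: "s \<in> carrier R" "s \<odot>\<^bsub>N\<^esub> \<pi> \<zeta> = \<zero>\<^bsub>N\<^esub>" for s
  proof -
    have s\<zeta>: "s \<odot>\<^bsub>?F\<^esub> \<zeta> \<in> carrier ?F" using s \<zeta>c by auto
    have "\<pi> (s \<odot>\<^bsub>?F\<^esub> \<zeta>) = \<zero>\<^bsub>N\<^esub>" using \<pi>h(3)[OF s(1) \<zeta>c] s(2) by simp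
    then have "s \<odot>\<^bsub>?F\<^esub> \<zeta> \<in> V" using N(3)[OF s\<zeta>] by blast
    then obtain v E where combined: "combined (s \<odot>\<^bsub>?F\<^esub> \<zeta>) v E" by (auto simp: V_def)
    have vc: "v e x \<in> carrier R" for e x using combined by (auto simp: combined_def)
    have row0: "row v e g = \<zero>" if "e0 \<le> e" "g \<in> G e" for e g
      using combined that s(1) by (auto simp: combined_def \<zeta>_def)
    have vJ: "v e d \<in> ?J" if e: "e0 \<le> e" for e
    proof -
      have "\<exists>\<phi>\<in>Hom_module R (Fr e) (ring_module R). \<phi> d = v e d"
      proof (rule functional_from_syzygies[OF is_cring module_Fr A(1,2) _ G(2) vc _ A(3)])
        show "\<exists>h\<in>H. \<forall>x\<in>A e. f x = h x"
          if "submodule H R (fun_module R)" "G e \<subseteq> H" "f \<in> syzygies R (Fr e) (A e)" for H f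
          using G(3)[of e] that by simp
        show "lincomb (ring_module R) (A e) g (v e) = \<zero>" if "g \<in> G e" for g
          using row0[OF e that] by (simp add: row_def)
      qed
      then obtain \<phi> where "\<phi> \<in> Hom_module R (Fr e) (ring_module R)" "\<phi> d = v e d" by blast
      then show ?thesis using tight_interior_atI[OF module_ring dc _ e, of \<phi>] by simp
    qed
    have "(\<Oplus>\<^bsub>ring_module R\<^esub>e\<in>E. v e d) \<in> ?J"
      by (rule RM.submodule_finsum[OF submodule_tight_interior_at[OF module_ring dc]])
        (use combined vJ in \<open>auto simp: combined_def\<close>)
    then have "s \<otimes> \<ominus> \<one> \<in> ?J" using combined by (simp add: combined_def \<zeta>_def)
    then have "(\<ominus> \<one>) \<otimes> (s \<otimes> \<ominus> \<one>) \<in> ?J" using Jp(5)[of "\<ominus> \<one>"] by simp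
    then show ?thesis using s(1) by (simp add: l_minus r_minus)
  qed
  then show ?thesis using N(1) z by blast
qed

lemma (in char_p_cring) big_test_ideal_eq_tight_interior:
  assumes F: "F_finite p R"
  shows "big_test_ideal p R = tight_interior p R (ring_module R)"
proof
  show "big_test_ideal p R \<subseteq> tight_interior p R (ring_module R)"
  proof
    fix r assume r: "r \<in> big_test_ideal p R"
    have rc: "r \<in> carrier R" using r by (simp add: big_test_ideal_def)
    have "r \<in> tight_interior_at p R (ring_module R) d e0" if d: "d \<in> off_minimal_primes R" for d e0
    proof -
      obtain N :: "('a, (nat \<times> ('a \<Rightarrow> 'a)) option \<Rightarrow> 'a) module" and z
        where N: "module R N" "z \<in> tight_closure_zero p R N"
          "\<forall>r\<in>carrier R. r \<odot>\<^bsub>N\<^esub> z = \<zero>\<^bsub>N\<^esub> \<longrightarrow> r \<in> tight_interior_at p R (ring_module R) d e0"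
        using tight_closure_zero_realizes_tight_interior_at[OF F d] by blast
      have "r \<odot>\<^bsub>N\<^esub> z = \<zero>\<^bsub>N\<^esub>"
        using big_test_ideal_universal[OF N(1) r] N(2) by (simp add: annihilator_def)
      then show ?thesis using N(3) rc by blast
    qed
    then show "r \<in> tight_interior p R (ring_module R)" by (simp add: tight_interior_def)
  qed
qed (rule tight_interior_subset_big_test_ideal)

lemma module_support_ring_module:
  assumes "cring S"
  shows "module_support S (ring_module S) = prime_spec S"
proof -
  interpret cring S by fact
  have "localization (ring_module S) (carrier S - P) \<noteq>
      {frac_rel (ring_module S) (carrier S - P) `` {(\<zero>\<^bsub>ring_module S\<^esub>, \<one>\<^bsub>S\<^esub>)}}" if P: "primeideal P S" for P
  proof
    interpret P: primeideal P S by fact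
    let ?U = "carrier S - P" and ?r = "frac_rel (ring_module S) (carrier S - P)"
    assume eq: "localization (ring_module S) ?U = {?r `` {(\<zero>\<^bsub>ring_module S\<^esub>, \<one>\<^bsub>S\<^esub>)}}"
    have one: "\<one>\<^bsub>S\<^esub> \<in> ?U" using P.one_imp_carrier P.I_notcarr by auto
    then have "?r `` {(\<one>\<^bsub>S\<^esub>, \<one>\<^bsub>S\<^esub>)} \<in> localization (ring_module S) ?U"
      unfolding localization_def by (intro quotientI) simp
    then have "?r `` {(\<one>\<^bsub>S\<^esub>, \<one>\<^bsub>S\<^esub>)} = ?r `` {(\<zero>\<^bsub>S\<^esub>, \<one>\<^bsub>S\<^esub>)}" using eq by simp
    moreover have "(\<one>\<^bsub>S\<^esub>, \<one>\<^bsub>S\<^esub>) \<in> ?r `` {(\<one>\<^bsub>S\<^esub>, \<one>\<^bsub>S\<^esub>)}" using one by (auto simp: frac_rel_def)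
    ultimately have "(\<one>\<^bsub>S\<^esub>, \<one>\<^bsub>S\<^esub>) \<in> ?r `` {(\<zero>\<^bsub>S\<^esub>, \<one>\<^bsub>S\<^esub>)}" by simp
    then obtain u where "u \<in> ?U" "u = \<zero>\<^bsub>S\<^esub>" by (auto simp: frac_rel_def)
    then show False using P.zero_closed by simp
  qed
  then show ?thesis by (auto simp: module_support_def prime_spec_def)
qed

lemma fg_module_ring_module:
  assumes "cring S" shows "fg_module S (ring_module S)"
proof -
  interpret cring S by fact
  interpret SM: module S "ring_module S" by (rule module_ring_module) fact
  have "x \<in> H" if H: "submodule H S (ring_module S)" "{\<one>\<^bsub>S\<^esub>} \<subseteq> H" and x: "x \<in> carrier S" for H x
    using SM.submodule_props(5)[OF H(1) x, of "\<one>\<^bsub>S\<^esub>"] H(2) x by simp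
  then have "generating_set S (ring_module S) {\<one>\<^bsub>S\<^esub>}" by (auto simp: generating_set_def)
  then show ?thesis unfolding fg_module_iff using SM.module_axioms by blast
qed

theorem corollary6p5:
  fixes p :: nat
    and R S :: "'a ring"
    and L :: "('a, 'l) module"
    and M :: "('a, 'm) module"
  assumes "char_p_ring p R" and "char_p_ring p S"
    and "F_finite p R" and "reduced_ring R"
    and "finite_extension R S" and "reduced_ring S"
  shows "(fg_module R L \<and> module_support R L = prime_spec R \<and>
          fg_module S M \<and> module_support S M = prime_spec S \<longrightarrow>
            tight_interior p R L =
              submodule_sum L (UNIV :: nat set) (\<lambda>e.
                submodule_sum L (Hom_module R (frob_module p e R M) L) (\<lambda>\<phi>.
                  \<phi> ` tight_interior p S M))) \<and>
         big_test_ideal p R =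
           submodule_sum (ring_module R) (UNIV :: nat set) (\<lambda>e.
             submodule_sum (ring_module R)
               (Hom_module R (frob_module p e R (ring_module S)) (ring_module R)) (\<lambda>\<phi>.
                 \<phi> ` big_test_ideal p S))"
proof -
  have char: "char_p_cring T p" if T: "char_p_ring p T" for T :: "'a ring"
    using T by (intro char_p_cring.intro noetherian_cring.intro char_p_cring_axioms.intro)
      (simp_all add: char_p_ring_def)
  interpret R: char_p_cring R p by (rule char[OF assms(1)])
  interpret S: char_p_cring S p by (rule char[OF assms(2)])
  have FS: "F_finite p S"
    by (rule F_finite_finite_extension[OF R.char_p_cring_axioms S.char_p_cring_axioms assms(3,5)])
  interpret F_finite_reduced_extension R S p
    by unfold_locales (use assms FS in auto)
  show ?thesis
  proof (intro conjI impI)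
    assume "fg_module R L \<and> module_support R L = prime_spec R \<and>
      fg_module S M \<and> module_support S M = prime_spec S"
    then show "tight_interior p R L =
        submodule_sum L (UNIV :: nat set) (\<lambda>e.
          submodule_sum L (Hom_module R (frob_module p e R M) L) (\<lambda>\<phi>. \<phi> ` tight_interior p S M))"
      by (intro tight_interior_finite_extension) (simp_all add: fg_module_def)
  next
    show "big_test_ideal p R =
        submodule_sum (ring_module R) (UNIV :: nat set) (\<lambda>e.
          submodule_sum (ring_module R) (Hom_module R (frob_module p e R (ring_module S)) (ring_module R))
            (\<lambda>\<phi>. \<phi> ` big_test_ideal p S))"
      unfolding R.big_test_ideal_eq_tight_interior[OF assms(3)] S.big_test_ideal_eq_tight_interior[OF FS]
      by (rule tight_interior_finite_extension[OF R.module_ring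
            fg_module_ring_module[OF S.is_cring] module_support_ring_module[OF S.is_cring]])
  qed
qed

end
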